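(* For all $r$-tuples of partitions $(\mu^{(1)}|\cdots|\mu^{(r)})$ and $(\lambda^{(1)}|\cdots|\lambda^{(r)})$, $$K^{(\lambda^{(1)}|\cdots|\lambda^{(r)})}_{(\mu^{(1)}|\cdots|\mu^{(r)})}=\left|\mathcal{L}_{(\mu^{(1)}|\cdots|\mu^{(r)})}(\lambda^{(1)}|\cdots|\lambda^{(r)})\right|.$$
   Context: Key polynomials $\mathcal{K}_\alpha$ ($\alpha\in\mathbb{Z}_{\ge0}^n$): the unique polynomials with $\mathcal{K}_\alpha=x^\alpha$ if $\alpha$ is weakly decreasing and $\mathcal{K}_{s_i\alpha}=\xi_i\mathcal{K}_\alpha$ whenever $\alpha_i>\alpha_{i+1}$, where $\xi_i f=\frac{x_if-x_{i+1}s_if}{x_i-x_{i+1}}$ and $s_i$ swaps positions/variables $i,i+1$. For a partition $\lambda$, $\mathrm{rev}(\lambda)=(\lambda_{\ell(\lambda)},\dots,\lambda_1)$; $*$ is concatenation, $0^m$ is $m$ zeros. The multi-symmetric Schur function $\mathcal{S}_{(\lambda^{(1)}|\cdots|\lambda^{(r)})}(X_1|\cdots|X_r)$ is the coefficientwise limit as $n_1,\dots,n_r\to\infty$ of $\mathcal{K}_\gamma(x_{1,1},\dots,x_{1,n_1},\dots,x_{r,1},\dots,x_{r,n_r})$, $\gamma=(0^{n_1-\ell(\lambda^{(1)})}*\mathrm{rev}(\lambda^{(1)}))*\cdots*(0^{n_r-\ell(\lambda^{(r)})}*\mathrm{rev}(\lambda^{(r)}))$; it lies in $\Lambda(X_1|\cdots|X_r)=\Lambda(X_1)\otimes\cdots\otimes\Lambda(X_r)$.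 The multi-symmetric Kostka coefficients are defined by $\mathcal{S}_{(\lambda)}=\sum_{(\mu)}K^{(\lambda)}_{(\mu)}m_{\mu^{(1)}}(X_1)\cdots m_{\mu^{(r)}}(X_r)$. Diagrams and fillings: for a composition $\mu$, $dg'(\mu)=\{(i,j):1\le j\le\mu_i\}$, $\widehat{dg}(\mu)=dg'(\mu)\cup\{(i,0)\}$. Distinct boxes attack if in the same row, or in consecutive rows with the lower box strictly to the right of the upper one. A co-inversion triple for a labeling $\tau$ of $\widehat{dg}(\mu)$ is $(u,v,w)$ with $u=(i,j)$, $j\ge1$, $w=(i,j-1)$, and either $v=(i',j-1)$, $i'>i$, $\mu_{i'}<\mu_i$, or $v=(i',j)$, $i'<i$, $\mu_{i'}\le\mu_i$, with $\tau(u)<\tau(v)<\tau(w)$ or $\tau(v)<\tau(w)<\tau(u)$ or $\tau(w)<\tau(u)<\tau(v)$. Alphabet: $k_j$ ($k\ge1$, $1\le j\le r$) and $\omega_j+k$ ($k\ge0$), ordered by: within index $j$, $a_j<b_j$ iff $a<b$, all $a_j<\omega_j+k$, $\omega_j+k<\omega_j+k'$ iff $k<k'$; all elements of index $j$ precede all of index $j'>j$. $\mathcal{L}(\lambda^{(1)}|\cdots|\lambda^{(r)})$ is the set of maps $\sigma:dg'(\mathrm{rev}(\lambda^{(1)})*\cdots*\mathrm{rev}(\lambda^{(r)}))\to\{k_j\}$ whose extension $\sigma^\star$ with basement labels $\sigma^\star(\ell(\lambda^{(1)})+\cdots+\ell(\lambda^{(i-1)})+j,0)=\omega_i+j-1$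 is non-attacking, weakly decreasing upwards in columns, and has no co-inversion triples. $\mathcal{L}_{(\mu^{(1)}|\cdots|\mu^{(r)})}(\lambda^{(1)}|\cdots|\lambda^{(r)})$ is the subset of those $\sigma$ with $|\sigma^{-1}(k_j)|=\mu^{(j)}_k$ for all $1\le j\le r$ and all $k\ge1$ (with $\mu^{(j)}_k=0$ for $k>\ell(\mu^{(j)})$). *)

theory Defs
  imports "HOL-Library.Poly_Mapping" "HOL-Library.Multiset" "HOL-Library.FuncSet"
    "HOL-Combinatorics.Transposition" Complex_Main
begin

text \<open>
  Conventions.  List positions are zero-based throughout: the blocks \<open>X\<^sub>1, \<dots>, X\<^sub>r\<close> are numbered
  \<open>0, \<dots>, r - 1\<close>, the variables \<open>x\<^sub>1, x\<^sub>2, \<dots>\<close> of a polynomial are numbered \<open>0, 1, \<dots>\<close>, and the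
  pair \<open>(j, k)\<close> names the variable \<open>x\<^bsub>j+1,k+1\<^esub>\<close> of the block \<open>X\<^bsub>j+1\<^esub>\<close>.  In a diagram the column
  \<open>i\<close> is zero-based, whereas the row \<open>j\<close> counts from 1, row 0 being the basement.
\<close>

section \<open>Partitions and compositions\<close>

definition is_partition :: "nat list \<Rightarrow> bool" where
  "is_partition p \<longleftrightarrow> sorted_wrt (\<ge>) p \<and> 0 \<notin> set p"

definition partition_tuples :: "nat \<Rightarrow> nat list list set" where
  "partition_tuples r = {ps. length ps = r \<and> (\<forall>p \<in> set ps. is_partition p)}"

definition part :: "nat list \<Rightarrow> nat \<Rightarrow> nat" where
  "part p k = (if k < length p then p ! k else 0)"

section \<open>Key polynomials\<close>

type_synonym 'v monomial = "'v \<Rightarrow>\<^sub>0 nat"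
type_synonym 'v mpoly = "'v monomial \<Rightarrow>\<^sub>0 int"

definition var :: "'v \<Rightarrow> 'v mpoly" where
  "var v = Poly_Mapping.single (Poly_Mapping.single v 1) 1"

definition monom_of :: "nat list \<Rightarrow> nat mpoly" where
  "monom_of \<alpha> = (\<Prod>i<length \<alpha>. var i ^ (\<alpha> ! i))"

definition substitute :: "('u \<Rightarrow> 'v) \<Rightarrow> 'u mpoly \<Rightarrow> 'v mpoly" where
  "substitute h f =
     (\<Sum>m\<in>Poly_Mapping.keys f. Poly_Mapping.single 0 (Poly_Mapping.lookup f m) *
        (\<Prod>u\<in>Poly_Mapping.keys m. var (h u) ^ Poly_Mapping.lookup m u))"

definition swap_at :: "nat \<Rightarrow> nat list \<Rightarrow> nat list" where
  "swap_at i \<alpha> = \<alpha>[i := \<alpha> ! Suc i, Suc i := \<alpha> ! i]"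

text \<open>The quotient \<open>(x\<^sub>i f - x\<^bsub>i+1\<^esub> s\<^sub>i f) / (x\<^sub>i - x\<^bsub>i+1\<^esub>)\<close>; the division is exact, and the
  quotient is unique since polynomials over the integers form an integral domain.\<close>

definition \<xi> :: "nat \<Rightarrow> nat mpoly \<Rightarrow> nat mpoly" where
  "\<xi> i f = (THE g. (var i - var (Suc i)) * g =
     var i * f - var (Suc i) * substitute (transpose i (Suc i)) f)"

definition is_key_family :: "(nat list \<Rightarrow> nat mpoly) \<Rightarrow> bool" where
  "is_key_family K \<longleftrightarrow>
     (\<forall>\<alpha>. sorted_wrt (\<ge>) \<alpha> \<longrightarrow> K \<alpha> = monom_of \<alpha>) \<and>
     (\<forall>\<alpha> i. Suc i < length \<alpha> \<and> \<alpha> ! i > \<alpha> ! Suc i \<longrightarrow> K (swap_at i \<alpha>) = \<xi> i (K \<alpha>))"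

definition key_poly :: "nat list \<Rightarrow> nat mpoly" where
  "key_poly = (THE K. is_key_family K)"

section \<open>Multi-symmetric Schur functions\<close>

text \<open>Formal power series in the variables \<open>(j, k)\<close>, given by their coefficients.\<close>

type_synonym series = "(nat \<times> nat) monomial \<Rightarrow> int"

definition padded_rev :: "nat \<Rightarrow> nat list \<Rightarrow> nat list" where
  "padded_rev n p = replicate (n - length p) 0 @ rev p"

definition schur_index :: "(nat \<Rightarrow> nat) \<Rightarrow> nat list list \<Rightarrow> nat list" where
  "schur_index n ls = concat (map (\<lambda>j. padded_rev (n j) (ls ! j)) [0..<length ls])"

definition block_vars :: "nat \<Rightarrow> (nat \<Rightarrow> nat) \<Rightarrow> (nat \<times> nat) list" where
  "block_vars r n = concat (map (\<lambda>j. map (\<lambda>k. (j, k)) [0..<n j]) [0..<r])"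

text \<open>If \<open>n j \<ge> length (ls ! j)\<close> for all \<open>j\<close>, then \<open>schur_index n ls\<close> and
  \<open>block_vars (length ls) n\<close> have the same length.  Smaller \<open>n j\<close> are irrelevant to the limit.\<close>

definition schur_approx :: "nat list list \<Rightarrow> (nat \<Rightarrow> nat) \<Rightarrow> (nat \<times> nat) mpoly" where
  "schur_approx ls n =
     substitute (\<lambda>p. block_vars (length ls) n ! p) (key_poly (schur_index n ls))"

text \<open>The filter of \<open>n 0, \<dots>, n (r - 1)\<close> tending jointly to infinity.\<close>

definition all_at_top :: "nat \<Rightarrow> (nat \<Rightarrow> nat) filter" where
  "all_at_top r = (INF N. principal {n. \<forall>j<r. N \<le> n j})"

text \<open>The integers carry the discrete topology, so this limit is the eventual value.\<close>

definition multi_schur :: "nat list list \<Rightarrow> series" where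
  "multi_schur ls = (\<lambda>e. Lim (all_at_top (length ls)) (\<lambda>n. Poly_Mapping.lookup (schur_approx ls n) e))"

section \<open>Multi-symmetric Kostka coefficients\<close>

definition series_one :: series where
  "series_one e = (if e = 0 then 1 else 0)"

definition series_mult :: "series \<Rightarrow> series \<Rightarrow> series" where
  "series_mult f g e = (\<Sum>(a, b) | a + b = e. f a * g b)"

text \<open>The monomial symmetric function \<open>m\<^sub>\<mu>\<close> in the variables \<open>(j, 0), (j, 1), \<dots>\<close>: the sum of all
  distinct monomials in these variables whose nonzero exponents are the parts of \<open>\<mu>\<close> in some
  order.\<close>

definition monomial_sym :: "nat \<Rightarrow> nat list \<Rightarrow> series" where
  "monomial_sym j \<mu> e =
     (if fst ` Poly_Mapping.keys e \<subseteq> {j} \<and>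
         image_mset (Poly_Mapping.lookup e) (mset_set (Poly_Mapping.keys e)) = mset \<mu>
      then 1 else 0)"

definition monomial_multisym :: "nat list list \<Rightarrow> series" where
  "monomial_multisym ms =
     foldr series_mult (map (\<lambda>j. monomial_sym j (ms ! j)) [0..<length ms]) series_one"

text \<open>The finitely supported family of coefficients in the expansion of a multi-symmetric function
  in the products of monomial symmetric functions.\<close>

definition multi_kostka :: "nat list list \<Rightarrow> nat list list \<Rightarrow> int" where
  "multi_kostka ls = Poly_Mapping.lookup (THE K :: nat list list \<Rightarrow>\<^sub>0 int.
     Poly_Mapping.keys K \<subseteq> partition_tuples (length ls) \<and>
     (\<forall>e. multi_schur ls e =
        (\<Sum>ms\<in>Poly_Mapping.keys K. Poly_Mapping.lookup K ms * monomial_multisym ms e)))"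

section \<open>The alphabet\<close>

text \<open>\<open>Letter j k\<close> is \<open>(k+1)\<^bsub>j+1\<^esub>\<close> and \<open>Omega j k\<close> is \<open>\<omega>\<^bsub>j+1\<^esub> + k\<close>.\<close>

datatype label = Letter nat nat | Omega nat nat

instantiation label :: linorder
begin

fun less_label :: "label \<Rightarrow> label \<Rightarrow> bool" where
  "Letter i a < Letter j b \<longleftrightarrow> i < j \<or> i = j \<and> a < b"
| "Letter i a < Omega j b \<longleftrightarrow> i \<le> j"
| "Omega i a < Letter j b \<longleftrightarrow> i < j"
| "Omega i a < Omega j b \<longleftrightarrow> i < j \<or> i = j \<and> a < b"

definition less_eq_label :: "label \<Rightarrow> label \<Rightarrow> bool" where
  "x \<le> y \<longleftrightarrow> x < y \<or> x = (y :: label)"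

instance
proof
  fix x y z :: label
  show "x < y \<longleftrightarrow> x \<le> y \<and> \<not> y \<le> x"
    by (cases x; cases y) (auto simp: less_eq_label_def)
  show "x \<le> x"
    by (simp add: less_eq_label_def)
  show "x \<le> y \<Longrightarrow> y \<le> z \<Longrightarrow> x \<le> z"
    by (cases x; cases y; cases z) (auto simp: less_eq_label_def)
  show "x \<le> y \<Longrightarrow> y \<le> x \<Longrightarrow> x = y"
    by (cases x; cases y) (auto simp: less_eq_label_def)
  show "x \<le> y \<or> y \<le> x"
    by (cases x; cases y) (auto simp: less_eq_label_def)
qed

end

section \<open>Diagrams and fillings\<close>

text \<open>A box is a pair (column, row).\<close>

type_synonym box = "nat \<times> nat"

definition dg' :: "nat list \<Rightarrow> box set" where
  "dg' \<mu> = {(i, j). i < length \<mu> \<and> 1 \<le> j \<and> j \<le> \<mu> ! i}"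

definition dg_hat :: "nat list \<Rightarrow> box set" where
  "dg_hat \<mu> = dg' \<mu> \<union> {(i, 0) |i. i < length \<mu>}"

fun lower_right :: "box \<Rightarrow> box \<Rightarrow> bool" where
  "lower_right (i, j) (i', j') \<longleftrightarrow> j = Suc j' \<and> i < i'"

definition attack :: "box \<Rightarrow> box \<Rightarrow> bool" where
  "attack u v \<longleftrightarrow> u \<noteq> v \<and> (snd u = snd v \<or> lower_right u v \<or> lower_right v u)"

definition non_attacking :: "nat list \<Rightarrow> (box \<Rightarrow> label) \<Rightarrow> bool" where
  "non_attacking \<mu> \<tau> \<longleftrightarrow> (\<forall>u\<in>dg_hat \<mu>. \<forall>v\<in>dg_hat \<mu>. attack u v \<longrightarrow> \<tau> u \<noteq> \<tau> v)"

definition weakly_decreasing_upwards :: "nat list \<Rightarrow> (box \<Rightarrow> label) \<Rightarrow> bool" where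
  "weakly_decreasing_upwards \<mu> \<tau> \<longleftrightarrow> (\<forall>(i, j)\<in>dg' \<mu>. \<tau> (i, j) \<le> \<tau> (i, j - 1))"

definition coinversion_triple ::
    "nat list \<Rightarrow> (box \<Rightarrow> label) \<Rightarrow> box \<Rightarrow> box \<Rightarrow> box \<Rightarrow> bool" where
  "coinversion_triple \<mu> \<tau> u v w \<longleftrightarrow>
     u \<in> dg_hat \<mu> \<and> v \<in> dg_hat \<mu> \<and> w \<in> dg_hat \<mu> \<and>
     (\<exists>i j i'. j \<ge> 1 \<and> u = (i, j) \<and> w = (i, j - 1) \<and>
        (v = (i', j - 1) \<and> i' > i \<and> \<mu> ! i' < \<mu> ! i \<or>
         v = (i', j) \<and> i' < i \<and> \<mu> ! i' \<le> \<mu> ! i)) \<and>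
     (\<tau> u < \<tau> v \<and> \<tau> v < \<tau> w \<or> \<tau> v < \<tau> w \<and> \<tau> w < \<tau> u \<or> \<tau> w < \<tau> u \<and> \<tau> u < \<tau> v)"

definition shape :: "nat list list \<Rightarrow> nat list" where
  "shape ls = concat (map rev ls)"

definition basement :: "nat list list \<Rightarrow> label list" where
  "basement ls = concat (map (\<lambda>b. map (Omega b) [0..<length (ls ! b)]) [0..<length ls])"

definition extend :: "nat list list \<Rightarrow> (box \<Rightarrow> label) \<Rightarrow> box \<Rightarrow> label" where
  "extend ls \<sigma> = (\<lambda>(i, j). if j = 0 then basement ls ! i else \<sigma> (i, j))"

definition fillings :: "nat list list \<Rightarrow> (box \<Rightarrow> label) set" where
  "fillings ls =
     {\<sigma> \<in> dg' (shape ls) \<rightarrow>\<^sub>E {Letter j k |j k. j < length ls}.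
        non_attacking (shape ls) (extend ls \<sigma>) \<and>
        weakly_decreasing_upwards (shape ls) (extend ls \<sigma>) \<and>
        (\<nexists>u v w. coinversion_triple (shape ls) (extend ls \<sigma>) u v w)}"

definition fillings_of_content :: "nat list list \<Rightarrow> nat list list \<Rightarrow> (box \<Rightarrow> label) set" where
  "fillings_of_content ms ls =
     {\<sigma> \<in> fillings ls. \<forall>j<length ls. \<forall>k.
        card {u \<in> dg' (shape ls). \<sigma> u = Letter j k} = part (ms ! j) k}"

end

(* The idea is to read a filling row by row.  For a composition alpha and an arbitrary basement w
   (injective, not only increasing), let F(w) be the generating function of the fillings of alpha
   over w.  Exchanging the labels i and i+1 in w turns F into xi_i F or xi_i F - F, depending on the
   relative position and heights of the two columns that carry these labels.  This is proved by
   induction on the number of rows: the admissible first rows are grouped into orbits {u, s_i u},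
   and on each orbit the claim reduces to a finite comparison of the admissibility of u and s_i u
   over w and s_i w.  If the labels of w increase as the heights decrease, then the only filling is
   constant on columns and F(w) is a monomial.  Sorting such a basement to the increasing one
   expresses F as a composition of operators xi_i, from which the recursion of the key polynomials
   follows.  Hence key polynomials count fillings with increasing basement; in the limit the empty
   columns disappear, and the Kostka coefficients are the coefficients of dominant monomials. *)

theory Submission
  imports Defs
begin

section \<open>Admissible pairs of consecutive rows\<close>

text \<open>The key recursion exchanges two parts of the shape, whereas the induction on rows
  controls only exchanges of labels in the basement. The link is to move the columns
  \<open>i\<close> and \<open>i + 1\<close> together with their labels: this preserves the
  generating function as long as labels increase from left to right wherever heights do not
  increase. Such a basement is reached from one with a monomial generating function by exchanges of
  the favourable kind, where the operator itself occurs and not the operator minus the identity, and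
  these exchanges remain favourable after the columns are moved. The unfavourable kind is still
  indispensable: a row above a favourable basement may carry the two labels in the other position,
  so both statements go through the induction together. Within an orbit single terms need not
  correspond; only the orbit sums do. The operator is handled as a relation between polynomials,
  linear in both arguments, with the quotient always exhibited explicitly in terms of generating
  functions.\<close>

text \<open>The row \<open>u\<close>, on the columns \<open>E\<close>, sits directly above the row \<open>w\<close>, on the columns \<open>D\<close>.  For two
  columns call the higher one dominant, the right one in case of a tie; attacks between the two rows
  and co-inversion triples are excluded exactly if the interval from \<open>u\<close> to \<open>w\<close> in the dominant
  column avoids the lower entry of the other column if that lies to the right, and its upper entry
  if it lies to the left.\<close>

definition row_ok :: "nat set \<Rightarrow> nat set \<Rightarrow> (nat \<Rightarrow> nat) \<Rightarrow> (nat \<Rightarrow> 'a::linorder) \<Rightarrow> (nat \<Rightarrow> 'a) \<Rightarrow> bool" where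
  "row_ok D E \<alpha> w u \<longleftrightarrow>
     (\<forall>c\<in>E. u c \<le> w c) \<and>
     (\<forall>c\<in>E. \<forall>d\<in>D. c < d \<and> \<alpha> d < \<alpha> c \<longrightarrow> \<not> (u c \<le> w d \<and> w d \<le> w c)) \<and>
     (\<forall>c\<in>E. \<forall>d\<in>E. c < d \<and> \<alpha> c \<le> \<alpha> d \<longrightarrow> \<not> (u d \<le> u c \<and> u c \<le> w d))"

lemma row_ok_le: "row_ok D E \<alpha> w u \<Longrightarrow> c \<in> E \<Longrightarrow> u c \<le> w c"
  and row_ok_right: "row_ok D E \<alpha> w u \<Longrightarrow> c \<in> E \<Longrightarrow> d \<in> D \<Longrightarrow> c < d \<Longrightarrow> \<alpha> d < \<alpha> c \<Longrightarrow> \<not> (u c \<le> w d \<and> w d \<le> w c)"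
  and row_ok_left: "row_ok D E \<alpha> w u \<Longrightarrow> c \<in> E \<Longrightarrow> d \<in> E \<Longrightarrow> c < d \<Longrightarrow> \<alpha> c \<le> \<alpha> d \<Longrightarrow> \<not> (u d \<le> u c \<and> u c \<le> w d)"
  unfolding row_ok_def by blast+

lemma row_okI:
  assumes "\<And>c. c \<in> E \<Longrightarrow> u c \<le> w c"
    and "\<And>c d. c \<in> E \<Longrightarrow> d \<in> D \<Longrightarrow> c < d \<Longrightarrow> \<alpha> d < \<alpha> c \<Longrightarrow> u c \<le> w d \<Longrightarrow> w d \<le> w c \<Longrightarrow> False"
    and "\<And>c d. c \<in> E \<Longrightarrow> d \<in> E \<Longrightarrow> c < d \<Longrightarrow> \<alpha> c \<le> \<alpha> d \<Longrightarrow> u d \<le> u c \<Longrightarrow> u c \<le> w d \<Longrightarrow> False"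
  shows "row_ok D E \<alpha> w u"
  using assms unfolding row_ok_def by blast

section \<open>Effect of exchanging two adjacent labels on admissibility\<close>

lemma transpose_le_iff:
  fixes x y i :: nat
  shows "transpose i (Suc i) x \<le> transpose i (Suc i) y \<longleftrightarrow> x \<le> y \<and> \<not> (x = i \<and> y = Suc i) \<or> x = Suc i \<and> y = i"
    and "x \<le> transpose i (Suc i) y \<longleftrightarrow> x \<le> y \<and> \<not> (x = Suc i \<and> y = Suc i) \<or> x = Suc i \<and> y = i"
    and "transpose i (Suc i) x \<le> y \<longleftrightarrow> x \<le> y \<and> \<not> (x = i \<and> y = i) \<or> x = Suc i \<and> y = i"
  by (auto simp: transpose_def)

text \<open>Exchanging \<open>i\<close> and \<open>i + 1\<close> alters only the comparison between
  these two values, so admissibility can break only where an inequality turns from false to true, or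
  \<open>u c \<le> w c\<close> from true to false. The hypotheses exclude these positions; their
  final inequations leave aside the positions where the other bound of the interval fails after the
  exchange.\<close>

lemma row_ok_transpose_both:
  fixes w u :: "nat \<Rightarrow> nat"
  assumes "row_ok D E \<alpha> w u"
    and "\<And>c. c \<in> E \<Longrightarrow> u c = i \<Longrightarrow> w c = Suc i \<Longrightarrow> False"
    and "\<And>c d. c \<in> E \<Longrightarrow> d \<in> D \<Longrightarrow> c < d \<Longrightarrow> \<alpha> d < \<alpha> c \<Longrightarrow> u c = Suc i \<Longrightarrow> w d = i \<Longrightarrow> w c \<noteq> Suc i \<Longrightarrow> False"
    and "\<And>c d. c \<in> E \<Longrightarrow> d \<in> D \<Longrightarrow> c < d \<Longrightarrow> \<alpha> d < \<alpha> c \<Longrightarrow> w d = Suc i \<Longrightarrow> w c = i \<Longrightarrow> u c \<noteq> i \<Longrightarrow> False"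
    and "\<And>c d. c \<in> E \<Longrightarrow> d \<in> E \<Longrightarrow> c < d \<Longrightarrow> \<alpha> c \<le> \<alpha> d \<Longrightarrow> u c = Suc i \<Longrightarrow> w d = i \<Longrightarrow> u d \<noteq> i \<Longrightarrow> False"
    and "\<And>c d. c \<in> E \<Longrightarrow> d \<in> E \<Longrightarrow> c < d \<Longrightarrow> \<alpha> c \<le> \<alpha> d \<Longrightarrow> u d = Suc i \<Longrightarrow> u c = i \<Longrightarrow> w d \<noteq> Suc i \<Longrightarrow> False"
  shows "row_ok D E \<alpha> (\<lambda>c. transpose i (Suc i) (w c)) (\<lambda>c. transpose i (Suc i) (u c))"
proof (rule row_okI, goal_cases)
  case (1 c)
  then show ?case using row_ok_le[OF assms(1), of c] assms(2)[of c]
    unfolding transpose_le_iff(1) by (metis n_not_Suc_n)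
next
  case (2 c d)
  then show ?case using row_ok_right[OF assms(1), of c d] assms(3)[of c d] assms(4)[of c d]
    unfolding transpose_le_iff(1) by (metis n_not_Suc_n)
next
  case (3 c d)
  then show ?case using row_ok_left[OF assms(1), of c d] assms(5)[of c d] assms(6)[of c d]
    unfolding transpose_le_iff(1) by (metis n_not_Suc_n)
qed

text \<open>A fixed value is now compared with a moved one, so ties matter as well:
  \<open>i + 1\<close> above \<open>i + 1\<close> is destroyed, whereas an entry
  \<open>i + 1\<close> against a base label \<open>i\<close> becomes a tie.\<close>

lemma row_ok_transpose_base:
  fixes w u :: "nat \<Rightarrow> nat"
  assumes "row_ok D E \<alpha> w u"
    and "\<And>c. c \<in> E \<Longrightarrow> u c = Suc i \<Longrightarrow> w c = Suc i \<Longrightarrow> False"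
    and "\<And>c d. c \<in> E \<Longrightarrow> d \<in> D \<Longrightarrow> c < d \<Longrightarrow> \<alpha> d < \<alpha> c \<Longrightarrow> u c = Suc i \<Longrightarrow> w d = i \<Longrightarrow> False"
    and "\<And>c d. c \<in> E \<Longrightarrow> d \<in> D \<Longrightarrow> c < d \<Longrightarrow> \<alpha> d < \<alpha> c \<Longrightarrow> w d = Suc i \<Longrightarrow> w c = i \<Longrightarrow> False"
    and "\<And>c d. c \<in> E \<Longrightarrow> d \<in> E \<Longrightarrow> c < d \<Longrightarrow> \<alpha> c \<le> \<alpha> d \<Longrightarrow> u c = Suc i \<Longrightarrow> w d = i \<Longrightarrow> False"
  shows "row_ok D E \<alpha> (\<lambda>c. transpose i (Suc i) (w c)) u"
proof (rule row_okI, goal_cases)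
  case (1 c)
  then show ?case using row_ok_le[OF assms(1), of c] assms(2)[of c]
    unfolding transpose_le_iff(1) unfolding transpose_le_iff(2) by blast
next
  case (2 c d)
  then show ?case using row_ok_right[OF assms(1), of c d] assms(3)[of c d] assms(4)[of c d]
    unfolding transpose_le_iff(1) unfolding transpose_le_iff(2) by blast
next
  case (3 c d)
  then show ?case using row_ok_left[OF assms(1), of c d] assms(5)[of c d]
    unfolding transpose_le_iff(1) unfolding transpose_le_iff(2) by blast
qed

lemma row_ok_transpose_entries:
  fixes w u :: "nat \<Rightarrow> nat"
  assumes "row_ok D E \<alpha> w u"
    and "\<And>c. c \<in> E \<Longrightarrow> u c = i \<Longrightarrow> w c = i \<Longrightarrow> False"
    and "\<And>c d. c \<in> E \<Longrightarrow> d \<in> D \<Longrightarrow> c < d \<Longrightarrow> \<alpha> d < \<alpha> c \<Longrightarrow> u c = Suc i \<Longrightarrow> w d = i \<Longrightarrow> False"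
    and "\<And>c d. c \<in> E \<Longrightarrow> d \<in> E \<Longrightarrow> c < d \<Longrightarrow> \<alpha> c \<le> \<alpha> d \<Longrightarrow> u c = Suc i \<Longrightarrow> w d = i \<Longrightarrow> False"
    and "\<And>c d. c \<in> E \<Longrightarrow> d \<in> E \<Longrightarrow> c < d \<Longrightarrow> \<alpha> c \<le> \<alpha> d \<Longrightarrow> u d = Suc i \<Longrightarrow> u c = i \<Longrightarrow> False"
  shows "row_ok D E \<alpha> w (\<lambda>c. transpose i (Suc i) (u c))"
proof (rule row_okI, goal_cases)
  case (1 c)
  then show ?case using row_ok_le[OF assms(1), of c] assms(2)[of c]
    unfolding transpose_le_iff(1) unfolding transpose_le_iff(3) by blast
next
  case (2 c d)
  then show ?case using row_ok_right[OF assms(1), of c d] assms(3)[of c d]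
    unfolding transpose_le_iff(1) unfolding transpose_le_iff(3) by blast
next
  case (3 c d)
  then show ?case using row_ok_left[OF assms(1), of c d] assms(4)[of c d] assms(5)[of c d]
    unfolding transpose_le_iff(1) unfolding transpose_le_iff(3) by blast
qed

text \<open>\<open>D\<close> and \<open>E\<close> stand for the columns that reach two consecutive
  rows; \<open>up\<close> and \<open>up_strict\<close> record this through the heights alone,
  without the row number.\<close>

locale adjacent_rows =
  fixes D E :: "nat set" and \<alpha> :: "nat \<Rightarrow> nat" and i :: nat and w u :: "nat \<Rightarrow> nat"
  assumes ED: "E \<subseteq> D"
    and up: "\<And>c d. c \<in> E \<Longrightarrow> d \<in> D \<Longrightarrow> \<alpha> c \<le> \<alpha> d \<Longrightarrow> d \<in> E"
    and up_strict: "\<And>c d. c \<in> D \<Longrightarrow> d \<in> D \<Longrightarrow> \<alpha> c < \<alpha> d \<Longrightarrow> d \<in> E"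
    and inj_w: "inj_on w D" and inj_u: "inj_on u E"
begin

abbreviation t :: "nat \<Rightarrow> nat" where "t \<equiv> transpose i (Suc i)"
abbreviation tw :: "nat \<Rightarrow> nat" where "tw \<equiv> \<lambda>c. t (w c)"
abbreviation tu :: "nat \<Rightarrow> nat" where "tu \<equiv> \<lambda>c. t (u c)"
abbreviation R :: "(nat \<Rightarrow> nat) \<Rightarrow> (nat \<Rightarrow> nat) \<Rightarrow> bool" where "R \<equiv> row_ok D E \<alpha>"

lemma t_iffs [simp]: "t x = i \<longleftrightarrow> x = Suc i" "t x = Suc i \<longleftrightarrow> x = i"
  by (auto simp: transpose_def)

lemma wD: "w c = w d \<Longrightarrow> c \<in> D \<Longrightarrow> d \<in> D \<Longrightarrow> c = d"
  using inj_w by (auto dest: inj_onD)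

lemma uD: "u c = u d \<Longrightarrow> c \<in> E \<Longrightarrow> d \<in> E \<Longrightarrow> c = d"
  using inj_u by (auto dest: inj_onD)

lemma inD: "c \<in> E \<Longrightarrow> c \<in> D"
  using ED by auto

lemma inj_tu: "inj_on tu E"
  using inj_u unfolding inj_on_def by (metis transpose_involutory)

text \<open>If \<open>q\<close> lay to the right of \<open>c\<close>, the common label would be an
  endpoint of the interval of the dominant column: the upper end \<open>w' q\<close> if
  \<open>q\<close> dominates, the lower end \<open>u' c\<close> if \<open>c\<close> does. So a label
  repeated in the next row can only move weakly to the right.\<close>

lemma no_base_right_of_entry:
  assumes a: "R w' u'" "inj_on u' E" and c: "c \<in> E" "q \<in> D" "w' q = u' c"
  shows "q \<le> c"
proof (rule ccontr)
  assume n: "\<not> q \<le> c"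
  show False
  proof (cases "\<alpha> c \<le> \<alpha> q")
    case True
    then have "q \<in> E" using up c by blast
    with True n c row_ok_left[OF a(1), of c q] row_ok_le[OF a(1), of q] show ?thesis by auto
  next
    case False
    with n c row_ok_right[OF a(1), of c q] row_ok_le[OF a(1), of c] show ?thesis by auto
  qed
qed

text \<open>The letter tells the row, \<open>W\<close> for the lower and \<open>U\<close> for the
  upper one; the digit tells the label, 0 for \<open>i\<close> and 1 for \<open>i + 1\<close>. By
  injectivity each predicate holds for at most one column.\<close>

definition W0 :: "nat \<Rightarrow> bool" where "W0 c \<longleftrightarrow> c \<in> D \<and> w c = i"
definition W1 :: "nat \<Rightarrow> bool" where "W1 c \<longleftrightarrow> c \<in> D \<and> w c = Suc i"
definition U0 :: "nat \<Rightarrow> bool" where "U0 c \<longleftrightarrow> c \<in> E \<and> u c = i"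
definition U1 :: "nat \<Rightarrow> bool" where "U1 c \<longleftrightarrow> c \<in> E \<and> u c = Suc i"

lemmas labels_def = W0_def W1_def U0_def U1_def

lemma labels_unique:
  "W0 c \<Longrightarrow> W0 d \<Longrightarrow> c = d" "W1 c \<Longrightarrow> W1 d \<Longrightarrow> c = d"
  "U0 c \<Longrightarrow> U0 d \<Longrightarrow> c = d" "U1 c \<Longrightarrow> U1 d \<Longrightarrow> c = d"
  unfolding labels_def by (metis wD uD)+

lemma both_fwd:
  assumes "R w u"
    and "\<And>c. U0 c \<Longrightarrow> W1 c \<Longrightarrow> False"
    and "\<And>c d. c < d \<Longrightarrow> \<alpha> d < \<alpha> c \<Longrightarrow> U1 c \<Longrightarrow> W0 d \<Longrightarrow> \<not> W1 c \<Longrightarrow> False"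
    and "\<And>c d. c < d \<Longrightarrow> \<alpha> d < \<alpha> c \<Longrightarrow> W1 d \<Longrightarrow> W0 c \<Longrightarrow> \<not> U0 c \<Longrightarrow> False"
    and "\<And>c d. c < d \<Longrightarrow> \<alpha> c \<le> \<alpha> d \<Longrightarrow> U1 c \<Longrightarrow> W0 d \<Longrightarrow> \<not> U0 d \<Longrightarrow> False"
    and "\<And>c d. c < d \<Longrightarrow> \<alpha> c \<le> \<alpha> d \<Longrightarrow> U1 d \<Longrightarrow> U0 c \<Longrightarrow> \<not> W1 d \<Longrightarrow> False"
  shows "R tw tu"
proof -
  have "R tw tu"
  proof (rule row_ok_transpose_both[OF assms(1)], goal_cases)
    case (1 c)
    then show ?case using assms(2)[of c] inD[of c] by (simp add: labels_def)
  next
    case (2 c d)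
    then show ?case using assms(3)[of c d] inD[of c] inD[of d] by (simp add: labels_def)
  next
    case (3 c d)
    then show ?case using assms(4)[of c d] inD[of c] inD[of d] by (simp add: labels_def)
  next
    case (4 c d)
    then show ?case using assms(5)[of c d] inD[of c] inD[of d] by (simp add: labels_def)
  next
    case (5 c d)
    then show ?case using assms(6)[of c d] inD[of c] inD[of d] by (simp add: labels_def)
  qed
  then show ?thesis by simp
qed

text \<open>The forward statement for the relabelled rows: relabelling twice is the identity, and
  the digits 0 and 1 trade places in the hypotheses.\<close>

lemma both_rev:
  assumes "R tw tu"
    and "\<And>c. U1 c \<Longrightarrow> W0 c \<Longrightarrow> False"
    and "\<And>c d. c < d \<Longrightarrow> \<alpha> d < \<alpha> c \<Longrightarrow> U0 c \<Longrightarrow> W1 d \<Longrightarrow> \<not> W0 c \<Longrightarrow> False"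
    and "\<And>c d. c < d \<Longrightarrow> \<alpha> d < \<alpha> c \<Longrightarrow> W0 d \<Longrightarrow> W1 c \<Longrightarrow> \<not> U1 c \<Longrightarrow> False"
    and "\<And>c d. c < d \<Longrightarrow> \<alpha> c \<le> \<alpha> d \<Longrightarrow> U0 c \<Longrightarrow> W1 d \<Longrightarrow> \<not> U1 d \<Longrightarrow> False"
    and "\<And>c d. c < d \<Longrightarrow> \<alpha> c \<le> \<alpha> d \<Longrightarrow> U0 d \<Longrightarrow> U1 c \<Longrightarrow> \<not> W0 d \<Longrightarrow> False"
  shows "R w u"
proof -
  have "R (\<lambda>c. t (tw c)) (\<lambda>c. t (tu c))"
  proof (rule row_ok_transpose_both[OF assms(1)], goal_cases)
    case (1 c)
    then show ?case using assms(2)[of c] inD[of c] by (simp add: labels_def)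
  next
    case (2 c d)
    then show ?case using assms(3)[of c d] inD[of c] inD[of d] by (simp add: labels_def)
  next
    case (3 c d)
    then show ?case using assms(4)[of c d] inD[of c] inD[of d] by (simp add: labels_def)
  next
    case (4 c d)
    then show ?case using assms(5)[of c d] inD[of c] inD[of d] by (simp add: labels_def)
  next
    case (5 c d)
    then show ?case using assms(6)[of c d] inD[of c] inD[of d] by (simp add: labels_def)
  qed
  then show ?thesis by simp
qed

lemma base_fwd:
  assumes "R w u"
    and "\<And>c. U1 c \<Longrightarrow> W1 c \<Longrightarrow> False"
    and "\<And>c d. c < d \<Longrightarrow> \<alpha> d < \<alpha> c \<Longrightarrow> U1 c \<Longrightarrow> W0 d \<Longrightarrow> False"
    and "\<And>c d. c < d \<Longrightarrow> \<alpha> d < \<alpha> c \<Longrightarrow> W1 d \<Longrightarrow> W0 c \<Longrightarrow> False"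
    and "\<And>c d. c < d \<Longrightarrow> \<alpha> c \<le> \<alpha> d \<Longrightarrow> U1 c \<Longrightarrow> W0 d \<Longrightarrow> False"
  shows "R tw u"
proof -
  have "R tw u"
  proof (rule row_ok_transpose_base[OF assms(1)], goal_cases)
    case (1 c)
    then show ?case using assms(2)[of c] inD[of c] by (simp add: labels_def)
  next
    case (2 c d)
    then show ?case using assms(3)[of c d] inD[of c] inD[of d] by (simp add: labels_def)
  next
    case (3 c d)
    then show ?case using assms(4)[of c d] inD[of c] inD[of d] by (simp add: labels_def)
  next
    case (4 c d)
    then show ?case using assms(5)[of c d] inD[of c] inD[of d] by (simp add: labels_def)
  qed
  then show ?thesis by simp
qed

lemma base_rev:
  assumes "R tw u"
    and "\<And>c. U1 c \<Longrightarrow> W0 c \<Longrightarrow> False"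
    and "\<And>c d. c < d \<Longrightarrow> \<alpha> d < \<alpha> c \<Longrightarrow> U1 c \<Longrightarrow> W1 d \<Longrightarrow> False"
    and "\<And>c d. c < d \<Longrightarrow> \<alpha> d < \<alpha> c \<Longrightarrow> W0 d \<Longrightarrow> W1 c \<Longrightarrow> False"
    and "\<And>c d. c < d \<Longrightarrow> \<alpha> c \<le> \<alpha> d \<Longrightarrow> U1 c \<Longrightarrow> W1 d \<Longrightarrow> False"
  shows "R w u"
proof -
  have "R (\<lambda>c. t (tw c)) u"
  proof (rule row_ok_transpose_base[OF assms(1)], goal_cases)
    case (1 c)
    then show ?case using assms(2)[of c] inD[of c] by (simp add: labels_def)
  next
    case (2 c d)
    then show ?case using assms(3)[of c d] inD[of c] inD[of d] by (simp add: labels_def)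
  next
    case (3 c d)
    then show ?case using assms(4)[of c d] inD[of c] inD[of d] by (simp add: labels_def)
  next
    case (4 c d)
    then show ?case using assms(5)[of c d] inD[of c] inD[of d] by (simp add: labels_def)
  qed
  then show ?thesis by simp
qed

lemma base_tu_fwd:
  assumes "R w tu"
    and "\<And>c. U0 c \<Longrightarrow> W1 c \<Longrightarrow> False"
    and "\<And>c d. c < d \<Longrightarrow> \<alpha> d < \<alpha> c \<Longrightarrow> U0 c \<Longrightarrow> W0 d \<Longrightarrow> False"
    and "\<And>c d. c < d \<Longrightarrow> \<alpha> d < \<alpha> c \<Longrightarrow> W1 d \<Longrightarrow> W0 c \<Longrightarrow> False"
    and "\<And>c d. c < d \<Longrightarrow> \<alpha> c \<le> \<alpha> d \<Longrightarrow> U0 c \<Longrightarrow> W0 d \<Longrightarrow> False"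
  shows "R tw tu"
proof -
  have "R tw tu"
  proof (rule row_ok_transpose_base[OF assms(1)], goal_cases)
    case (1 c)
    then show ?case using assms(2)[of c] inD[of c] by (simp add: labels_def)
  next
    case (2 c d)
    then show ?case using assms(3)[of c d] inD[of c] inD[of d] by (simp add: labels_def)
  next
    case (3 c d)
    then show ?case using assms(4)[of c d] inD[of c] inD[of d] by (simp add: labels_def)
  next
    case (4 c d)
    then show ?case using assms(5)[of c d] inD[of c] inD[of d] by (simp add: labels_def)
  qed
  then show ?thesis by simp
qed

lemma base_tu_rev:
  assumes "R tw tu"
    and "\<And>c. U0 c \<Longrightarrow> W0 c \<Longrightarrow> False"
    and "\<And>c d. c < d \<Longrightarrow> \<alpha> d < \<alpha> c \<Longrightarrow> U0 c \<Longrightarrow> W1 d \<Longrightarrow> False"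
    and "\<And>c d. c < d \<Longrightarrow> \<alpha> d < \<alpha> c \<Longrightarrow> W0 d \<Longrightarrow> W1 c \<Longrightarrow> False"
    and "\<And>c d. c < d \<Longrightarrow> \<alpha> c \<le> \<alpha> d \<Longrightarrow> U0 c \<Longrightarrow> W1 d \<Longrightarrow> False"
  shows "R w tu"
proof -
  have "R (\<lambda>c. t (tw c)) tu"
  proof (rule row_ok_transpose_base[OF assms(1)], goal_cases)
    case (1 c)
    then show ?case using assms(2)[of c] inD[of c] by (simp add: labels_def)
  next
    case (2 c d)
    then show ?case using assms(3)[of c d] inD[of c] inD[of d] by (simp add: labels_def)
  next
    case (3 c d)
    then show ?case using assms(4)[of c d] inD[of c] inD[of d] by (simp add: labels_def)
  next
    case (4 c d)
    then show ?case using assms(5)[of c d] inD[of c] inD[of d] by (simp add: labels_def)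
  qed
  then show ?thesis by simp
qed

lemma entries_fwd:
  assumes "R w u"
    and "\<And>c. U0 c \<Longrightarrow> W0 c \<Longrightarrow> False"
    and "\<And>c d. c < d \<Longrightarrow> \<alpha> d < \<alpha> c \<Longrightarrow> U1 c \<Longrightarrow> W0 d \<Longrightarrow> False"
    and "\<And>c d. c < d \<Longrightarrow> \<alpha> c \<le> \<alpha> d \<Longrightarrow> U1 c \<Longrightarrow> W0 d \<Longrightarrow> False"
    and "\<And>c d. c < d \<Longrightarrow> \<alpha> c \<le> \<alpha> d \<Longrightarrow> U1 d \<Longrightarrow> U0 c \<Longrightarrow> False"
  shows "R w tu"
proof -
  have "R w tu"
  proof (rule row_ok_transpose_entries[OF assms(1)], goal_cases)
    case (1 c)
    then show ?case using assms(2)[of c] inD[of c] by (simp add: labels_def)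
  next
    case (2 c d)
    then show ?case using assms(3)[of c d] inD[of c] inD[of d] by (simp add: labels_def)
  next
    case (3 c d)
    then show ?case using assms(4)[of c d] inD[of c] inD[of d] by (simp add: labels_def)
  next
    case (4 c d)
    then show ?case using assms(5)[of c d] inD[of c] inD[of d] by (simp add: labels_def)
  qed
  then show ?thesis by simp
qed

lemma entries_rev:
  assumes "R w tu"
    and "\<And>c. U1 c \<Longrightarrow> W0 c \<Longrightarrow> False"
    and "\<And>c d. c < d \<Longrightarrow> \<alpha> d < \<alpha> c \<Longrightarrow> U0 c \<Longrightarrow> W0 d \<Longrightarrow> False"
    and "\<And>c d. c < d \<Longrightarrow> \<alpha> c \<le> \<alpha> d \<Longrightarrow> U0 c \<Longrightarrow> W0 d \<Longrightarrow> False"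
    and "\<And>c d. c < d \<Longrightarrow> \<alpha> c \<le> \<alpha> d \<Longrightarrow> U0 d \<Longrightarrow> U1 c \<Longrightarrow> False"
  shows "R w u"
proof -
  have "R w (\<lambda>c. t (tu c))"
  proof (rule row_ok_transpose_entries[OF assms(1)], goal_cases)
    case (1 c)
    then show ?case using assms(2)[of c] inD[of c] by (simp add: labels_def)
  next
    case (2 c d)
    then show ?case using assms(3)[of c d] inD[of c] inD[of d] by (simp add: labels_def)
  next
    case (3 c d)
    then show ?case using assms(4)[of c d] inD[of c] inD[of d] by (simp add: labels_def)
  next
    case (4 c d)
    then show ?case using assms(5)[of c d] inD[of c] inD[of d] by (simp add: labels_def)
  qed
  then show ?thesis by simp
qed

section \<open>Lower rows for which the exchange is the operator itself\<close>

context
  assumes low1: "\<And>p. W1 p \<Longrightarrow> \<exists>q. W0 q \<and> p < q \<and> \<alpha> p \<le> \<alpha> q"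
begin

lemma low1D: "W1 p \<Longrightarrow> W0 q \<Longrightarrow> p < q \<and> \<alpha> p \<le> \<alpha> q"
  using low1 labels_unique by metis

lemma low1_none:
  assumes "\<And>c. \<not> U0 c" "\<And>c. \<not> U1 c"
  shows "R tw u \<longleftrightarrow> R w u"
proof
  show "R tw u" if "R w u"
    by (rule base_fwd[OF that]) (use assms low1D in fastforce)+
  show "R w u" if "R tw u"
    by (rule base_rev[OF that]) (use assms low1D in fastforce)+
qed

context
  fixes c0 d0
  assumes c0: "U1 c0" and d0: "U0 d0" and lt: "c0 < d0" "\<alpha> c0 \<le> \<alpha> d0"
begin

lemma c0E: "c0 \<in> E" "d0 \<in> E" "u d0 = i" "u c0 = Suc i"
  using c0 d0 by (auto simp: labels_def)

lemma u_eqD: "U0 c \<Longrightarrow> c = d0" "U1 c \<Longrightarrow> c = c0"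
  using labels_unique c0 d0 by blast+

text \<open>The entries of \<open>c0\<close> and \<open>d0\<close> force the base label
  \<open>i + 1\<close> below \<open>d0\<close>. Then \<open>i\<close> lies further right in a column
  \<open>q\<close> at least as high; after the exchange that column has base label
  \<open>i + 1\<close> and an entry below \<open>i\<close>, so its interval contains the entry
  \<open>i\<close> of \<open>d0\<close>.\<close>

lemma low1_low1_a: "\<not> R tw u"
proof
  assume a: "R tw u"
  have "w d0 = Suc i"
    using row_ok_left[OF a, of c0 d0] row_ok_le[OF a, of d0] c0E lt unfolding transpose_le_iff(2) by auto
  then obtain q where q: "W0 q" "d0 < q" "\<alpha> d0 \<le> \<alpha> q" using low1[of d0] inD c0E by (auto simp: labels_def)
  then have qE: "q \<in> E" "w q = i" using up c0E unfolding labels_def by blast+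
  have "u q \<noteq> i" "u q \<noteq> Suc i" using u_eqD[of q] q qE lt by (auto simp: labels_def)
  then show False using row_ok_left[OF a, of d0 q] row_ok_le[OF a, of q] q qE c0E by auto
qed

lemma low1_low1_b: assumes a: "R w u" shows "W0 d0"
proof -
  have "w d0 = i"
    using row_ok_left[OF a, of c0 d0] row_ok_le[OF a, of d0] c0E lt by force
  then show ?thesis using inD c0E by (simp add: labels_def)
qed

lemma low1_low1_c: "R w tu \<Longrightarrow> \<not> W0 d0"
  using row_ok_le[of D E \<alpha> w tu d0] c0E by (auto simp: labels_def)

lemma low1_low1_d: assumes w0: "W0 d0" shows "R w u \<longleftrightarrow> R tw tu"
proof -
  have wq: "W0 c \<Longrightarrow> c = d0" for c using labels_unique w0 by blast
  have wp: "W1 c \<Longrightarrow> c < d0 \<and> \<alpha> c \<le> \<alpha> d0" for c using w0 low1D[of c d0] by blast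
  show ?thesis
  proof
    show "R tw tu" if "R w u"
      by (rule both_fwd[OF that]; use lt d0 in \<open>fastforce dest: u_eqD wq wp low1D\<close>)
    show "R w u" if "R tw tu"
      by (rule both_rev[OF that]; use lt c0 d0 w0 in \<open>fastforce dest: u_eqD wq wp low1D\<close>)
  qed
qed

lemma low1_low1_e: assumes w0: "\<not> W0 d0" shows "R w tu \<longleftrightarrow> R tw tu"
proof
  show "R tw tu" if a: "R w tu"
  proof -
    have wq: "q \<le> c0" if "W0 q" for q
      using no_base_right_of_entry[OF a inj_tu, of c0 q] c0E that by (simp add: labels_def)
    have wp: "p < c0" if "W1 p" for p
      using low1[OF that] wq by force
    show ?thesis
      by (rule base_tu_fwd[OF a]; use lt in \<open>fastforce dest: u_eqD wq wp low1D\<close>)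
  qed
  assume a: "R tw tu"
  have wq: "q < d0" if "W0 q" for q
    using no_base_right_of_entry[OF a inj_tu, of d0 q] c0E w0 that by (auto simp: labels_def le_less)
  have wp: "p < d0" if "W1 p" for p
    using low1[OF that] wq by force
  show "R w tu"
    by (rule base_tu_rev[OF a]; use lt w0 low1D in \<open>fastforce dest: u_eqD wq wp low1D\<close>)
qed

text \<open>Over \<open>w\<close> the presence of \<open>i\<close> below \<open>d0\<close> decides
  which of the two rows can occur; over the exchanged basement only \<open>tu\<close> can. The
  operator sends the contribution of \<open>u\<close> to that of \<open>tu\<close> and fixes the
  latter, so in either case the orbit has the right image.\<close>

lemma low1_low1: "\<not> R tw u" "R tw tu \<longleftrightarrow> R w u \<or> R w tu" "\<not> (R w u \<and> R w tu)"
  using low1_low1_a low1_low1_b low1_low1_c low1_low1_d low1_low1_e by blast+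

end

context
  fixes c0
  assumes c0: "U0 c0" and d0: "\<And>d. U1 d \<Longrightarrow> c0 < d \<and> \<alpha> d < \<alpha> c0"
begin

text \<open>Nothing is claimed about \<open>R w tu\<close>, because the operator annihilates the
  contribution of \<open>tu\<close>. The equivalences rest on the base labels lying to the left:
  \<open>i\<close> weakly left of \<open>c0\<close>, hence \<open>i + 1\<close> strictly left of
  it.\<close>

lemma low1_low2: "R tw u \<longleftrightarrow> R w u" "R tw tu \<longleftrightarrow> R w u"
proof -
  have c0E: "c0 \<in> E" "u c0 = i" "tu c0 = Suc i" using c0 by (auto simp: labels_def)
  have uq: "c = c0" if "U0 c" for c using labels_unique c0 that by blast
  have wq: "q \<le> c0" if "W0 q" and R: "R w u \<or> R tw u \<or> R tw tu" for q
  proof (rule ccontr)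
    assume n: "\<not> q \<le> c0"
    have q: "q \<in> D" "w q = i" using \<open>W0 q\<close> by (auto simp: labels_def)
    have "\<not> R w u" using no_base_right_of_entry[of w u c0 q] q n c0E inj_u by force
    moreover have "\<not> R tw tu" using no_base_right_of_entry[of tw tu c0 q] q n c0E inj_tu by force
    moreover have "\<not> R tw u"
    proof
      assume a: "R tw u"
      show False
      proof (cases "\<alpha> c0 \<le> \<alpha> q")
        case True
        have qE: "q \<in> E" using up[of c0 q] True c0E q by auto
        moreover have "u q \<noteq> i" "u q \<noteq> Suc i" using True qE n d0[of q] uq[of q] by (auto simp: labels_def)
        ultimately show ?thesis
          using row_ok_left[OF a, of c0 q] row_ok_le[OF a, of q] True n c0E q by auto
      next
        case False
        then show ?thesis
          using row_ok_right[OF a, of c0 q] row_ok_le[OF a, of c0] n c0E q low1D[of c0 q] inD[of c0]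
          unfolding transpose_le_iff(2) by (auto simp: le_Suc_eq labels_def)
      qed
    qed
    ultimately show False using R by blast
  qed
  have wp: "p < c0" if "W1 p" "R w u \<or> R tw u \<or> R tw tu" for p
    using low1[of p] wq that by force
  show "R tw u \<longleftrightarrow> R w u"
  proof
    show "R tw u" if a: "R w u"
    proof -
      have wq: "q \<le> c0" if "W0 q" for q using wq[OF that] a by blast
      have wp: "p < c0" if "W1 p" for p using wp[OF that] a by blast
      show ?thesis
      by (rule base_fwd[OF a]; use low1D in \<open>fastforce dest: uq d0 wq wp\<close>)
    qed
    show "R w u" if a: "R tw u"
    proof -
      have wq: "q \<le> c0" if "W0 q" for q using wq[OF that] a by blast
      have wp: "p < c0" if "W1 p" for p using wp[OF that] a by blast
      show ?thesis
      by (rule base_rev[OF a]; use low1D in \<open>fastforce dest: uq d0 wq wp\<close>)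
    qed
  qed
  show "R tw tu \<longleftrightarrow> R w u"
  proof
    show "R tw tu" if a: "R w u"
    proof -
      have wq: "q \<le> c0" if "W0 q" for q using wq[OF that] a by blast
      have wp: "p < c0" if "W1 p" for p using wp[OF that] a by blast
      show ?thesis
      by (rule both_fwd[OF a]; use low1D in \<open>fastforce dest: uq d0 wq wp\<close>)
    qed
    show "R w u" if a: "R tw tu"
    proof -
      have wq: "q \<le> c0" if "W0 q" for q using wq[OF that] a by blast
      have wp: "p < c0" if "W1 p" for p using wp[OF that] a by blast
      show ?thesis
      by (rule both_rev[OF a]; use low1D in \<open>fastforce dest: uq d0 wq wp\<close>)
    qed
  qed
qed

end

end

section \<open>Lower rows for which the exchange is the operator minus the identity\<close>

context
  fixes p q
  assumes p: "W0 p" and q: "W1 q" and pq: "p < q" "\<alpha> q < \<alpha> p"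
begin

lemma w0: "p \<in> D" "q \<in> D" "w p = i" "w q = Suc i"
  using p q by (auto simp: labels_def)

lemma w_eqD: "W0 c \<Longrightarrow> c = p" "W1 c \<Longrightarrow> c = q"
  using labels_unique p q by blast+

lemma pE: "p \<in> E" using up_strict[of q p] w0 pq by auto

text \<open>After the exchange the lower column \<open>q\<close> on the right shows the label
  \<open>i\<close>, which the interval of \<open>p\<close> must avoid; that interval ends at
  \<open>i + 1\<close>, so it consists of \<open>i + 1\<close> only.\<close>

lemma low2_entry: assumes a: "R tw v" shows "v p = Suc i"
  using row_ok_right[OF a, of p q] row_ok_le[OF a, of p] pE w0 pq by auto

lemma low2_none: "(\<And>c. \<not> U1 c) \<Longrightarrow> \<not> R tw u"
  using low2_entry[of u] pE by (auto simp: labels_def)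

text \<open>What may remain is \<open>tu\<close> over \<open>w\<close>. Its contribution is
  symmetric and hence fixed by the operator, which agrees with the exchanged side being
  zero.\<close>

lemma low2_low1:
  assumes c0: "U1 c0" and d0: "U0 d0" and lt: "c0 < d0" "\<alpha> c0 \<le> \<alpha> d0"
  shows "\<not> R tw u" "\<not> R tw tu" "\<not> R w u"
proof -
  have u0: "c0 \<in> E" "d0 \<in> E" "u d0 = i" "u c0 = Suc i"
    using c0 d0 by (auto simp: labels_def)
  have u_eqD: "U0 c \<Longrightarrow> c = d0" "U1 c \<Longrightarrow> c = c0" for c
    using labels_unique c0 d0 by blast+
  show "\<not> R tw u"
  proof
    assume a: "R tw u"
    have "U1 p" using low2_entry[OF a] pE by (simp add: labels_def)
    then have "c0 = p" using u_eqD by blast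
    moreover have "W1 d0"
      using row_ok_left[OF a, of c0 d0] row_ok_le[OF a, of d0] u0 inD[of d0] lt
      unfolding transpose_le_iff(2) by (auto simp: labels_def)
    ultimately show False using w_eqD[of d0] pq lt by auto
  qed
  show "\<not> R tw tu"
  proof
    assume a: "R tw tu"
    have "U0 p" using low2_entry[OF a] pE by (simp add: labels_def)
    then have "d0 = p" using u_eqD by blast
    then show False using no_base_right_of_entry[OF a inj_tu, of c0 q] u0 w0 lt pq by auto
  qed
  show "\<not> R w u"
  proof
    assume a: "R w u"
    have "w d0 = i"
      using row_ok_left[OF a, of c0 d0] row_ok_le[OF a, of d0] u0 lt by force
    then have "W0 d0" using inD u0 by (simp add: labels_def)
    then have "d0 = p" using w_eqD by blast
    then show False using no_base_right_of_entry[OF a inj_u, of c0 q] u0 w0 lt pq by auto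
  qed
qed

context
  fixes c0
  assumes c0: "U0 c0" and d0: "\<And>d. U1 d \<Longrightarrow> c0 < d \<and> \<alpha> d < \<alpha> c0"
begin

text \<open>The entry \<open>i\<close> cannot lie to the left of \<open>p\<close>. If it lies in
  \<open>p\<close>, both rows must be exchanged together; if it lies further right, exchanging the
  upper row alone is harmless. These positions are the two alternatives.\<close>

lemma low2_low2: "\<not> R tw u" "R w u \<longleftrightarrow> R w tu \<or> R tw tu" "\<not> (R w tu \<and> R tw tu)"
proof -
  have c0E: "c0 \<in> E" "u c0 = i" "tu c0 = Suc i" using c0 by (auto simp: labels_def)
  have uq: "c = c0" if "U0 c" for c using labels_unique c0 that by blast
  have 1: "p \<le> c0" if "R w u"
    using no_base_right_of_entry[OF that, of c0 p] inj_u c0E w0 by simp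
  have 2: "p < c0" if "R w tu"
    using no_base_right_of_entry[OF that, of c0 q] inj_tu c0E w0 pq by simp
  show a: "\<not> R tw u"
  proof
    assume a: "R tw u"
    have "U1 p" using low2_entry[OF a] pE by (simp add: labels_def)
    then have "c0 < p" using d0 by blast
    then show False using no_base_right_of_entry[OF a inj_u, of c0 q] c0E w0 pq by auto
  qed
  have b: "c0 = p" if a: "R tw tu"
  proof -
    have "U0 p" using low2_entry[OF a] pE by (simp add: labels_def)
    then show ?thesis using uq by auto
  qed
  have c: "R tw tu \<longleftrightarrow> R w u" if c: "c0 = p"
  proof
    show "R tw tu" if a: "R w u"
      by (rule both_fwd[OF a]; use c c0 p pq in \<open>fastforce dest: uq d0 w_eqD\<close>)
    show "R w u" if a: "R tw tu"
      by (rule both_rev[OF a]; use c c0 p pq in \<open>fastforce dest: uq d0 w_eqD\<close>)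
  qed
  have d: "R w tu \<longleftrightarrow> R w u" if c: "p < c0"
  proof
    show "R w tu" if a: "R w u"
      by (rule entries_fwd[OF a]; use c c0 p pq in \<open>fastforce dest: uq d0 w_eqD\<close>)
    show "R w u" if a: "R w tu"
      by (rule entries_rev[OF a]; use c c0 p pq in \<open>fastforce dest: uq d0 w_eqD\<close>)
  qed
  show "R w u \<longleftrightarrow> R w tu \<or> R tw tu" "\<not> (R w tu \<and> R tw tu)"
    using b c d 1 2 le_neq_implies_less by blast+
qed

end
end
end

section \<open>Substitution and the operators \<open>\<xi>\<^sub>i\<close>\<close>

definition rename_monom :: "('u \<Rightarrow> 'v) \<Rightarrow> 'u monomial \<Rightarrow> 'v monomial" where
  "rename_monom h m = (\<Sum>u\<in>Poly_Mapping.keys m. Poly_Mapping.single (h u) (Poly_Mapping.lookup m u))"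

lemma rename_monom_superset:
  assumes "finite A" "Poly_Mapping.keys m \<subseteq> A"
  shows "rename_monom h m = (\<Sum>u\<in>A. Poly_Mapping.single (h u) (Poly_Mapping.lookup m u))"
  unfolding rename_monom_def using assms
  by (intro sum.mono_neutral_left) (auto simp: in_keys_iff)

lemma rename_monom_add: "rename_monom h (a + b) = rename_monom h a + rename_monom h b"
proof -
  let ?A = "Poly_Mapping.keys a \<union> Poly_Mapping.keys b"
  have "rename_monom h (a + b) = (\<Sum>u\<in>?A. Poly_Mapping.single (h u) (Poly_Mapping.lookup (a + b) u))"
    using keys_add[of a b] by (intro rename_monom_superset) auto
  also have "\<dots> = rename_monom h a + rename_monom h b"
    by (subst (1 2) rename_monom_superset[of ?A]) (auto simp: lookup_add single_add sum.distrib)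
  finally show ?thesis .
qed

lemma rename_monom_zero [simp]: "rename_monom h 0 = 0"
  by (simp add: rename_monom_def)

lemma rename_monom_single [simp]: "rename_monom h (Poly_Mapping.single v k) = Poly_Mapping.single (h v) k"
  by (simp add: rename_monom_def)

lemma rename_monom_sum: "rename_monom h (\<Sum>x\<in>A. f x) = (\<Sum>x\<in>A. rename_monom h (f x))"
  by (induction A rule: infinite_finite_induct) (simp_all add: rename_monom_add)

lemma var_power: "var v ^ k = Poly_Mapping.single (Poly_Mapping.single v k) 1"
  by (induction k) (simp_all add: var_def mult_single flip: single_add)

lemma prod_single:
  "(\<Prod>x\<in>A. Poly_Mapping.single (f x) (1 :: 'b :: comm_semiring_1)) = Poly_Mapping.single (\<Sum>x\<in>A. f x :: 'a :: comm_monoid_add) 1"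
  by (induction A rule: infinite_finite_induct) (simp_all add: mult_single)

text \<open>Renaming variables acts on exponents by a monoid homomorphism; in this form additivity
  and multiplicativity reduce to single terms.\<close>

lemma substitute_eq:
  "substitute h f = (\<Sum>m\<in>Poly_Mapping.keys f. Poly_Mapping.single (rename_monom h m) (Poly_Mapping.lookup f m))"
  unfolding substitute_def by (simp add: var_power prod_single mult_single rename_monom_def)

lemma substitute_superset:
  assumes "finite A" "Poly_Mapping.keys f \<subseteq> A"
  shows "substitute h f = (\<Sum>m\<in>A. Poly_Mapping.single (rename_monom h m) (Poly_Mapping.lookup f m))"
  unfolding substitute_eq using assms
  by (intro sum.mono_neutral_left) (auto simp: in_keys_iff)

lemma substitute_add: "substitute h (f + g) = substitute h f + substitute h g"
proof -
  let ?A = "Poly_Mapping.keys f \<union> Poly_Mapping.keys g"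
  have "substitute h (f + g) = (\<Sum>u\<in>?A. Poly_Mapping.single (rename_monom h u) (Poly_Mapping.lookup (f + g) u))"
    using keys_add[of f g] by (intro substitute_superset) auto
  also have "\<dots> = substitute h f + substitute h g"
    by (subst (1 2) substitute_superset[of ?A]) (auto simp: lookup_add single_add sum.distrib)
  finally show ?thesis .
qed

lemma substitute_zero [simp]: "substitute h 0 = 0"
  by (simp add: substitute_eq)

lemma substitute_single [simp]:
  "substitute h (Poly_Mapping.single m c) = Poly_Mapping.single (rename_monom h m) c"
  by (simp add: substitute_eq)

lemma substitute_sum: "substitute h (\<Sum>x\<in>A. f x) = (\<Sum>x\<in>A. substitute h (f x))"
  by (induction A rule: infinite_finite_induct) (simp_all add: substitute_add)

lemma poly_mapping_sum_singles:
  "f = (\<Sum>m\<in>Poly_Mapping.keys f. Poly_Mapping.single m (Poly_Mapping.lookup f m))"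
  by (rule poly_mapping_eqI) (simp add: lookup_sum lookup_single when_def in_keys_iff)

lemma substitute_mult: "substitute h (f * g) = substitute h f * substitute h g"
proof -
  have "f * g = (\<Sum>a\<in>Poly_Mapping.keys f. \<Sum>b\<in>Poly_Mapping.keys g.
      Poly_Mapping.single (a + b) (Poly_Mapping.lookup f a * Poly_Mapping.lookup g b))"
    by (subst (1) poly_mapping_sum_singles[of f], subst (1) poly_mapping_sum_singles[of g])
       (simp add: sum_product mult_single)
  then have "substitute h (f * g) = (\<Sum>a\<in>Poly_Mapping.keys f. \<Sum>b\<in>Poly_Mapping.keys g.
      Poly_Mapping.single (rename_monom h a + rename_monom h b) (Poly_Mapping.lookup f a * Poly_Mapping.lookup g b))"
    by (simp add: substitute_sum rename_monom_add)
  also have "\<dots> = substitute h f * substitute h g"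
    unfolding substitute_eq by (simp add: sum_product mult_single)
  finally show ?thesis .
qed

lemma substitute_var [simp]: "substitute h (var v) = var (h v)"
  by (simp add: var_def)

lemma substitute_one [simp]: "substitute h 1 = 1"
  by (simp flip: single_one)

lemma substitute_prod: "substitute h (\<Prod>x\<in>A. f x) = (\<Prod>x\<in>A. substitute h (f x))"
  by (induction A rule: infinite_finite_induct) (simp_all add: substitute_mult)

lemma substitute_uminus: "substitute h (- f) = - substitute h f"
  using substitute_add[of h f "- f"] by (simp add: add_eq_0_iff)

lemma substitute_diff: "substitute h (f - g) = substitute h f - substitute h g"
  using substitute_add[of h f "- g"] by (simp add: substitute_uminus)

lemma rename_monom_compose: "rename_monom h (rename_monom k m) = rename_monom (h \<circ> k) m"
  by (simp add: rename_monom_def[of k] rename_monom_sum) (simp add: rename_monom_def)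

lemma rename_monom_id: "rename_monom (\<lambda>x. x) m = m"
  unfolding rename_monom_def by (rule poly_mapping_sum_singles[symmetric])

lemma substitute_compose: "substitute h (substitute k f) = substitute (h \<circ> k) f"
  by (simp add: substitute_eq[of k] substitute_sum rename_monom_compose) (simp add: substitute_eq)

lemma substitute_id: "substitute (\<lambda>x. x) f = f"
  unfolding substitute_eq rename_monom_id by (rule poly_mapping_sum_singles[symmetric])

section \<open>Calculus of the operators\<close>

abbreviation exchange :: "nat \<Rightarrow> nat mpoly \<Rightarrow> nat mpoly" where
  "exchange i \<equiv> substitute (transpose i (Suc i))"

lemma exchange_exchange [simp]: "exchange i (exchange i f) = f"
  by (simp add: substitute_compose substitute_id id_def)

text \<open>A relational form of \<open>\<xi>\<^sub>i f = g\<close>, which is linear in \<open>(f, g)\<close> without knowing that the division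
  is exact.\<close>

definition is_\<xi> :: "nat \<Rightarrow> nat mpoly \<Rightarrow> nat mpoly \<Rightarrow> bool" where
  "is_\<xi> i f g \<longleftrightarrow> (var i - var (Suc i)) * g = var i * f - var (Suc i) * exchange i f"

lemma var_diff_nonzero: "var i - var (Suc i) \<noteq> (0 :: nat mpoly)"
proof
  assume "var i - var (Suc i) = (0 :: nat mpoly)"
  then have "Poly_Mapping.single i (1::nat) = Poly_Mapping.single (Suc i) 1"
    unfolding var_def by (metis keys_single right_minus_eq singleton_inject zero_neq_one)
  then show False by (metis keys_single n_not_Suc_n singleton_inject zero_neq_one)
qed

lemma \<xi>_eqI: "is_\<xi> i f g \<Longrightarrow> \<xi> i f = g"
  unfolding \<xi>_def is_\<xi>_def
  by (rule the_equality) (use var_diff_nonzero[of i] in \<open>metis mult_left_cancel\<close>)+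

lemma is_\<xi>_zero: "is_\<xi> i 0 0"
  by (simp add: is_\<xi>_def)

lemma is_\<xi>_add: "is_\<xi> i f g \<Longrightarrow> is_\<xi> i f' g' \<Longrightarrow> is_\<xi> i (f + f') (g + g')"
  by (simp add: is_\<xi>_def substitute_add algebra_simps)

lemma is_\<xi>_diff:
  assumes "is_\<xi> i f g" "is_\<xi> i f' g'"
  shows "is_\<xi> i (f - f') (g - g')"
proof -
  have "(var i - var (Suc i)) * (g - g') = (var i - var (Suc i)) * g - (var i - var (Suc i)) * g'"
    by (rule right_diff_distrib)
  also have "\<dots> = (var i * f - var (Suc i) * exchange i f) - (var i * f' - var (Suc i) * exchange i f')"
    using assms by (simp add: is_\<xi>_def)
  finally show ?thesis by (simp add: is_\<xi>_def substitute_diff algebra_simps)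
qed

lemma is_\<xi>_sum: "(\<And>x. x \<in> A \<Longrightarrow> is_\<xi> i (f x) (g x)) \<Longrightarrow> is_\<xi> i (\<Sum>x\<in>A. f x) (\<Sum>x\<in>A. g x)"
  by (induction A rule: infinite_finite_induct) (auto intro: is_\<xi>_zero is_\<xi>_add)

text \<open>Summing over all rows instead of over orbits doubles both sides; the factor 2 cancels
  because the coefficients are integers.\<close>

lemma is_\<xi>_half:
  assumes "is_\<xi> i (f + f) (g + g)"
  shows "is_\<xi> i f g"
proof -
  have halve: "A = B - C" if "A + A = (B + B) - (C + C)" for A B C :: "nat mpoly"
  proof -
    have "2 * A = 2 * (B - C)" unfolding mult_2 that by simp
    then show ?thesis using mult_left_cancel[of 2 A "B - C"] zero_neq_numeral by metis
  qed
  show ?thesis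
    using assms unfolding is_\<xi>_def substitute_add distrib_left by (rule halve)
qed

lemma is_\<xi>_mult:
  assumes "exchange i y = y" "is_\<xi> i f g"
  shows "is_\<xi> i (y * f) (y * g)"
proof -
  have "(var i - var (Suc i)) * (y * g) = y * ((var i - var (Suc i)) * g)"
    by (rule mult.left_commute)
  also have "\<dots> = y * (var i * f - var (Suc i) * exchange i f)"
    using assms(2) by (simp add: is_\<xi>_def)
  also have "\<dots> = var i * (y * f) - var (Suc i) * exchange i (y * f)"
    by (simp add: substitute_mult assms(1) right_diff_distrib mult.left_commute)
  finally show ?thesis by (simp add: is_\<xi>_def)
qed

lemma is_\<xi>_self: "exchange i g = g \<Longrightarrow> is_\<xi> i g g"
  by (simp add: is_\<xi>_def algebra_simps)

text \<open>The divisor and the numerator both change sign under the exchange of the two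
  variables.\<close>

lemma is_\<xi>_exchange: assumes "is_\<xi> i f g" shows "exchange i g = g"
proof -
  have "exchange i ((var i - var (Suc i)) * g) = exchange i (var i * f - var (Suc i) * exchange i f)"
    using assms by (simp add: is_\<xi>_def)
  then have "(var (Suc i) - var i) * exchange i g = var (Suc i) * exchange i f - var i * f"
    by (simp add: substitute_mult substitute_diff)
  also have "\<dots> = - ((var i - var (Suc i)) * g)"
    using assms by (simp add: is_\<xi>_def)
  also have "\<dots> = (var (Suc i) - var i) * g"
    by (simp add: algebra_simps)
  finally have eq: "(var (Suc i) - var i) * exchange i g = (var (Suc i) - var i) * g" .
  have "var (Suc i) - var i \<noteq> (0 :: nat mpoly)"
    using var_diff_nonzero[of i] unfolding right_minus_eq by (rule not_sym)
  with eq show ?thesis by (rule mult_left_cancel[THEN iffD1, rotated])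
qed

text \<open>For rows that contain \<open>i\<close> but not \<open>i + 1\<close>: their weight is
  \<open>var i\<close> times a symmetric factor, and it becomes \<open>var (Suc i)\<close> times the
  same factor when the row is exchanged.\<close>

lemma is_\<xi>_var:
  assumes "is_\<xi> i f g"
  shows "is_\<xi> i (var i * f) (var i * f + var (Suc i) * g)" "is_\<xi> i (var (Suc i) * g) 0"
proof -
  have "(var i - var (Suc i)) * (var i * f + var (Suc i) * g) =
      (var i - var (Suc i)) * var i * f + var (Suc i) * ((var i - var (Suc i)) * g)"
    by (simp add: algebra_simps)
  also have "\<dots> = (var i - var (Suc i)) * var i * f + var (Suc i) * (var i * f - var (Suc i) * exchange i f)"
    using assms by (simp add: is_\<xi>_def)
  also have "\<dots> = var i * (var i * f) - var (Suc i) * exchange i (var i * f)"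
    by (simp add: substitute_mult algebra_simps)
  finally show "is_\<xi> i (var i * f) (var i * f + var (Suc i) * g)" by (simp add: is_\<xi>_def)
  have "exchange i (var (Suc i) * g) = var i * g"
    by (subst substitute_mult) (simp only: substitute_var transpose_apply_second is_\<xi>_exchange[OF assms])
  then have "(var i - var (Suc i)) * 0 = var i * (var (Suc i) * g) - var (Suc i) * exchange i (var (Suc i) * g)"
    using mult.left_commute[of "var i" "var (Suc i)" g] by (simp only: mult_zero_right diff_self)
  then show "is_\<xi> i (var (Suc i) * g) 0"
    by (simp only: is_\<xi>_def)
qed

section \<open>Exchanging adjacent labels in the basement\<close>

definition cols :: "nat \<Rightarrow> (nat \<Rightarrow> nat) \<Rightarrow> nat \<Rightarrow> nat set" where
  "cols n \<alpha> j = {c. c < n \<and> j \<le> \<alpha> c}"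

lemma finite_cols [simp]: "finite (cols n \<alpha> j)"
  by (simp add: cols_def)

text \<open>Extensional functions, so that a row is determined by its entries and no row is counted
  twice.\<close>

definition rows :: "nat \<Rightarrow> (nat \<Rightarrow> nat) \<Rightarrow> nat \<Rightarrow> (nat \<Rightarrow> 'a::linorder) \<Rightarrow> (nat \<Rightarrow> 'a) set" where
  "rows n \<alpha> j w = {u \<in> cols n \<alpha> (Suc j) \<rightarrow>\<^sub>E UNIV. inj_on u (cols n \<alpha> (Suc j)) \<and>
     row_ok (cols n \<alpha> j) (cols n \<alpha> (Suc j)) \<alpha> w u}"

lemma finite_rows: "finite (rows n \<alpha> j (w :: nat \<Rightarrow> nat))"
proof (rule finite_subset)
  show "rows n \<alpha> j w \<subseteq> (\<Pi>\<^sub>E c\<in>cols n \<alpha> (Suc j). {..w c})"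
    by (force simp: rows_def row_ok_def PiE_iff extensional_def)
qed (simp add: finite_PiE)

lemma rows_cong:
  assumes "\<And>c. c \<in> cols n \<alpha> j \<Longrightarrow> w c = w' c"
  shows "rows n \<alpha> j w = rows n \<alpha> j w'"
proof -
  have "c \<in> cols n \<alpha> j" if "c \<in> cols n \<alpha> (Suc j)" for c using that by (auto simp: cols_def)
  then show ?thesis using assms by (simp add: rows_def row_ok_def)
qed

definition row_weight :: "nat set \<Rightarrow> (nat \<Rightarrow> nat) \<Rightarrow> nat mpoly" where
  "row_weight E u = (\<Prod>c\<in>E. var (u c))"

text \<open>\<open>gf n \<alpha> N j w\<close> sums over the fillings of the rows \<open>j + 1, \<dots>, j + N\<close> above the row \<open>w\<close>.\<close>

primrec gf :: "nat \<Rightarrow> (nat \<Rightarrow> nat) \<Rightarrow> nat \<Rightarrow> nat \<Rightarrow> (nat \<Rightarrow> nat) \<Rightarrow> nat mpoly" where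
  "gf n \<alpha> 0 j w = 1"
| "gf n \<alpha> (Suc N) j w = (\<Sum>u\<in>rows n \<alpha> j w. row_weight (cols n \<alpha> (Suc j)) u * gf n \<alpha> N (Suc j) u)"

lemma gf_cong:
  assumes "\<And>c. c \<in> cols n \<alpha> j \<Longrightarrow> w c = w' c"
  shows "gf n \<alpha> N j w = gf n \<alpha> N j w'"
  using rows_cong[OF assms] by (cases N) simp_all

text \<open>In these configurations, exchanging the labels \<open>i\<close> and \<open>i + 1\<close> corresponds to applying
  \<open>\<xi>\<^sub>i\<close> and \<open>\<xi>\<^sub>i - 1\<close>, respectively.\<close>

definition low1 :: "nat set \<Rightarrow> (nat \<Rightarrow> nat) \<Rightarrow> nat \<Rightarrow> (nat \<Rightarrow> nat) \<Rightarrow> bool" where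
  "low1 D \<alpha> i w \<longleftrightarrow> (\<forall>p\<in>D. w p = Suc i \<longrightarrow> (\<exists>q\<in>D. w q = i \<and> p < q \<and> \<alpha> p \<le> \<alpha> q))"

definition low2 :: "nat set \<Rightarrow> (nat \<Rightarrow> nat) \<Rightarrow> nat \<Rightarrow> (nat \<Rightarrow> nat) \<Rightarrow> bool" where
  "low2 D \<alpha> i w \<longleftrightarrow> (\<exists>p\<in>D. \<exists>q\<in>D. w p = i \<and> w q = Suc i \<and> p < q \<and> \<alpha> q < \<alpha> p)"

text \<open>The image of the operator consists of symmetric polynomials, which it fixes; subtracting
  \<open>f \<mapsto> f + f'\<close> from the fixed \<open>f + f'\<close> leaves
  \<open>f' \<mapsto> 0\<close>.\<close>

lemma is_\<xi>_invariant_factor: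
  assumes "exchange i x = x" "is_\<xi> i f (f + f')"
  shows "is_\<xi> i (x * f) (x * f + x * f')" "is_\<xi> i (x * f') 0"
proof -
  show f: "is_\<xi> i (x * f) (x * f + x * f')"
    using is_\<xi>_mult[OF assms] by (simp add: distrib_left)
  have "is_\<xi> i (x * f + x * f') (x * f + x * f')"
    using f by (intro is_\<xi>_self is_\<xi>_exchange)
  from is_\<xi>_diff[OF this f] show "is_\<xi> i (x * f') 0" by simp
qed

lemma exchange_row_weight: "exchange i (row_weight E u) = row_weight E (\<lambda>c. transpose i (Suc i) (u c))"
  by (simp add: row_weight_def substitute_prod)

lemma row_weight_cong: "(\<And>c. c \<in> E \<Longrightarrow> u c = v c) \<Longrightarrow> row_weight E u = row_weight E v"
  by (simp add: row_weight_def)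

lemma row_weight_both:
  assumes "inj_on u E" "i \<in> u ` E" "Suc i \<in> u ` E"
  shows "row_weight E (\<lambda>c. transpose i (Suc i) (u c)) = row_weight E u"
proof -
  have img: "transpose i (Suc i) ` u ` E = u ` E"
    using assms(2,3) by (intro transpose_image_eq) blast
  have "row_weight E (\<lambda>c. transpose i (Suc i) (u c)) = (\<Prod>v\<in>u ` E. var (transpose i (Suc i) v))"
    using assms(1) by (simp add: row_weight_def prod.reindex)
  also have "\<dots> = (\<Prod>v\<in>transpose i (Suc i) ` u ` E. var v)"
    by (subst prod.reindex) (auto intro: inj_on_subset[OF inj_transpose])
  also have "\<dots> = row_weight E u"
    unfolding img using assms(1) by (simp add: row_weight_def prod.reindex)
  finally show ?thesis .
qed

lemma row_weight_one:
  assumes "finite E" "c0 \<in> E" "u c0 = i" "inj_on u E" "Suc i \<notin> u ` E"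
  shows "\<exists>y. exchange i y = y \<and> row_weight E u = var i * y \<and>
    row_weight E (\<lambda>c. transpose i (Suc i) (u c)) = var (Suc i) * y"
proof (intro exI conjI)
  let ?y = "\<Prod>c\<in>E - {c0}. var (u c)"
  have other: "transpose i (Suc i) (u c) = u c" if "c \<in> E - {c0}" for c
  proof (rule transpose_apply_other)
    show "u c \<noteq> i" using that assms(2-4) by (metis Diff_iff inj_onD insertI1)
    show "u c \<noteq> Suc i" using that assms(5) by (metis Diff_iff image_eqI)
  qed
  show "exchange i ?y = ?y" using other by (simp add: substitute_prod)
  show "row_weight E u = var i * ?y"
    unfolding row_weight_def using assms by (subst prod.remove[of E c0]) auto
  show "row_weight E (\<lambda>c. transpose i (Suc i) (u c)) = var (Suc i) * ?y"
    unfolding row_weight_def using assms other by (subst prod.remove[of E c0]) auto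
qed

text \<open>The bound on the heights says that no row is missing; without it \<open>low2\<close> fails for \<open>N = 0\<close>.\<close>

theorem gf_exchange:
  assumes "inj_on w (cols n \<alpha> j)" and "\<forall>c<n. \<alpha> c \<le> j + N"
  shows "(low1 (cols n \<alpha> j) \<alpha> i w \<longrightarrow> is_\<xi> i (gf n \<alpha> N j w) (gf n \<alpha> N j (\<lambda>c. transpose i (Suc i) (w c)))) \<and>
    (low2 (cols n \<alpha> j) \<alpha> i w \<longrightarrow> is_\<xi> i (gf n \<alpha> N j w)
       (gf n \<alpha> N j (\<lambda>c. transpose i (Suc i) (w c)) + gf n \<alpha> N j w))"
  using assms
proof (induction N arbitrary: j w)
  case 0
  have "\<not> low2 (cols n \<alpha> j) \<alpha> i w"
    using 0 by (force simp: low2_def cols_def)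
  moreover have "is_\<xi> i 1 1" by (rule is_\<xi>_self) simp
  ultimately show ?case by simp
next
  case (Suc N)
  define D where "D = cols n \<alpha> j"
  define E where "E = cols n \<alpha> (Suc j)"
  let ?t = "transpose i (Suc i)"
  let ?R = "row_ok D E \<alpha>"
  let ?tw = "\<lambda>c. ?t (w c)"
  define F where "F u = row_weight E u * gf n \<alpha> N (Suc j) u" for u
  \<comment> \<open>A bound for all labels of \<open>w\<close> and for both exchanged labels. Hence
    \<open>U\<close> contains every row admissible over \<open>w\<close> or over the exchanged
    basement, and it is closed under the exchange.\<close>
  define K where "K = Suc i + (\<Sum>c\<in>D. w c)"
  define U where "U = {u \<in> E \<rightarrow>\<^sub>E {..K}. inj_on u E}"
  define \<phi> where "\<phi> u = restrict (\<lambda>c. ?t (u c)) E" for u :: "nat \<Rightarrow> nat"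
  define a where "a u = (if ?R ?tw u then F u else 0)" for u
  define b where "b u = (if ?R w u then F u else 0)" for u
  have fin: "finite D" "finite E" "E \<subseteq> D" by (auto simp: D_def E_def cols_def)
  have finU: "finite U" unfolding U_def by (rule finite_subset[of _ "E \<rightarrow>\<^sub>E {..K}"]) (auto intro: finite_PiE fin)
  have wK: "w c \<le> K" if "c \<in> D" for c
    using member_le_sum[of c D w] that fin by (auto simp: K_def)
  have tK: "?t x \<le> K" if "x \<le> K" for x
    using that by (auto simp: transpose_def K_def)
  have gf_rows: "gf n \<alpha> (Suc N) j v = (\<Sum>u\<in>U. if ?R v u then F u else 0)" if v: "\<And>c. c \<in> D \<Longrightarrow> v c \<le> K" for v
  proof -
    have "rows n \<alpha> j v = {u \<in> U. ?R v u}"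
    proof (intro set_eqI iffI)
      fix u assume u: "u \<in> rows n \<alpha> j v"
      then have "u c \<le> K" if "c \<in> E" for c
        using that v[of c] fin by (force simp: rows_def D_def E_def row_ok_def)
      then show "u \<in> {u \<in> U. ?R v u}"
        using u by (auto simp: rows_def D_def E_def U_def PiE_iff)
    next
      fix u assume "u \<in> {u \<in> U. ?R v u}"
      then show "u \<in> rows n \<alpha> j v"
        by (auto simp: rows_def D_def E_def U_def PiE_iff)
    qed
    then have "gf n \<alpha> (Suc N) j v = (\<Sum>u | u \<in> U \<and> ?R v u. F u)"
      by (simp add: F_def E_def)
    then show ?thesis by (simp only: sum.inter_filter[OF finU])
  qed
  have inj_w: "inj_on w D" using Suc.prems by (simp add: D_def)
  have sums: "gf n \<alpha> (Suc N) j w = (\<Sum>u\<in>U. b u)" "gf n \<alpha> (Suc N) j ?tw = (\<Sum>u\<in>U. a u)"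
    unfolding a_def b_def by (rule gf_rows; blast intro: wK tK)+
  have \<phi>U: "\<phi> u \<in> U" if "u \<in> U" for u
  proof -
    have "inj_on (\<phi> u) E"
    proof (rule inj_onI)
      fix c d assume cd: "c \<in> E" "d \<in> E" "\<phi> u c = \<phi> u d"
      then have "?t (?t (u c)) = ?t (?t (u d))" by (simp add: \<phi>_def)
      then show "c = d" using cd that by (auto simp: U_def dest: inj_onD)
    qed
    moreover have "\<phi> u \<in> E \<rightarrow>\<^sub>E {..K}"
      using that tK unfolding U_def \<phi>_def by (intro restrict_PiE_iff[THEN iffD2]) blast
    ultimately show ?thesis by (simp add: U_def)
  qed
  have \<phi>\<phi>: "\<phi> (\<phi> u) = u" if "u \<in> U" for u
    using that by (auto simp: U_def \<phi>_def PiE_iff extensional_def fun_eq_iff)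
  have reindex: "(\<Sum>u\<in>U. f (\<phi> u)) = (\<Sum>u\<in>U. f u)" for f :: "(nat \<Rightarrow> nat) \<Rightarrow> nat mpoly"
    by (rule sum.reindex_bij_witness[of _ \<phi> \<phi>]) (auto simp: \<phi>U \<phi>\<phi>)
  have F\<phi>: "F (\<phi> u) = row_weight E (\<lambda>c. ?t (u c)) * gf n \<alpha> N (Suc j) (\<lambda>c. ?t (u c))" for u
    using row_weight_cong[of E "\<phi> u" "\<lambda>c. ?t (u c)"] gf_cong[of n \<alpha> "Suc j" "\<phi> u" "\<lambda>c. ?t (u c)" N]
    by (simp add: F_def \<phi>_def E_def)
  have R\<phi>: "?R v (\<phi> u) \<longleftrightarrow> ?R v (\<lambda>c. ?t (u c))" for v u
    by (simp add: row_ok_def \<phi>_def)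
  have a\<phi>: "a (\<phi> u) = (if ?R ?tw (\<lambda>c. ?t (u c)) then F (\<phi> u) else 0)"
    and b\<phi>: "b (\<phi> u) = (if ?R w (\<lambda>c. ?t (u c)) then F (\<phi> u) else 0)" for u
    by (simp_all add: a_def b_def R\<phi>)
  have bound: "\<forall>c<n. \<alpha> c \<le> Suc j + N" using Suc.prems(2) by auto
  \<comment> \<open>It suffices to treat the orbits of \<open>\<phi>\<close>; summing over all \<open>u\<close> counts each of them twice.\<close>
  have pair: "(low1 D \<alpha> i w \<longrightarrow> is_\<xi> i (b u + b (\<phi> u)) (a u + a (\<phi> u))) \<and>
      (low2 D \<alpha> i w \<longrightarrow> is_\<xi> i (b u + b (\<phi> u)) ((a u + a (\<phi> u)) + (b u + b (\<phi> u))))"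
    if u: "u \<in> U" and low: "low1 E \<alpha> i u \<or> low2 E \<alpha> i u" for u
  proof -
    have inj_u: "inj_on u E" using u by (simp add: U_def)
    interpret adjacent_rows D E \<alpha> i w u
      using inj_w inj_u fin(3) by unfold_locales (auto simp: D_def E_def cols_def)
    have w1: "W1 p \<Longrightarrow> \<exists>q. W0 q \<and> p < q \<and> \<alpha> p \<le> \<alpha> q" if "low1 D \<alpha> i w" for p
      using that by (auto simp: low1_def labels_def)
    have w2: "\<exists>p q. W0 p \<and> W1 q \<and> p < q \<and> \<alpha> q < \<alpha> p" if "low2 D \<alpha> i w"
      using that by (auto simp: low2_def labels_def)
    have img: "U0 c \<Longrightarrow> i \<in> u ` E" "U1 c \<Longrightarrow> Suc i \<in> u ` E" for c
      unfolding labels_def by (metis image_eqI)+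
    note IH = Suc.IH[of u "Suc j", folded E_def, OF inj_u bound]
    have X: "exchange i (row_weight E u) = row_weight E (\<lambda>c. ?t (u c))"
      by (rule exchange_row_weight)
    \<comment> \<open>A row with \<open>i\<close> but without \<open>i + 1\<close> satisfies
      \<open>low1\<close>, yet it is grouped with \<open>low2\<close>: in both situations the
      operator annihilates \<open>F (\<phi> u)\<close>.\<close>
    consider (none) "\<And>c. \<not> U0 c" "\<And>c. \<not> U1 c"
      | (both1) c0 d0 where "U1 c0" "U0 d0" "c0 < d0" "\<alpha> c0 \<le> \<alpha> d0"
      | (both2) c0 where "U0 c0" "\<And>d. U1 d \<Longrightarrow> c0 < d \<and> \<alpha> d < \<alpha> c0"
    proof (cases "low2 E \<alpha> i u")
      case True
      then obtain c0 d where "U0 c0" "U1 d" "c0 < d" "\<alpha> d < \<alpha> c0"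
        by (auto simp: low2_def labels_def)
      then show ?thesis using that(3)[of c0] labels_unique(4) by blast
    next
      case False
      then have "U1 c \<Longrightarrow> \<exists>d. U0 d \<and> c < d \<and> \<alpha> c \<le> \<alpha> d" for c
        using low by (auto simp: low1_def labels_def)
      then show ?thesis using that by blast
    qed
    then show ?thesis
    proof cases
      case none
      have tu: "\<phi> u = u"
      proof
        fix c
        have "c \<in> E \<Longrightarrow> ?t (u c) = u c"
          using none[of c] by (intro transpose_apply_other) (auto simp: labels_def)
        then show "\<phi> u c = u c" using u by (auto simp: \<phi>_def U_def PiE_iff extensional_def)
      qed
      have "low1 E \<alpha> i u" using none by (auto simp: low1_def labels_def)
      \<comment> \<open>Relabelling does not change \<open>u\<close>, so the induction hypothesis
        makes the generating function above it an image of the operator, hence symmetric.\<close>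
      then have ex: "exchange i (gf n \<alpha> N (Suc j) u) = gf n \<alpha> N (Suc j) u"
        using IH gf_cong[of n \<alpha> "Suc j" "\<phi> u" "\<lambda>c. ?t (u c)" N] tu is_\<xi>_exchange[of i]
        by (metis E_def \<phi>_def restrict_apply')
      have "exchange i (row_weight E u) = row_weight E u"
        using X row_weight_cong[of E "\<phi> u" "\<lambda>c. ?t (u c)"] tu by (simp add: \<phi>_def)
      with ex have "is_\<xi> i (F u) (F u)"
        by (intro is_\<xi>_self) (simp add: F_def substitute_mult)
      then have "is_\<xi> i (b u) (b u)" by (simp add: b_def is_\<xi>_zero)
      then have bb: "is_\<xi> i (b u + b u) (b u + b u)" by (intro is_\<xi>_add)
      have "a u = b u" if "low1 D \<alpha> i w"
        using low1_none[OF w1[OF that] none] by (simp add: a_def b_def)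
      moreover have "a u = 0" if "low2 D \<alpha> i w"
        using w2[OF that] low2_none none by (auto simp: a_def)
      ultimately show ?thesis using bb unfolding tu by (metis add_0_left)
    next
      case both1
      have ui: "i \<in> u ` E" "Suc i \<in> u ` E" using both1 img by blast+
      have "low1 E \<alpha> i u" unfolding low1_def
        using both1 labels_unique by (metis labels_def(3,4))
      then have "is_\<xi> i (gf n \<alpha> N (Suc j) u) (gf n \<alpha> N (Suc j) (\<lambda>c. ?t (u c)))"
        using IH by blast
      then have FF: "is_\<xi> i (F u) (F (\<phi> u))"
        unfolding F\<phi> row_weight_both[OF inj_u ui] unfolding F_def
        by (intro is_\<xi>_mult) (simp_all add: X row_weight_both[OF inj_u ui])
      then have FF': "is_\<xi> i (F (\<phi> u)) (F (\<phi> u))"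
        by (intro is_\<xi>_self is_\<xi>_exchange)
      show ?thesis
      proof (intro conjI impI)
        assume "low1 D \<alpha> i w"
        from low1_low1[OF w1[OF this] both1] FF FF'
        show "is_\<xi> i (b u + b (\<phi> u)) (a u + a (\<phi> u))"
          unfolding a\<phi> b\<phi> by (auto simp: a_def b_def is_\<xi>_zero)
      next
        assume "low2 D \<alpha> i w"
        then obtain p q where "W0 p" "W1 q" "p < q" "\<alpha> q < \<alpha> p" using w2 by blast
        from low2_low1[OF this both1] FF'
        show "is_\<xi> i (b u + b (\<phi> u)) ((a u + a (\<phi> u)) + (b u + b (\<phi> u)))"
          unfolding a\<phi> b\<phi> by (auto simp: a_def b_def is_\<xi>_zero)
      qed
    next
      case both2
      have FF: "is_\<xi> i (F u) (F u + F (\<phi> u))" "is_\<xi> i (F (\<phi> u)) 0"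
      proof -
        have "is_\<xi> i (F u) (F u + F (\<phi> u)) \<and> is_\<xi> i (F (\<phi> u)) 0"
        \<comment> \<open>With both labels present the weight is symmetric and factors out. With
          \<open>i\<close> alone the weight itself changes from \<open>var i\<close> to
          \<open>var (Suc i)\<close>, and this produces the extra summand although the part above
          the row is only of type \<open>low1\<close>.\<close>
        proof (cases "\<exists>d. U1 d")
          case True
          then obtain d where d: "U1 d" by blast
          have ui: "i \<in> u ` E" "Suc i \<in> u ` E" using both2 d img by blast+
          have "low2 E \<alpha> i u" unfolding low2_def
            using both2 d by (auto simp: labels_def)
          then have g: "is_\<xi> i (gf n \<alpha> N (Suc j) u) (gf n \<alpha> N (Suc j) u + gf n \<alpha> N (Suc j) (\<lambda>c. ?t (u c)))"
            using IH by (simp add: add.commute)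
          show ?thesis unfolding F\<phi> unfolding F_def
            unfolding row_weight_both[OF inj_u ui]
            using is_\<xi>_invariant_factor[OF _ g] X row_weight_both[OF inj_u ui] by simp
        next
          case False
          then have n: "Suc i \<notin> u ` E" by (force simp: labels_def)
          have c0: "c0 \<in> E" "u c0 = i" using both2 by (auto simp: labels_def)
          have "low1 E \<alpha> i u" using False by (auto simp: low1_def labels_def)
          then have g: "is_\<xi> i (gf n \<alpha> N (Suc j) u) (gf n \<alpha> N (Suc j) (\<lambda>c. ?t (u c)))"
            using IH by blast
          obtain y where y: "exchange i y = y" "row_weight E u = var i * y"
            "row_weight E (\<lambda>c. ?t (u c)) = var (Suc i) * y"
            using row_weight_one[of E c0 u i] fin c0 inj_u n by blast
          have gy: "is_\<xi> i (y * gf n \<alpha> N (Suc j) u) (y * gf n \<alpha> N (Suc j) (\<lambda>c. ?t (u c)))"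
            by (rule is_\<xi>_mult[OF y(1) g])
          show ?thesis unfolding F\<phi> unfolding F_def y(2,3)
            using is_\<xi>_var[OF gy] by (simp add: mult.assoc)
        qed
        then show "is_\<xi> i (F u) (F u + F (\<phi> u))" "is_\<xi> i (F (\<phi> u)) 0" by blast+
      qed
      have FF2: "is_\<xi> i (F u + F (\<phi> u)) (F u + F (\<phi> u))"
        using is_\<xi>_add[OF FF] by simp
      show ?thesis
      proof (intro conjI impI)
        assume "low1 D \<alpha> i w"
        \<comment> \<open>\<open>b (\<phi> u)\<close> is undetermined here, but its image is 0 in
          any case.\<close>
        from low1_low2[OF w1[OF this] both2] FF FF2
        show "is_\<xi> i (b u + b (\<phi> u)) (a u + a (\<phi> u))"
          unfolding a\<phi> b\<phi> by (auto simp: a_def b_def is_\<xi>_zero)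
      next
        assume "low2 D \<alpha> i w"
        then obtain p q where "W0 p" "W1 q" "p < q" "\<alpha> q < \<alpha> p" using w2 by blast
        from low2_low2[OF this both2] FF FF2
        show "is_\<xi> i (b u + b (\<phi> u)) ((a u + a (\<phi> u)) + (b u + b (\<phi> u)))"
          unfolding a\<phi> b\<phi> by (auto simp: a_def b_def is_\<xi>_zero add.commute)
      qed
    qed
  qed
  \<comment> \<open>At least one member of each orbit is in one of the two positions treated; since
    \<open>pair\<close> is symmetric in the two members, that suffices.\<close>
  have low: "(low1 E \<alpha> i u \<or> low2 E \<alpha> i u) \<or> (low1 E \<alpha> i (\<phi> u) \<or> low2 E \<alpha> i (\<phi> u))" if "u \<in> U" for u
  proof (cases "\<exists>c\<in>E. \<exists>d\<in>E. u c = i \<and> u d = Suc i")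
    case True
    then obtain c d where cd: "c \<in> E" "d \<in> E" "u c = i" "u d = Suc i" by blast
    have inj_u: "inj_on u E" using \<open>u \<in> U\<close> by (simp add: U_def)
    have uniq: "x = d" if "x \<in> E" "u x = Suc i" for x
      using inj_onD[OF inj_u, of x d] that cd by simp
    have uniq': "x = c" if "x \<in> E" "u x = i" for x
      using inj_onD[OF inj_u, of x c] that cd by simp
    have \<phi>cd: "\<phi> u c = Suc i" "\<phi> u d = i" using cd by (simp_all add: \<phi>_def)
    have \<phi>uniq: "x = c" if "x \<in> E" "\<phi> u x = Suc i" for x
      using that uniq'[of x] by (auto simp: \<phi>_def transpose_def split: if_splits)
    have "c \<noteq> d" using cd by auto
    then consider "d < c" "\<alpha> d \<le> \<alpha> c" | "d < c" "\<alpha> c < \<alpha> d" | "c < d" "\<alpha> c \<le> \<alpha> d" | "c < d" "\<alpha> d < \<alpha> c"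
      by linarith
    then show ?thesis
    proof cases
      case 1
      have "low1 E \<alpha> i u" unfolding low1_def using 1 cd uniq by metis
      then show ?thesis by blast
    next
      case 2
      have "low2 E \<alpha> i (\<phi> u)" unfolding low2_def using 2 cd \<phi>cd by metis
      then show ?thesis by blast
    next
      case 3
      have "low1 E \<alpha> i (\<phi> u)" unfolding low1_def using 3 cd \<phi>cd \<phi>uniq by metis
      then show ?thesis by blast
    next
      case 4
      have "low2 E \<alpha> i u" unfolding low2_def using 4 cd by metis
      then show ?thesis by blast
    qed
  next
    case False
    show ?thesis
    proof (cases "\<exists>d\<in>E. u d = Suc i")
      case True
      then have "low1 E \<alpha> i (\<phi> u)"
        using False by (auto simp: low1_def \<phi>_def transpose_def split: if_splits)
      then show ?thesis by blast
    next
      case False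
      then show ?thesis by (auto simp: low1_def)
    qed
  qed
  have pair': "(low1 D \<alpha> i w \<longrightarrow> is_\<xi> i (b u + b (\<phi> u)) (a u + a (\<phi> u))) \<and>
      (low2 D \<alpha> i w \<longrightarrow> is_\<xi> i (b u + b (\<phi> u)) ((a u + a (\<phi> u)) + (b u + b (\<phi> u))))"
    if u: "u \<in> U" for u
    using low[OF u] pair[OF u] pair[OF \<phi>U[OF u]] \<phi>\<phi>[OF u] by (auto simp: add.commute)
  let ?A = "\<Sum>u\<in>U. a u" and ?B = "\<Sum>u\<in>U. b u"
  have AB: "(\<Sum>u\<in>U. a u + a (\<phi> u)) = ?A + ?A" "(\<Sum>u\<in>U. b u + b (\<phi> u)) = ?B + ?B"
    "(\<Sum>u\<in>U. (a u + a (\<phi> u)) + (b u + b (\<phi> u))) = (?A + ?B) + (?A + ?B)"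
    by (simp_all add: sum.distrib reindex add_ac)
  show ?case unfolding D_def[symmetric] sums
  proof (intro conjI impI)
    assume "low1 D \<alpha> i w"
    then have "is_\<xi> i (\<Sum>u\<in>U. b u + b (\<phi> u)) (\<Sum>u\<in>U. a u + a (\<phi> u))"
      using pair' by (intro is_\<xi>_sum) blast
    then show "is_\<xi> i ?B ?A" unfolding AB by (rule is_\<xi>_half)
  next
    assume "low2 D \<alpha> i w"
    then have "is_\<xi> i (\<Sum>u\<in>U. b u + b (\<phi> u)) (\<Sum>u\<in>U. (a u + a (\<phi> u)) + (b u + b (\<phi> u)))"
      using pair' by (intro is_\<xi>_sum) blast
    then show "is_\<xi> i ?B (?A + ?B)" unfolding AB by (rule is_\<xi>_half)
  qed
qed

section \<open>Key polynomials as generating functions\<close>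

lemma gf_heights_cong:
  assumes "\<And>c. c < n \<Longrightarrow> \<alpha> c = \<beta> c"
  shows "gf n \<alpha> N j w = gf n \<beta> N j w"
proof -
  have cols: "cols n \<alpha> k = cols n \<beta> k" for k
    using assms by (auto simp: cols_def)
  have "rows n \<alpha> k v = rows n \<beta> k v" for k and v :: "nat \<Rightarrow> nat"
    unfolding rows_def row_ok_def cols using assms by (auto simp: cols_def)
  then show ?thesis by (induction N arbitrary: j w) (simp_all add: cols)
qed

text \<open>Induction on the label below an entry. If the entry of \<open>c\<close> were smaller
  than that label, the base column \<open>d\<close> carrying it would be at least as high as
  \<open>c\<close>, and by induction would have the same entry, against injectivity.\<close>

lemma rows_dominant:
  fixes w :: "nat \<Rightarrow> nat"
  assumes w: "inj_on w {..<n}" "w ` {..<n} = {..<n}"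
    and dom: "\<And>p q. p < n \<Longrightarrow> q < n \<Longrightarrow> w p < w q \<Longrightarrow> \<alpha> q \<le> \<alpha> p"
  shows "rows n \<alpha> j w = {restrict w (cols n \<alpha> (Suc j))}"
proof (intro set_eqI iffI)
  let ?E = "cols n \<alpha> (Suc j)"
  fix u assume u: "u \<in> rows n \<alpha> j w"
  have le: "u c \<le> w c" if "c \<in> ?E" for c using u that by (auto simp: rows_def row_ok_def)
  have inj: "inj_on u ?E" using u by (simp add: rows_def)
  have "u c = w c" if "c \<in> ?E" for c
    using that
  proof (induction "w c" arbitrary: c rule: less_induct)
    case less
    show ?case
    proof (rule ccontr)
      assume "u c \<noteq> w c"
      then have lt: "u c < w c" using le[OF less.prems] by simp
      have c: "c < n" "Suc j \<le> \<alpha> c" using less.prems by (auto simp: cols_def)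
      have "w c < n" using w(2) c by blast
      then obtain d where d: "d < n" "w d = u c" using w(2) lt by (metis imageE less_trans lessThan_iff)
      then have dE: "d \<in> ?E" using dom[of d c] c lt by (auto simp: cols_def)
      then have "u d = u c" using less.hyps[of d] d lt by simp
      then have "d = c" using inj dE less.prems by (auto dest: inj_onD)
      then show False using d lt by simp
    qed
  qed
  then have "u = restrict w ?E"
    using u by (auto simp: rows_def PiE_iff extensional_def fun_eq_iff)
  then show "u \<in> {restrict w ?E}" by simp
next
  let ?E = "cols n \<alpha> (Suc j)"
  fix u assume "u \<in> {restrict w ?E}"
  then have u: "u = restrict w ?E" by simp
  have wD: "c = d" if "w c = w d" "c < n" "d < n" for c d
    using w(1) that by (auto dest: inj_onD)
  have "inj_on u ?E" unfolding u by (intro inj_onI) (auto simp: cols_def dest: wD)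
  moreover have "row_ok (cols n \<alpha> j) ?E \<alpha> w u"
  proof (rule row_okI)
    fix c d assume "c \<in> ?E" "d \<in> cols n \<alpha> j" "c < d" "u c \<le> w d" "w d \<le> w c"
    then show False using wD[of c d] by (auto simp: u cols_def)
  next
    fix c d assume "c \<in> ?E" "d \<in> ?E" "c < d" "u d \<le> u c" "u c \<le> w d"
    then show False using wD[of c d] by (auto simp: u cols_def)
  qed (simp add: u)
  ultimately show "u \<in> rows n \<alpha> j w" by (auto simp: rows_def u)
qed

lemma gf_dominant:
  fixes w :: "nat \<Rightarrow> nat"
  assumes w: "inj_on w {..<n}" "w ` {..<n} = {..<n}"
    and dom: "\<And>p q. p < n \<Longrightarrow> q < n \<Longrightarrow> w p < w q \<Longrightarrow> \<alpha> q \<le> \<alpha> p"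
    and "\<forall>c<n. \<alpha> c \<le> j + N"
  shows "gf n \<alpha> N j w = (\<Prod>c<n. var (w c) ^ (\<alpha> c - j))"
  using assms(4)
proof (induction N arbitrary: j)
  case 0
  then show ?case by simp
next
  case (Suc N)
  let ?E = "cols n \<alpha> (Suc j)"
  have "gf n \<alpha> (Suc N) j w = row_weight ?E (restrict w ?E) * gf n \<alpha> N (Suc j) (restrict w ?E)"
    using rows_dominant[OF w dom] by simp
  also have "row_weight ?E (restrict w ?E) = row_weight ?E w"
    by (rule row_weight_cong) simp
  also have "gf n \<alpha> N (Suc j) (restrict w ?E) = gf n \<alpha> N (Suc j) w"
    by (rule gf_cong) simp
  also have "row_weight ?E w = (\<Prod>c<n. if Suc j \<le> \<alpha> c then var (w c) else 1)"
    unfolding row_weight_def cols_def by (intro prod.mono_neutral_cong_left) auto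
  also have "gf n \<alpha> N (Suc j) w = (\<Prod>c<n. var (w c) ^ (\<alpha> c - Suc j))"
    using Suc by simp
  also have "(\<Prod>c<n. if Suc j \<le> \<alpha> c then var (w c) else 1) * (\<Prod>c<n. var (w c) ^ (\<alpha> c - Suc j))
      = (\<Prod>c<n. var (w c) ^ (\<alpha> c - j))"
    unfolding prod.distrib[symmetric]
  proof (rule prod.cong[OF refl])
    fix c
    show "(if Suc j \<le> \<alpha> c then var (w c) else 1) * var (w c) ^ (\<alpha> c - Suc j) = var (w c) ^ (\<alpha> c - j)"
    proof (cases "Suc j \<le> \<alpha> c")
      case True
      then have "\<alpha> c - j = Suc (\<alpha> c - Suc j)" by simp
      then show ?thesis using True by (simp only: if_True power_Suc)
    qed simp
  qed
  finally show ?case .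
qed

text \<open>In the dominant case both sides are the same monomial; otherwise both arise from smaller
  instances by the same operator. By \<open>compat\<close>, adjacent labels that are not in dominant
  order sit in columns \<open>p < q\<close>, and this makes undoing them an exchange of type
  \<open>low1\<close>.\<close>

lemma gf_swap_columns:
  fixes w :: "nat \<Rightarrow> nat"
  assumes i: "Suc i < n" "\<alpha> (Suc i) < \<alpha> i" and N: "\<forall>c<n. \<alpha> c \<le> N"
    and w: "inj_on w {..<n}" "w ` {..<n} = {..<n}"
    and compat: "\<And>p q. p < q \<Longrightarrow> q < n \<Longrightarrow> \<alpha> q \<le> \<alpha> p \<Longrightarrow> w p < w q"
  shows "gf n \<alpha> N 0 w = gf n (\<alpha> \<circ> transpose i (Suc i)) N 0 (w \<circ> transpose i (Suc i))"
  using w compat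
proof (induction "\<Sum>c<n. \<alpha> c * w c" arbitrary: w rule: less_induct)
  case less
  let ?\<tau> = "transpose i (Suc i)"
  let ?\<beta> = "\<alpha> \<circ> ?\<tau>"
  note inj = less.prems(1) and img = less.prems(2) and compat = less.prems(3)
  have wD: "c = d" if "w c = w d" "c < n" "d < n" for c d
    using inj that by (auto dest: inj_onD)
  have \<tau>n: "?\<tau> c < n \<longleftrightarrow> c < n" for c using i by (auto simp: transpose_def)
  have N\<beta>: "\<forall>c<n. ?\<beta> c \<le> 0 + N" using N \<tau>n by auto
  have \<tau>img: "?\<tau> ` {..<n} = {..<n}" using i by (intro transpose_image_eq) auto
  have inj_\<tau>: "inj_on (v \<circ> ?\<tau>) {..<n}" and img_\<tau>: "(v \<circ> ?\<tau>) ` {..<n} = {..<n}"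
    if "inj_on v {..<n}" "v ` {..<n} = {..<n}" for v :: "nat \<Rightarrow> nat"
  proof -
    show "inj_on (v \<circ> ?\<tau>) {..<n}"
      by (rule comp_inj_on) (simp_all add: \<tau>img that inj_on_subset[OF inj_transpose])
    show "(v \<circ> ?\<tau>) ` {..<n} = {..<n}"
      by (simp only: image_comp[symmetric] \<tau>img that)
  qed
  show ?case
  proof (cases "\<forall>p<n. \<forall>q<n. w p < w q \<longrightarrow> \<alpha> q \<le> \<alpha> p")
    case True
    have "gf n \<alpha> N 0 w = (\<Prod>c<n. var (w c) ^ \<alpha> c)"
      using gf_dominant[OF inj img, of \<alpha> 0 N] True N by simp
    also have "\<dots> = (\<Prod>c<n. var (w (?\<tau> c)) ^ \<alpha> (?\<tau> c))"
      by (rule prod.reindex_bij_witness[of _ ?\<tau> ?\<tau>]) (auto simp: \<tau>n)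
    also have "\<dots> = gf n ?\<beta> N 0 (w \<circ> ?\<tau>)"
      using gf_dominant[OF inj_\<tau>[OF inj img] img_\<tau>[OF inj img], of ?\<beta> 0 N] True N\<beta> \<tau>n by simp
    finally show ?thesis .
  next
    case False
    \<comment> \<open>Heights listed by label. If this list is not weakly decreasing, it ascends at
      some adjacent pair of labels.\<close>
    define f where "f v = \<alpha> (inv_into {..<n} w v)" for v
    have f: "f (w c) = \<alpha> c" if "c < n" for c using that inj by (simp add: f_def)
    have "\<exists>a. Suc a < n \<and> f a < f (Suc a)"
    proof (rule ccontr)
      assume "\<not> ?thesis"
      then have step: "f (Suc a) \<le> f a" if "Suc a < n" for a using that by force
      have "f q \<le> f p" if "p \<le> q" "q < n" for p q
        using that
      proof (induction q rule: dec_induct)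
        case (step m)
        then show ?case using \<open>\<And>a. Suc a < n \<Longrightarrow> f (Suc a) \<le> f a\<close>[of m] by simp
      qed simp
      then have "\<alpha> q \<le> \<alpha> p" if "p < n" "q < n" "w p < w q" for p q
        using that f img by (metis imageI less_imp_le lessThan_iff)
      with False show False by blast
    qed
    then obtain a where a: "Suc a < n" "f a < f (Suc a)" by blast
    obtain p where p: "p < n" "w p = a" using img a by (metis Suc_lessD imageE lessThan_iff)
    obtain q where q: "q < n" "w q = Suc a" using img a by (metis imageE lessThan_iff)
    have lt: "\<alpha> p < \<alpha> q" using a f[OF p(1)] f[OF q(1)] p q by simp
    have "p \<noteq> q" using p q by auto
    have pq: "p < q"
      using compat[of q p] lt p q \<open>p \<noteq> q\<close> by (metis Suc_n_not_le_n less_imp_le linorder_neqE_nat)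
    let ?t = "transpose a (Suc a)"
    define w' where "w' = ?t \<circ> w"
    have w'pq: "w' p = Suc a" "w' q = a" using p q by (simp_all add: w'_def)
    have w'other: "w' c = w c" if "c < n" "c \<noteq> p" "c \<noteq> q" for c
      using that wD[of c p] wD[of c q] p q unfolding w'_def by (auto intro!: transpose_apply_other)
    have t_img: "?t ` {..<n} = {..<n}" using a by (intro transpose_image_eq) auto
    have inj': "inj_on w' {..<n}" unfolding w'_def
      by (rule comp_inj_on[OF inj]) (auto intro: inj_on_subset[OF inj_transpose])
    have img': "w' ` {..<n} = {..<n}" unfolding w'_def image_comp[symmetric] img t_img ..
    have ww': "?t (w' c) = w c" for c by (simp add: w'_def)
    \<comment> \<open>Only the pair \<open>p\<close>, \<open>q\<close> changes its order, and
      \<open>compat\<close> does not constrain it because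
      \<open>\<alpha> p < \<alpha> q\<close>.\<close>
    have compat': "w' x < w' y" if xy: "x < y" "y < n" "\<alpha> y \<le> \<alpha> x" for x y
    proof -
      have "w x < w y" using compat xy by blast
      moreover have "\<not> (w x = a \<and> w y = Suc a)" using wD[of x p] wD[of y q] p q lt xy by auto
      ultimately show ?thesis by (auto simp: w'_def transpose_def)
    qed
    \<comment> \<open>The larger label moves to the lower column, which decreases the weighted sum
      by \<open>\<alpha> q - \<alpha> p\<close>; correction terms are added on both sides to avoid
      truncated subtraction.\<close>
    have "\<alpha> c * w' c + (if c = q then \<alpha> q else 0) = \<alpha> c * w c + (if c = p then \<alpha> p else 0)" if "c < n" for c
      using w'other[OF that] w'pq p q \<open>p \<noteq> q\<close> by auto
    then have "(\<Sum>c<n. \<alpha> c * w' c + (if c = q then \<alpha> q else 0)) = (\<Sum>c<n. \<alpha> c * w c + (if c = p then \<alpha> p else 0))"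
      by (intro sum.cong) auto
    then have "(\<Sum>c<n. \<alpha> c * w' c) + \<alpha> q = (\<Sum>c<n. \<alpha> c * w c) + \<alpha> p"
      using p q by (simp add: sum.distrib)
    then have less: "(\<Sum>c<n. \<alpha> c * w' c) < (\<Sum>c<n. \<alpha> c * w c)" using lt by simp
    have cols0: "cols n \<gamma> 0 = {..<n}" for \<gamma> by (auto simp: cols_def)
    have "low1 {..<n} \<alpha> a w'"
      unfolding low1_def using w'pq p q pq lt inj_onD[OF inj'] by (metis lessThan_iff less_imp_le)
    then have 1: "is_\<xi> a (gf n \<alpha> N 0 w') (gf n \<alpha> N 0 w)"
      using gf_exchange[of w' n \<alpha> 0 N a] inj' N by (simp add: cols0 ww')
    \<comment> \<open>Moving the columns reverses only the pair \<open>i\<close>,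
      \<open>i + 1\<close>, whose heights descend, whereas those of \<open>p\<close>,
      \<open>q\<close> ascend.\<close>
    have \<tau>pq: "?\<tau> p < ?\<tau> q"
      using pq lt i by (auto simp: transpose_def)
    have "low1 {..<n} ?\<beta> a (w' \<circ> ?\<tau>)"
      unfolding low1_def
    proof (intro ballI impI)
      fix x assume x: "x \<in> {..<n}" "(w' \<circ> ?\<tau>) x = Suc a"
      then have "?\<tau> x = p" using inj_onD[OF inj', of "?\<tau> x" p] w'pq p \<tau>n by simp
      then have "x = ?\<tau> p" by auto
      then show "\<exists>y\<in>{..<n}. (w' \<circ> ?\<tau>) y = a \<and> x < y \<and> ?\<beta> x \<le> ?\<beta> y"
        using \<tau>pq q \<tau>n lt w'pq by (intro bexI[of _ "?\<tau> q"]) auto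
    qed
    then have 2: "is_\<xi> a (gf n ?\<beta> N 0 (w' \<circ> ?\<tau>)) (gf n ?\<beta> N 0 (w \<circ> ?\<tau>))"
      using gf_exchange[of "w' \<circ> ?\<tau>" n ?\<beta> 0 N a] inj_\<tau>[OF inj' img'] N\<beta>
      by (simp add: cols0 ww' comp_def)
    have "gf n \<alpha> N 0 w' = gf n ?\<beta> N 0 (w' \<circ> ?\<tau>)"
      by (rule less.hyps[OF less inj' img' compat'])
    then show ?thesis using \<xi>_eqI[OF 1] \<xi>_eqI[OF 2] by simp
  qed
qed

text \<open>The sum of the parts serves as a bound on all heights; rows above the top of the diagram
  are empty and contribute the factor 1.\<close>

definition key_gf :: "nat list \<Rightarrow> nat mpoly" where
  "key_gf \<alpha> = gf (length \<alpha>) (nth \<alpha>) (sum_list \<alpha>) 0 (\<lambda>c. c)"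

lemma length_swap_at [simp]: "length (swap_at i \<alpha>) = length \<alpha>"
  by (simp add: swap_at_def)

lemma nth_swap_at:
  "Suc i < length \<alpha> \<Longrightarrow> c < length \<alpha> \<Longrightarrow> swap_at i \<alpha> ! c = \<alpha> ! transpose i (Suc i) c"
  by (auto simp: swap_at_def nth_list_update transpose_def)

lemma swap_at_swap_at: "Suc i < length \<alpha> \<Longrightarrow> swap_at i (swap_at i \<alpha>) = \<alpha>"
  by (rule nth_equalityI) (auto simp: nth_swap_at transpose_def)

lemma mset_swap_at: "Suc i < length \<alpha> \<Longrightarrow> mset (swap_at i \<alpha>) = mset \<alpha>"
  by (simp add: swap_at_def mset_swap)

lemma sum_list_swap_at: "Suc i < length \<alpha> \<Longrightarrow> sum_list (swap_at i \<alpha>) = sum_list \<alpha>"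
  by (metis mset_swap_at sum_mset_sum_list)

lemma nth_le_sum_list: "c < length \<alpha> \<Longrightarrow> \<alpha> ! c \<le> sum_list (\<alpha> :: nat list)"
  by (simp add: elem_le_sum_list)

text \<open>With the two basement labels interchanged, \<open>i\<close> sits on the right in a
  column at least as high, so restoring the increasing order is an exchange of type
  \<open>low1\<close>.\<close>

lemma key_gf_exchange_base:
  assumes i: "Suc i < length \<alpha>" "\<alpha> ! i \<le> \<alpha> ! Suc i"
  shows "is_\<xi> i (gf (length \<alpha>) (nth \<alpha>) (sum_list \<alpha>) 0 (transpose i (Suc i))) (key_gf \<alpha>)"
proof -
  let ?n = "length \<alpha>"
  have cols0: "cols ?n (nth \<alpha>) 0 = {..<?n}" by (auto simp: cols_def)
  have "low1 {..<?n} (nth \<alpha>) i (transpose i (Suc i))"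
    using i by (auto simp: low1_def transpose_def intro!: bexI[of _ "Suc i"])
  then show ?thesis
    using gf_exchange[of "transpose i (Suc i)" ?n "nth \<alpha>" 0 "sum_list \<alpha>" i] nth_le_sum_list
    by (simp add: cols0 key_gf_def inj_on_subset[OF inj_transpose])
qed

lemma key_gf_symmetric:
  "Suc i < length \<alpha> \<Longrightarrow> \<alpha> ! i \<le> \<alpha> ! Suc i \<Longrightarrow> exchange i (key_gf \<alpha>) = key_gf \<alpha>"
  using is_\<xi>_exchange[OF key_gf_exchange_base] by blast

lemma key_gf_is_key_family: "is_key_family key_gf"
  unfolding is_key_family_def
proof (intro conjI allI impI)
  fix \<alpha> :: "nat list" assume s: "sorted_wrt (\<ge>) \<alpha>"
  have "\<alpha> ! q \<le> \<alpha> ! p" if "q < length \<alpha>" "p < q" for p q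
    using sorted_wrt_nth_less[OF s, of p q] that by simp
  then show "key_gf \<alpha> = monom_of \<alpha>"
    using gf_dominant[of "\<lambda>c. c" "length \<alpha>" "nth \<alpha>" 0 "sum_list \<alpha>"] nth_le_sum_list
    by (simp add: key_gf_def monom_of_def)
next
  fix \<alpha> :: "nat list" and i assume "Suc i < length \<alpha> \<and> \<alpha> ! Suc i < \<alpha> ! i"
  then have i: "Suc i < length \<alpha>" "\<alpha> ! Suc i < \<alpha> ! i" by auto
  let ?\<beta> = "swap_at i \<alpha>" and ?n = "length \<alpha>" and ?N = "sum_list \<alpha>" and ?\<tau> = "transpose i (Suc i)"
  \<comment> \<open>Carrying the labels along replaces the increasing basement over
    \<open>\<alpha>\<close> by the interchanged one over \<open>?\<beta>\<close>; restoring the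
    increasing order there applies the operator.\<close>
  have "key_gf \<alpha> = gf ?n (nth \<alpha> \<circ> ?\<tau>) ?N 0 ((\<lambda>c. c) \<circ> ?\<tau>)"
    unfolding key_gf_def using i nth_le_sum_list by (intro gf_swap_columns) auto
  also have "\<dots> = gf ?n (nth ?\<beta>) ?N 0 ?\<tau>"
    using i nth_swap_at by (simp add: comp_def) (rule gf_heights_cong, simp add: nth_swap_at)
  finally have "key_gf \<alpha> = gf (length ?\<beta>) (nth ?\<beta>) (sum_list ?\<beta>) 0 ?\<tau>"
    using i by (simp add: sum_list_swap_at)
  moreover have "is_\<xi> i (gf (length ?\<beta>) (nth ?\<beta>) (sum_list ?\<beta>) 0 ?\<tau>) (key_gf ?\<beta>)"
    using i by (intro key_gf_exchange_base) (simp_all add: nth_swap_at)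
  ultimately show "key_gf (swap_at i \<alpha>) = \<xi> i (key_gf \<alpha>)"
    using \<xi>_eqI by metis
qed

text \<open>At an ascent of \<open>\<alpha>\<close> the recursion expresses
  \<open>K \<alpha>\<close> through an index with a smaller position-weighted sum, and an index
  without ascents is weakly decreasing. Together with existence this justifies the definite
  description in \<open>key_poly\<close>.\<close>

lemma is_key_family_unique:
  assumes K: "is_key_family K" and K': "is_key_family K'"
  shows "K \<alpha> = K' \<alpha>"
proof (induction "\<Sum>c<length \<alpha>. c * \<alpha> ! c" arbitrary: \<alpha> rule: less_induct)
  case less
  show ?case
  proof (cases "sorted_wrt (\<ge>) \<alpha>")
    case True
    then show ?thesis using K K' by (simp add: is_key_family_def)
  next
    case False
    then obtain i where i: "Suc i < length \<alpha>" "\<alpha> ! i < \<alpha> ! Suc i"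
      by (subst (asm) sorted_wrt_iff_nth_Suc_transp) (auto simp: transp_def not_le)
    let ?\<beta> = "swap_at i \<alpha>" and ?n = "length \<alpha>"
    have eq: "transpose i (Suc i) c * \<alpha> ! c + (if c = Suc i then \<alpha> ! Suc i else 0) = c * \<alpha> ! c + (if c = i then \<alpha> ! i else 0)" for c
      by (auto simp: transpose_def)
    have "(\<Sum>c<?n. c * ?\<beta> ! c) = (\<Sum>c<?n. transpose i (Suc i) c * \<alpha> ! c)"
      by (rule sum.reindex_bij_witness[of _ "transpose i (Suc i)" "transpose i (Suc i)"])
         (use i in \<open>auto simp: nth_swap_at transpose_def\<close>)
    moreover have "(\<Sum>c<?n. transpose i (Suc i) c * \<alpha> ! c) + \<alpha> ! Suc i = (\<Sum>c<?n. c * \<alpha> ! c) + \<alpha> ! i"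
    proof -
      have "(\<Sum>c<?n. transpose i (Suc i) c * \<alpha> ! c + (if c = Suc i then \<alpha> ! Suc i else 0))
          = (\<Sum>c<?n. c * \<alpha> ! c + (if c = i then \<alpha> ! i else 0))"
        by (simp only: eq)
      then show ?thesis using i by (simp add: sum.distrib)
    qed
    ultimately have "(\<Sum>c<length ?\<beta>. c * ?\<beta> ! c) < (\<Sum>c<?n. c * \<alpha> ! c)" using i by simp
    then have "K ?\<beta> = K' ?\<beta>" by (rule less)
    moreover have "L \<alpha> = \<xi> i (L ?\<beta>)" if "is_key_family L" for L
      using that i unfolding is_key_family_def
      by (metis (no_types, lifting) swap_at_swap_at length_swap_at nth_swap_at Suc_lessD transpose_apply_first transpose_apply_second)
    ultimately show ?thesis using K K' by metis
  qed
qed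

theorem key_poly_eq: "key_poly = key_gf"
  unfolding key_poly_def
  by (rule the_equality) (use key_gf_is_key_family is_key_family_unique in \<open>auto simp: fun_eq_iff\<close>)

section \<open>Fillings\<close>

definition boxes :: "nat \<Rightarrow> (nat \<Rightarrow> nat) \<Rightarrow> nat \<Rightarrow> box set" where
  "boxes n \<alpha> j = {(c, k). c < n \<and> j < k \<and> k \<le> \<alpha> c}"

lemma finite_boxes [simp]: "finite (boxes n \<alpha> j)"
proof (rule finite_subset)
  show "boxes n \<alpha> j \<subseteq> Sigma {..<n} (\<lambda>c. {..\<alpha> c})" by (auto simp: boxes_def)
qed simp

lemma boxes_Suc: "boxes n \<alpha> j = (\<lambda>c. (c, Suc j)) ` cols n \<alpha> (Suc j) \<union> boxes n \<alpha> (Suc j)"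
  by (auto simp: boxes_def cols_def)

definition row_of :: "nat \<Rightarrow> (nat \<Rightarrow> 'a) \<Rightarrow> (box \<Rightarrow> 'a) \<Rightarrow> nat \<Rightarrow> nat \<Rightarrow> 'a" where
  "row_of j w \<sigma> k = (if k = j then w else (\<lambda>c. \<sigma> (c, k)))"

text \<open>The label type stays open: numbers serve the key polynomials, \<open>label\<close> the
  fillings of the theorem. Above the top of the diagram the row conditions hold vacuously.\<close>

definition fillset :: "nat \<Rightarrow> (nat \<Rightarrow> nat) \<Rightarrow> nat \<Rightarrow> (nat \<Rightarrow> 'a::linorder) \<Rightarrow> (box \<Rightarrow> 'a) set" where
  "fillset n \<alpha> j w = {\<sigma> \<in> boxes n \<alpha> j \<rightarrow>\<^sub>E UNIV. \<forall>k\<ge>j.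
     inj_on (row_of j w \<sigma> (Suc k)) (cols n \<alpha> (Suc k)) \<and>
     row_ok (cols n \<alpha> k) (cols n \<alpha> (Suc k)) \<alpha> (row_of j w \<sigma> k) (row_of j w \<sigma> (Suc k))}"

definition content :: "'b set \<Rightarrow> ('b \<Rightarrow> 'v) \<Rightarrow> 'v monomial" where
  "content B \<sigma> = (\<Sum>b\<in>B. Poly_Mapping.single (\<sigma> b) 1)"

lemma content_cong: "(\<And>b. b \<in> B \<Longrightarrow> \<sigma> b = \<sigma>' b) \<Longrightarrow> content B \<sigma> = content B \<sigma>'"
  by (simp add: content_def)

lemma lookup_content:
  "finite B \<Longrightarrow> Poly_Mapping.lookup (content B \<sigma>) v = card {b \<in> B. \<sigma> b = v}"
  by (simp add: content_def lookup_sum lookup_single when_def sum.If_cases Int_def)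

lemma keys_content: "finite B \<Longrightarrow> Poly_Mapping.keys (content B \<sigma>) = \<sigma> ` B"
  by (auto simp: in_keys_iff lookup_content)

lemma row_ok_cong:
  assumes "\<And>c. c \<in> D \<Longrightarrow> w c = w' c" "\<And>c. c \<in> E \<Longrightarrow> u c = u' c" "E \<subseteq> D"
  shows "row_ok D E \<alpha> w u \<longleftrightarrow> row_ok D E \<alpha> w' u'"
  using assms subsetD[OF assms(3)] by (simp add: row_ok_def)

lemma fillset_le:
  assumes "\<sigma> \<in> fillset n \<alpha> j (w :: nat \<Rightarrow> nat)" "j \<le> k" "c < n" "k \<le> \<alpha> c"
  shows "row_of j w \<sigma> k c \<le> w c"
  using assms(2,4)
proof (induction k rule: dec_induct)
  case base
  then show ?case by (simp add: row_of_def)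
next
  case (step k)
  have "row_of j w \<sigma> (Suc k) c \<le> row_of j w \<sigma> k c"
    using assms(1) step assms(3) by (auto simp: fillset_def row_ok_def cols_def)
  then show ?case using step by simp
qed

lemma finite_fillset: "finite (fillset n \<alpha> j (w :: nat \<Rightarrow> nat))"
proof (rule finite_subset)
  show "fillset n \<alpha> j w \<subseteq> (\<Pi>\<^sub>E b\<in>boxes n \<alpha> j. {..w (fst b)})"
  proof
    fix \<sigma> assume s: "\<sigma> \<in> fillset n \<alpha> j w"
    have "\<sigma> (c, k) \<le> w c" if "(c, k) \<in> boxes n \<alpha> j" for c k
      using fillset_le[OF s, of k c] that by (auto simp: boxes_def row_of_def split: if_splits)
    then show "\<sigma> \<in> (\<Pi>\<^sub>E b\<in>boxes n \<alpha> j. {..w (fst b)})"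
      using s by (auto simp: fillset_def PiE_iff)
  qed
qed (simp add: finite_PiE)

definition stack_row :: "nat \<Rightarrow> (nat \<Rightarrow> nat) \<Rightarrow> nat \<Rightarrow> (nat \<Rightarrow> nat) \<Rightarrow> (box \<Rightarrow> nat) \<Rightarrow> box \<Rightarrow> nat" where
  "stack_row n \<alpha> j u \<sigma> = restrict (\<lambda>(c, k). if k = Suc j then u c else \<sigma> (c, k)) (boxes n \<alpha> j)"

lemma fillset_stack_row:
  assumes u: "u \<in> rows n \<alpha> j w" and s: "\<sigma> \<in> fillset n \<alpha> (Suc j) u"
  shows "stack_row n \<alpha> j u \<sigma> \<in> fillset n \<alpha> j w"
  unfolding fillset_def
proof (intro CollectI conjI allI impI)
  let ?s = "stack_row n \<alpha> j u \<sigma>"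
  show "?s \<in> boxes n \<alpha> j \<rightarrow>\<^sub>E UNIV" by (simp add: stack_row_def)
  fix k assume k: "j \<le> k"
  have row: "row_of j w ?s m c = row_of (Suc j) u \<sigma> m c" if "j < m" "c \<in> cols n \<alpha> m" for m c
    using that by (auto simp: row_of_def stack_row_def boxes_def cols_def)
  have sub: "cols n \<alpha> (Suc k) \<subseteq> cols n \<alpha> k" by (auto simp: cols_def)
  show "inj_on (row_of j w ?s (Suc k)) (cols n \<alpha> (Suc k))"
  proof (cases "k = j")
    case True
    have "inj_on u (cols n \<alpha> (Suc j))" using u by (simp add: rows_def)
    then show ?thesis using row[of "Suc j"] True by (simp add: inj_on_def row_of_def)
  next
    case False
    then have "inj_on (row_of (Suc j) u \<sigma> (Suc k)) (cols n \<alpha> (Suc k))"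
      using s k by (simp add: fillset_def)
    then show ?thesis using row[of "Suc k"] k by (simp add: inj_on_def)
  qed
  show "row_ok (cols n \<alpha> k) (cols n \<alpha> (Suc k)) \<alpha> (row_of j w ?s k) (row_of j w ?s (Suc k))"
  proof (cases "k = j")
    case True
    have "row_ok (cols n \<alpha> j) (cols n \<alpha> (Suc j)) \<alpha> w u" using u by (simp add: rows_def)
    then show ?thesis
      using row_ok_cong[OF _ _ sub, of "row_of j w ?s k" w "row_of j w ?s (Suc k)" u \<alpha>] row[of "Suc j"] True
      by (simp add: row_of_def)
  next
    case False
    then have "row_ok (cols n \<alpha> k) (cols n \<alpha> (Suc k)) \<alpha> (row_of (Suc j) u \<sigma> k) (row_of (Suc j) u \<sigma> (Suc k))"
      using s k by (simp add: fillset_def)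
    then show ?thesis
      using row_ok_cong[of "cols n \<alpha> k" "row_of j w ?s k" "row_of (Suc j) u \<sigma> k" "cols n \<alpha> (Suc k)"
          "row_of j w ?s (Suc k)" "row_of (Suc j) u \<sigma> (Suc k)" \<alpha>] row sub k False by simp
  qed
qed

lemma fillset_first_row:
  assumes s: "\<sigma> \<in> fillset n \<alpha> j w"
  defines "u \<equiv> restrict (\<lambda>c. \<sigma> (c, Suc j)) (cols n \<alpha> (Suc j))"
  shows "u \<in> rows n \<alpha> j w" "restrict \<sigma> (boxes n \<alpha> (Suc j)) \<in> fillset n \<alpha> (Suc j) u"
proof -
  let ?s = "restrict \<sigma> (boxes n \<alpha> (Suc j))"
  have row: "row_of (Suc j) u ?s m c = row_of j w \<sigma> m c" if "j < m" "c \<in> cols n \<alpha> m" for m c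
    using that by (auto simp: row_of_def u_def boxes_def cols_def)
  have sub: "cols n \<alpha> (Suc k) \<subseteq> cols n \<alpha> k" for k by (auto simp: cols_def)
  have inj: "inj_on (row_of j w \<sigma> (Suc k)) (cols n \<alpha> (Suc k))"
    and ok: "row_ok (cols n \<alpha> k) (cols n \<alpha> (Suc k)) \<alpha> (row_of j w \<sigma> k) (row_of j w \<sigma> (Suc k))"
    if "j \<le> k" for k using s that by (simp_all add: fillset_def)
  show "u \<in> rows n \<alpha> j w"
    using inj[of j] ok[of j] row_ok_cong[OF _ _ sub, of j w w u "row_of j w \<sigma> (Suc j)" \<alpha>]
    by (auto simp: rows_def u_def row_of_def inj_on_def)
  show "?s \<in> fillset n \<alpha> (Suc j) u"
    unfolding fillset_def
  proof (intro CollectI conjI allI impI)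
    show "?s \<in> boxes n \<alpha> (Suc j) \<rightarrow>\<^sub>E UNIV" by simp
    fix k assume k: "Suc j \<le> k"
    show "inj_on (row_of (Suc j) u ?s (Suc k)) (cols n \<alpha> (Suc k))"
      using inj[of k] row[of "Suc k"] k by (simp add: inj_on_def)
    show "row_ok (cols n \<alpha> k) (cols n \<alpha> (Suc k)) \<alpha> (row_of (Suc j) u ?s k) (row_of (Suc j) u ?s (Suc k))"
      using row_ok_cong[of "cols n \<alpha> k" "row_of (Suc j) u ?s k" "row_of j w \<sigma> k" "cols n \<alpha> (Suc k)"
          "row_of (Suc j) u ?s (Suc k)" "row_of j w \<sigma> (Suc k)" \<alpha>] row sub[of k] ok[of k] k by simp
  qed
qed

text \<open>Splitting off the first row is a bijection from fillings to pairs of an admissible row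
  and a filling above it, which is the recursion of \<open>gf\<close>.\<close>

lemma gf_eq_sum_fillset:
  assumes "\<forall>c<n. \<alpha> c \<le> j + N"
  shows "gf n \<alpha> N j w = (\<Sum>\<sigma>\<in>fillset n \<alpha> j w. Poly_Mapping.single (content (boxes n \<alpha> j) \<sigma>) 1)"
  using assms
proof (induction N arbitrary: j w)
  case 0
  then have e: "boxes n \<alpha> j = {}" "\<And>k. k \<ge> j \<Longrightarrow> cols n \<alpha> (Suc k) = {}"
    by (force simp: boxes_def cols_def)+
  then have "fillset n \<alpha> j w = {\<lambda>x. undefined}"
    by (auto simp: fillset_def row_ok_def)
  then show ?case using e by (simp add: content_def)
next
  case (Suc N)
  let ?E = "cols n \<alpha> (Suc j)"
  have weight: "row_weight ?E u * Poly_Mapping.single (content (boxes n \<alpha> (Suc j)) \<sigma>) 1 =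
      Poly_Mapping.single (content (boxes n \<alpha> j) (stack_row n \<alpha> j u \<sigma>)) 1" for u \<sigma>
  proof -
    have "content (boxes n \<alpha> j) (stack_row n \<alpha> j u \<sigma>) =
        content (boxes n \<alpha> j) (\<lambda>(c, k). if k = Suc j then u c else \<sigma> (c, k))"
      by (rule content_cong) (simp add: stack_row_def)
    also have "\<dots> = (\<Sum>c\<in>?E. Poly_Mapping.single (u c) 1) + content (boxes n \<alpha> (Suc j)) \<sigma>"
      unfolding content_def
    proof (subst boxes_Suc, subst sum.union_disjoint)
      show "(\<lambda>c. (c, Suc j)) ` ?E \<inter> boxes n \<alpha> (Suc j) = {}" by (auto simp: boxes_def)
    qed (auto simp: sum.reindex inj_on_def intro!: arg_cong2[where f = "(+)"] sum.cong, simp add: boxes_def)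
    finally show ?thesis
      by (simp add: row_weight_def var_def prod_single mult_single)
  qed
  have "gf n \<alpha> (Suc N) j w = (\<Sum>u\<in>rows n \<alpha> j w. \<Sum>\<sigma>\<in>fillset n \<alpha> (Suc j) u.
      Poly_Mapping.single (content (boxes n \<alpha> j) (stack_row n \<alpha> j u \<sigma>)) 1)"
    using Suc by (simp add: sum_distrib_left weight)
  also have "\<dots> = (\<Sum>(u, \<sigma>)\<in>Sigma (rows n \<alpha> j w) (fillset n \<alpha> (Suc j)).
      Poly_Mapping.single (content (boxes n \<alpha> j) (stack_row n \<alpha> j u \<sigma>)) 1)"
    by (rule sum.Sigma) (simp_all add: finite_rows finite_fillset)
  also have "\<dots> = (\<Sum>\<sigma>\<in>fillset n \<alpha> j w. Poly_Mapping.single (content (boxes n \<alpha> j) \<sigma>) 1)"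
  proof (rule sum.reindex_bij_witness[of _
        "\<lambda>\<sigma>. (restrict (\<lambda>c. \<sigma> (c, Suc j)) ?E, restrict \<sigma> (boxes n \<alpha> (Suc j)))"
        "\<lambda>(u, \<sigma>). stack_row n \<alpha> j u \<sigma>"], goal_cases)
    case (1 x)
    then obtain u \<sigma> where x: "x = (u, \<sigma>)" "u \<in> rows n \<alpha> j w" "\<sigma> \<in> fillset n \<alpha> (Suc j) u" by auto
    have "restrict (\<lambda>c. stack_row n \<alpha> j u \<sigma> (c, Suc j)) ?E = u"
      using x(2) by (auto simp: rows_def PiE_iff extensional_def stack_row_def boxes_def cols_def fun_eq_iff)
    moreover have "restrict (stack_row n \<alpha> j u \<sigma>) (boxes n \<alpha> (Suc j)) = \<sigma>"
      using x(3) by (auto simp: fillset_def PiE_iff extensional_def stack_row_def boxes_def fun_eq_iff)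
    ultimately show ?case using x by simp
  next
    case (2 x)
    then show ?case by (auto intro: fillset_stack_row)
  next
    case (3 \<sigma>)
    then show ?case
      by (auto simp: fillset_def PiE_iff extensional_def stack_row_def boxes_def cols_def fun_eq_iff)
  next
    case (4 \<sigma>)
    then show ?case using fillset_first_row by auto
  next
    case (5 x)
    then show ?case by auto
  qed
  finally show ?case .
qed

lemma dg'_eq_boxes: "dg' \<mu> = boxes (length \<mu>) (nth \<mu>) 0"
  by (auto simp: dg'_def boxes_def)

lemma dg_hat_iff: "(c, k) \<in> dg_hat \<mu> \<longleftrightarrow> c \<in> cols (length \<mu>) (nth \<mu>) k"
  by (cases k) (auto simp: dg_hat_def dg'_def cols_def)

text \<open>Under weak decrease upwards only the cyclic order
  \<open>\<tau> u < \<tau> v < \<tau> w\<close> is possible in a triple, and non-attacking excludes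
  the cases of equality. Conversely the interval conditions rule out equal labels on attacking boxes
  of consecutive rows, while row 0 is covered by \<open>base\<close>.\<close>

lemma tableau_conditions_iff:
  fixes \<tau> :: "box \<Rightarrow> label"
  assumes base: "inj_on (\<lambda>c. \<tau> (c, 0)) {..<length \<mu>}"
  defines "C \<equiv> cols (length \<mu>) (nth \<mu>)"
  shows "non_attacking \<mu> \<tau> \<and> weakly_decreasing_upwards \<mu> \<tau> \<and> (\<nexists>u v w. coinversion_triple \<mu> \<tau> u v w) \<longleftrightarrow>
    (\<forall>k. inj_on (\<lambda>c. \<tau> (c, Suc k)) (C (Suc k)) \<and>
       row_ok (C k) (C (Suc k)) (nth \<mu>) (\<lambda>c. \<tau> (c, k)) (\<lambda>c. \<tau> (c, Suc k)))"
    (is "?L \<longleftrightarrow> ?R")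
proof
  assume L: ?L
  have hat: "(c, k) \<in> dg_hat \<mu> \<longleftrightarrow> c \<in> C k" for c k by (simp add: dg_hat_iff C_def)
  have na: "\<tau> u \<noteq> \<tau> v" if "u \<in> dg_hat \<mu>" "v \<in> dg_hat \<mu>" "attack u v" for u v
    using L that by (auto simp: non_attacking_def)
  have sub: "c \<in> C k" if "c \<in> C (Suc k)" for c k using that by (auto simp: C_def cols_def)
  show ?R
  proof (intro allI conjI)
    fix k
    show "inj_on (\<lambda>c. \<tau> (c, Suc k)) (C (Suc k))"
    proof (rule inj_onI, rule ccontr)
      fix c d assume "c \<in> C (Suc k)" "d \<in> C (Suc k)" "\<tau> (c, Suc k) = \<tau> (d, Suc k)" "c \<noteq> d"
      then show False using na[of "(c, Suc k)" "(d, Suc k)"] by (auto simp: hat attack_def)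
    qed
    show "row_ok (C k) (C (Suc k)) (nth \<mu>) (\<lambda>c. \<tau> (c, k)) (\<lambda>c. \<tau> (c, Suc k))"
    proof (rule row_okI)
      fix c assume "c \<in> C (Suc k)"
      then show "\<tau> (c, Suc k) \<le> \<tau> (c, k)"
        using L by (fastforce simp: weakly_decreasing_upwards_def dg'_def C_def cols_def)
    next
      fix c d assume cd: "c \<in> C (Suc k)" "d \<in> C k" "c < d" "\<mu> ! d < \<mu> ! c"
        and le: "\<tau> (c, Suc k) \<le> \<tau> (d, k)" "\<tau> (d, k) \<le> \<tau> (c, k)"
      have "\<tau> (c, Suc k) \<noteq> \<tau> (d, k)"
        using na[of "(c, Suc k)" "(d, k)"] cd by (auto simp: hat attack_def)
      moreover have "\<tau> (d, k) \<noteq> \<tau> (c, k)"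
        using na[of "(d, k)" "(c, k)"] cd sub by (auto simp: hat attack_def)
      ultimately have "coinversion_triple \<mu> \<tau> (c, Suc k) (d, k) (c, k)"
        using cd le sub unfolding coinversion_triple_def hat by auto
      then show False using L by blast
    next
      fix c d assume cd: "c \<in> C (Suc k)" "d \<in> C (Suc k)" "c < d" "\<mu> ! c \<le> \<mu> ! d"
        and le: "\<tau> (d, Suc k) \<le> \<tau> (c, Suc k)" "\<tau> (c, Suc k) \<le> \<tau> (d, k)"
      have "\<tau> (d, Suc k) \<noteq> \<tau> (c, Suc k)"
        using na[of "(d, Suc k)" "(c, Suc k)"] cd by (auto simp: hat attack_def)
      moreover have "\<tau> (c, Suc k) \<noteq> \<tau> (d, k)"
        using na[of "(c, Suc k)" "(d, k)"] cd sub by (auto simp: hat attack_def)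
      ultimately have "coinversion_triple \<mu> \<tau> (d, Suc k) (c, Suc k) (d, k)"
        using cd le sub unfolding coinversion_triple_def hat by auto
      then show False using L by blast
    qed
  qed
next
  assume R: ?R
  have hat: "(c, k) \<in> dg_hat \<mu> \<longleftrightarrow> c \<in> C k" for c k by (simp add: dg_hat_iff C_def)
  have sub: "c \<in> C k" if "c \<in> C (Suc k)" for c k using that by (auto simp: C_def cols_def)
  have up: "d \<in> C (Suc k)" if "c \<in> C (Suc k)" "d \<in> C k" "\<mu> ! c \<le> \<mu> ! d" for c d k
    using that by (auto simp: C_def cols_def)
  have le: "\<tau> (c, Suc k) \<le> \<tau> (c, k)" if "c \<in> C (Suc k)" for c k
    using R that by (auto simp: row_ok_def)
  have right: "\<not> (\<tau> (c, Suc k) \<le> \<tau> (d, k) \<and> \<tau> (d, k) \<le> \<tau> (c, k))"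
    if "c \<in> C (Suc k)" "d \<in> C k" "c < d" "\<mu> ! d < \<mu> ! c" for c d k
    using R that by (simp add: row_ok_def)
  have left: "\<not> (\<tau> (d, Suc k) \<le> \<tau> (c, Suc k) \<and> \<tau> (c, Suc k) \<le> \<tau> (d, k))"
    if "c \<in> C (Suc k)" "d \<in> C (Suc k)" "c < d" "\<mu> ! c \<le> \<mu> ! d" for c d k
    using R that by (simp add: row_ok_def)
  have same: "c = d" if "\<tau> (c, k) = \<tau> (d, k)" "c \<in> C k" "d \<in> C k" for c d k
  proof (cases k)
    case 0
    then show ?thesis using base that by (auto simp: inj_on_def C_def cols_def)
  next
    case (Suc m)
    then have "inj_on (\<lambda>c. \<tau> (c, k)) (C k)" using R by simp
    then show ?thesis using that by (auto dest: inj_onD)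
  qed
  \<comment> \<open>Equality would place the common label at an end of the interval of the dominant
    column; if that column is \<open>d\<close>, it also reaches the upper row.\<close>
  have diag: "\<tau> (c, Suc k) \<noteq> \<tau> (d, k)" if "c \<in> C (Suc k)" "d \<in> C k" "c < d" for c d k
  proof (cases "\<mu> ! d < \<mu> ! c")
    case True
    then show ?thesis using right[OF that] le[of c k] that by auto
  next
    case False
    then have "d \<in> C (Suc k)" using up that by simp
    then show ?thesis using left[of c k d] le[of d k] that False by auto
  qed
  show ?L
  proof (intro conjI)
    show "non_attacking \<mu> \<tau>"
      unfolding non_attacking_def
    proof (intro ballI impI)
      fix u v assume uv: "u \<in> dg_hat \<mu>" "v \<in> dg_hat \<mu>" "attack u v"
      obtain c k d l where [simp]: "u = (c, k)" "v = (d, l)" by (cases u, cases v)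
      have cd: "c \<in> C k" "d \<in> C l" using uv by (simp_all add: hat)
      have "k = l \<and> c \<noteq> d \<or> k = Suc l \<and> c < d \<or> l = Suc k \<and> d < c"
        using uv(3) by (auto simp: attack_def)
      then show "\<tau> u \<noteq> \<tau> v"
        using cd same[of c k d] diag[of c l d] diag[of d k c] by auto
    qed
    show "weakly_decreasing_upwards \<mu> \<tau>"
      unfolding weakly_decreasing_upwards_def
    proof (intro ballI, clarify)
      fix c k assume "(c, k) \<in> dg' \<mu>"
      then show "\<tau> (c, k) \<le> \<tau> (c, k - 1)" using le[of c "k - 1"] by (auto simp: dg'_def C_def cols_def)
    qed
    show "\<nexists>u v w. coinversion_triple \<mu> \<tau> u v w"
    proof (intro notI, elim exE)
      fix u v w assume co: "coinversion_triple \<mu> \<tau> u v w"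
      then obtain c j d where 1: "1 \<le> j" "u = (c, j)" "w = (c, j - 1)"
         "v = (d, j - 1) \<and> c < d \<and> \<mu> ! d < \<mu> ! c \<or> v = (d, j) \<and> d < c \<and> \<mu> ! d \<le> \<mu> ! c"
        and cyc: "\<tau> u < \<tau> v \<and> \<tau> v < \<tau> w \<or> \<tau> v < \<tau> w \<and> \<tau> w < \<tau> u \<or> \<tau> w < \<tau> u \<and> \<tau> u < \<tau> v"
        and hats: "u \<in> dg_hat \<mu>" "v \<in> dg_hat \<mu>"
        unfolding coinversion_triple_def by blast
      obtain k where j: "j = Suc k" using 1(1) by (cases j) auto
      have "\<tau> u \<le> \<tau> w" using le[of c k] hats 1 j by (simp add: hat)
      then have lt: "\<tau> u < \<tau> v" "\<tau> v < \<tau> w" using cyc by auto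
      from 1(4) show False
        using right[of c k d] left[of d k c] lt hats 1(2,3) j by (auto simp: hat)
    qed
  qed
qed

section \<open>Removing the empty columns\<close>

lemma strict_mono_on_le_iff:
  fixes f :: "'a::linorder \<Rightarrow> 'b::linorder"
  shows "strict_mono_on A f \<Longrightarrow> x \<in> A \<Longrightarrow> y \<in> A \<Longrightarrow> f x \<le> f y \<longleftrightarrow> x \<le> y"
  by (metis strict_mono_onD linorder_not_less order_le_less)

text \<open>A deleted column of the lower row matters only to dominant columns on its left. By
  \<open>extra\<close> its label exceeds the label below each of them and thus lies outside their
  intervals.\<close>

lemma row_ok_transport:
  fixes \<psi> :: "nat \<Rightarrow> nat" and \<Lambda> :: "'a::linorder \<Rightarrow> 'b::linorder"
  assumes \<psi>: "strict_mono_on D \<psi>" and D: "\<psi> ` D \<subseteq> D'" and E: "E' = \<psi> ` E" "E \<subseteq> D"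
    and \<Lambda>: "strict_mono_on V \<Lambda>"
    and w: "\<And>c. c \<in> D \<Longrightarrow> w' (\<psi> c) \<in> V \<and> w c = \<Lambda> (w' (\<psi> c))"
    and u: "\<And>c. c \<in> E \<Longrightarrow> u' (\<psi> c) \<in> V \<and> u c = \<Lambda> (u' (\<psi> c))"
    and \<beta>: "\<And>c. c \<in> D \<Longrightarrow> \<beta> c = \<alpha> (\<psi> c)"
    and extra: "\<And>c d. c \<in> E' \<Longrightarrow> d \<in> D' \<Longrightarrow> d \<notin> \<psi> ` D \<Longrightarrow> c < d \<Longrightarrow> w' c < w' d"
  shows "row_ok D' E' \<alpha> w' u' \<longleftrightarrow> row_ok D E \<beta> w u"
proof -
  have \<psi>_less: "\<psi> c < \<psi> d \<longleftrightarrow> c < d" if "c \<in> D" "d \<in> D" for c d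
    using \<psi> that by (simp add: strict_mono_on_less)
  have inD: "c \<in> D" if "c \<in> E" for c using that E by auto
  have le: "\<Lambda> x \<le> \<Lambda> y \<longleftrightarrow> x \<le> y" if "x \<in> V" "y \<in> V" for x y
    using strict_mono_on_le_iff[OF \<Lambda>] that by blast
  show ?thesis
  proof
    assume a: "row_ok D' E' \<alpha> w' u'"
    show "row_ok D E \<beta> w u"
    proof (rule row_okI)
      fix c assume c: "c \<in> E"
      then have "u' (\<psi> c) \<le> w' (\<psi> c)" using row_ok_le[OF a] E by auto
      then show "u c \<le> w c" using c w[OF inD[OF c]] u le by simp
    next
      fix c d assume cd: "c \<in> E" "d \<in> D" "c < d" "\<beta> d < \<beta> c" "u c \<le> w d" "w d \<le> w c"
      then have "u' (\<psi> c) \<le> w' (\<psi> d)" "w' (\<psi> d) \<le> w' (\<psi> c)"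
        using w[OF inD[OF cd(1)]] w[of d] u[of c] le by auto
      then show False using row_ok_right[OF a, of "\<psi> c" "\<psi> d"] cd \<psi>_less inD \<beta> E(1) D by auto
    next
      fix c d assume cd: "c \<in> E" "d \<in> E" "c < d" "\<beta> c \<le> \<beta> d" "u d \<le> u c" "u c \<le> w d"
      then have "u' (\<psi> d) \<le> u' (\<psi> c)" "u' (\<psi> c) \<le> w' (\<psi> d)"
        using w[OF inD[OF cd(2)]] u[of c] u[of d] le by auto
      then show False using row_ok_left[OF a, of "\<psi> c" "\<psi> d"] cd \<psi>_less inD \<beta> E(1) by auto
    qed
  next
    assume a: "row_ok D E \<beta> w u"
    show "row_ok D' E' \<alpha> w' u'"
    proof (rule row_okI)
      fix c' assume "c' \<in> E'"
      then obtain c where c: "c \<in> E" "c' = \<psi> c" using E by auto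
      then show "u' c' \<le> w' c'" using row_ok_le[OF a c(1)] w[OF inD[OF c(1)]] u le by simp
    next
      fix c' d' assume cd': "c' \<in> E'" "d' \<in> D'" "c' < d'" "\<alpha> d' < \<alpha> c'" "u' c' \<le> w' d'" "w' d' \<le> w' c'"
      then have "d' \<in> \<psi> ` D" using extra by force
      then obtain c d where cd: "c \<in> E" "d \<in> D" "c' = \<psi> c" "d' = \<psi> d" using E cd' by auto
      have "u c \<le> w d" "w d \<le> w c" using cd' cd w[OF inD[OF cd(1)]] w[of d] u[of c] le by auto
      then show False using row_ok_right[OF a, of c d] cd cd' \<psi>_less inD \<beta> by auto
    next
      fix c' d' assume cd': "c' \<in> E'" "d' \<in> E'" "c' < d'" "\<alpha> c' \<le> \<alpha> d'" "u' d' \<le> u' c'" "u' c' \<le> w' d'"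
      then obtain c d where cd: "c \<in> E" "d \<in> E" "c' = \<psi> c" "d' = \<psi> d" using E by auto
      have "u d \<le> u c" "u c \<le> w d" using cd' cd w[OF inD[OF cd(2)]] u[of c] u[of d] le by auto
      then show False using row_ok_left[OF a, of c d] cd cd' \<psi>_less inD \<beta> by auto
    qed
  qed
qed

text \<open>Empty columns only carry a basement label; in an increasing basement they impose no
  condition on the columns to their left.\<close>

lemma fillset_transport:
  fixes \<psi> :: "nat \<Rightarrow> nat" and \<Lambda> :: "nat \<Rightarrow> 'b::linorder"
  assumes \<psi>: "strict_mono_on {..<m} \<psi>" "\<psi> ` {..<m} \<subseteq> {..<n}"
    and \<beta>: "\<And>c. c < m \<Longrightarrow> \<beta> c = \<alpha> (\<psi> c)"
    and empty: "\<And>p. p < n \<Longrightarrow> p \<notin> \<psi> ` {..<m} \<Longrightarrow> \<alpha> p = 0"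
    and \<Lambda>: "strict_mono_on {..<n} \<Lambda>" and b: "\<And>c. c < m \<Longrightarrow> b c = \<Lambda> (\<psi> c)"
    and \<sigma>: "\<sigma> \<in> boxes n \<alpha> 0 \<rightarrow>\<^sub>E UNIV" and \<tau>: "\<tau> \<in> boxes m \<beta> 0 \<rightarrow>\<^sub>E UNIV"
    and \<sigma>\<tau>: "\<And>c k. (c, k) \<in> boxes m \<beta> 0 \<Longrightarrow> \<sigma> (\<psi> c, k) < n \<and> \<tau> (c, k) = \<Lambda> (\<sigma> (\<psi> c, k))"
  shows "\<sigma> \<in> fillset n \<alpha> 0 (\<lambda>c. c) \<longleftrightarrow> \<tau> \<in> fillset m \<beta> 0 b"
proof -
  let ?w' = "row_of 0 (\<lambda>c. c) \<sigma>" and ?w = "row_of 0 b \<tau>"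
  have w: "?w' k (\<psi> c) \<in> {..<n} \<and> ?w k c = \<Lambda> (?w' k (\<psi> c))" if "c \<in> cols m \<beta> k" for k c
    using that \<psi>(2) b \<sigma>\<tau>[of c k] by (auto simp: row_of_def cols_def boxes_def)
  have cols_Suc: "cols n \<alpha> (Suc k) = \<psi> ` cols m \<beta> (Suc k)" for k
  proof (intro equalityI subsetI)
    fix p assume p: "p \<in> cols n \<alpha> (Suc k)"
    then have "p \<in> \<psi> ` {..<m}" using empty by (force simp: cols_def)
    then show "p \<in> \<psi> ` cols m \<beta> (Suc k)" using p \<beta> by (auto simp: cols_def)
  next
    fix p assume "p \<in> \<psi> ` cols m \<beta> (Suc k)"
    then show "p \<in> cols n \<alpha> (Suc k)" using \<psi>(2) \<beta> by (auto simp: cols_def)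
  qed
  have ok: "row_ok (cols n \<alpha> k) (cols n \<alpha> (Suc k)) \<alpha> (?w' k) (?w' (Suc k)) \<longleftrightarrow>
      row_ok (cols m \<beta> k) (cols m \<beta> (Suc k)) \<beta> (?w k) (?w (Suc k))" for k
  proof (rule row_ok_transport[of _ \<psi> _ _ _ "{..<n}" \<Lambda>])
    show "strict_mono_on (cols m \<beta> k) \<psi>"
      using \<psi>(1) by (rule monotone_on_subset) (auto simp: cols_def)
    show "\<psi> ` cols m \<beta> k \<subseteq> cols n \<alpha> k" using \<psi>(2) \<beta> by (auto simp: cols_def)
    show "cols m \<beta> (Suc k) \<subseteq> cols m \<beta> k" by (auto simp: cols_def)
    fix c d assume "c \<in> cols n \<alpha> (Suc k)" "d \<in> cols n \<alpha> k" "d \<notin> \<psi> ` cols m \<beta> k" "c < d"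
    \<comment> \<open>Above the basement every column comes from the smaller diagram, so columns are
      deleted in row 0 only, where the labels are the column numbers.\<close>
    then have "k = 0"
      using cols_Suc by (cases k) auto
    then show "?w' k c < ?w' k d" using \<open>c < d\<close> by (simp add: row_of_def)
  qed (use cols_Suc \<Lambda> w \<beta> in \<open>auto simp: cols_def\<close>)
  have inj: "inj_on (?w' (Suc k)) (cols n \<alpha> (Suc k)) \<longleftrightarrow> inj_on (?w (Suc k)) (cols m \<beta> (Suc k))" for k
  proof -
    have "inj_on \<psi> (cols m \<beta> (Suc k))"
      using strict_mono_on_imp_inj_on[OF \<psi>(1)] by (rule inj_on_subset) (auto simp: cols_def)
    then have "inj_on (?w' (Suc k)) (cols n \<alpha> (Suc k)) \<longleftrightarrow> inj_on (?w' (Suc k) \<circ> \<psi>) (cols m \<beta> (Suc k))"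
      unfolding cols_Suc by (simp add: comp_inj_on_iff)
    also have "\<dots> \<longleftrightarrow> inj_on (?w (Suc k)) (cols m \<beta> (Suc k))"
      using w[of _ "Suc k"] strict_mono_on_imp_inj_on[OF \<Lambda>] unfolding inj_on_def comp_def by metis
    finally show ?thesis .
  qed
  show ?thesis using \<sigma> \<tau> by (simp add: fillset_def ok inj)
qed

lemma boxes_transport:
  assumes "\<psi> ` {..<m} \<subseteq> {..<n}" "\<And>c. c < m \<Longrightarrow> \<beta> c = \<alpha> (\<psi> c)"
    and "\<And>p. p < n \<Longrightarrow> p \<notin> \<psi> ` {..<m} \<Longrightarrow> \<alpha> p = 0"
  shows "boxes n \<alpha> 0 = map_prod \<psi> id ` boxes m \<beta> 0"
proof (intro equalityI subsetI)
  fix x assume x: "x \<in> boxes n \<alpha> 0"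
  then obtain p k where pk: "x = (p, k)" "p < n" "0 < k" "k \<le> \<alpha> p" by (auto simp: boxes_def)
  then obtain c where "c < m" "p = \<psi> c" using assms(3)[of p] by force
  then show "x \<in> map_prod \<psi> id ` boxes m \<beta> 0" using pk assms(2) by (force simp: boxes_def)
next
  fix x assume "x \<in> map_prod \<psi> id ` boxes m \<beta> 0"
  then show "x \<in> boxes n \<alpha> 0" using assms(1,2) by (auto simp: boxes_def)
qed

section \<open>Positions in a concatenation of blocks\<close>

definition off :: "(nat \<Rightarrow> nat) \<Rightarrow> nat \<Rightarrow> nat" where
  "off f j = (\<Sum>i<j. f i)"

lemma off_Suc: "off f (Suc j) = off f j + f j"
  by (simp add: off_def)

lemma off_mono: "i \<le> j \<Longrightarrow> off f i \<le> off f j"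
  unfolding off_def by (rule sum_mono2) auto

lemma off_add_less: "j < j' \<Longrightarrow> k < f j \<Longrightarrow> off f j + k < off f j'"
  using off_mono[of "Suc j" j' f] by (simp add: off_Suc)

lemma off_less_iff:
  assumes "k < f j" "k' < f j'"
  shows "off f j + k < off f j' + k' \<longleftrightarrow> j < j' \<or> j = j' \<and> k < k'"
  using off_add_less[of j j' k f] off_add_less[of j' j k' f] assms
  by (cases j j' rule: linorder_cases) auto

lemma off_decompose:
  assumes "p < off f r"
  obtains j k where "j < r" "k < f j" "p = off f j + k"
proof -
  have "\<exists>j<r. \<exists>k<f j. p = off f j + k"
    using assms
  proof (induction r)
    case (Suc r)
    show ?case
    proof (cases "p < off f r")
      case False
      then show ?thesis using Suc.prems
        by (intro exI[of _ r] conjI exI[of _ "p - off f r"]) (auto simp: off_Suc)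
    qed (use Suc.IH less_Suc_eq in blast)
  qed (simp add: off_def)
  then show ?thesis using that by blast
qed

lemma length_concat_blocks:
  assumes "\<And>j. j < r \<Longrightarrow> length (g j) = f j"
  shows "length (concat (map g [0..<r])) = off f r"
  using assms by (induction r) (simp_all add: off_def)

lemma nth_concat_blocks:
  assumes "\<And>j. j < r \<Longrightarrow> length (g j) = f j" "j < r" "k < f j"
  shows "concat (map g [0..<r]) ! (off f j + k) = g j ! k"
  using assms
proof (induction r)
  case (Suc r)
  have len: "length (concat (map g [0..<r])) = off f r"
    using Suc.prems by (intro length_concat_blocks) simp
  show ?case
  proof (cases "j = r")
    case True
    then show ?thesis using len by (simp add: nth_append)
  next
    case False
    then show ?thesis using len Suc off_add_less[of j r k f] by (simp add: nth_append)
  qed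
qed simp

fun unletter :: "label \<Rightarrow> nat \<times> nat" where
  "unletter (Letter j k) = (j, k)"
| "unletter (Omega j k) = (j, k)"

section \<open>Comparison of the padded index with the diagram of the theorem\<close>

locale padding =
  fixes ls :: "nat list list" and n :: "nat \<Rightarrow> nat"
  assumes len_le: "\<And>j. j < length ls \<Longrightarrow> length (ls ! j) \<le> n j"
begin

abbreviation "r \<equiv> length ls"
abbreviation "l \<equiv> \<lambda>j. length (ls ! j)"
abbreviation "\<gamma> \<equiv> schur_index n ls"
abbreviation "h \<equiv> \<lambda>p. block_vars r n ! p"

lemma length_padded: "j < r \<Longrightarrow> length (padded_rev (n j) (ls ! j)) = n j"
  using len_le by (simp add: padded_rev_def)

lemma shape_eq: "shape ls = concat (map (\<lambda>j. rev (ls ! j)) [0..<r])"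
proof -
  have "map rev ls = map (\<lambda>j. rev (ls ! j)) [0..<r]" by (rule nth_equalityI) auto
  then show ?thesis by (simp only: shape_def)
qed

lemma lengths: "length \<gamma> = off n r" "length (shape ls) = off l r" "length (basement ls) = off l r"
  "length (block_vars r n) = off n r"
  unfolding schur_index_def shape_eq basement_def block_vars_def
  by (intro length_concat_blocks; simp add: length_padded)+

lemma nths:
  assumes "j < r"
  shows "k < n j \<Longrightarrow> h (off n j + k) = (j, k)"
    and "k < n j \<Longrightarrow> \<gamma> ! (off n j + k) = padded_rev (n j) (ls ! j) ! k"
    and "t < l j \<Longrightarrow> shape ls ! (off l j + t) = rev (ls ! j) ! t"
    and "t < l j \<Longrightarrow> basement ls ! (off l j + t) = Omega j t"
    and "t < l j \<Longrightarrow> block_vars r l ! (off l j + t) = (j, t)"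
  unfolding block_vars_def schur_index_def shape_eq basement_def
  using assms length_padded by (simp_all add: nth_concat_blocks)

definition \<psi> :: "nat \<Rightarrow> nat" where
  "\<psi> c = (case block_vars r l ! c of (j, t) \<Rightarrow> off n j + (n j - l j + t))"

text \<open>The last \<open>l j\<close> numbers of a block lie under the columns of the diagram and
  become the basement symbols of index \<open>j\<close>; the earlier ones lie under padding zeros
  and become letters. This respects the order of the alphabet.\<close>

definition \<Lambda> :: "nat \<Rightarrow> label" where
  "\<Lambda> p = (case h p of (j, k) \<Rightarrow> if k < n j - l j then Letter j k else Omega j (k - (n j - l j)))"

lemma \<psi>: "j < r \<Longrightarrow> t < l j \<Longrightarrow> \<psi> (off l j + t) = off n j + (n j - l j + t)"
  by (simp add: \<psi>_def nths)

lemma \<Lambda>: "j < r \<Longrightarrow> k < n j \<Longrightarrow>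
    \<Lambda> (off n j + k) = (if k < n j - l j then Letter j k else Omega j (k - (n j - l j)))"
  by (simp add: \<Lambda>_def nths)

lemma \<psi>_index_less: "j < r \<Longrightarrow> t < l j \<Longrightarrow> n j - l j + t < n j"
  using len_le[of j] by simp

lemma strict_mono_\<psi>: "strict_mono_on {..<off l r} \<psi>"
proof (rule strict_mono_onI)
  fix c d assume c: "c \<in> {..<off l r}" and d: "d \<in> {..<off l r}" and cd: "c < d"
  obtain j t where j: "j < r" "t < l j" "c = off l j + t" using c by (auto elim: off_decompose)
  obtain j' t' where j': "j' < r" "t' < l j'" "d = off l j' + t'" using d by (auto elim: off_decompose)
  have "j < j' \<or> j = j' \<and> t < t'" using cd j j' off_less_iff[of t l j t' j'] by simp
  then show "\<psi> c < \<psi> d"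
    using off_less_iff[of "n j - l j + t" n j "n j' - l j' + t'" j'] \<psi>_index_less j j' by (auto simp: \<psi>)
qed

lemma strict_mono_\<Lambda>: "strict_mono_on {..<off n r} \<Lambda>"
proof (rule strict_mono_onI)
  fix c d assume c: "c \<in> {..<off n r}" and d: "d \<in> {..<off n r}" and cd: "c < d"
  obtain j t where j: "j < r" "t < n j" "c = off n j + t" using c by (auto elim: off_decompose)
  obtain j' t' where j': "j' < r" "t' < n j'" "d = off n j' + t'" using d by (auto elim: off_decompose)
  have "j < j' \<or> j = j' \<and> t < t'" using cd j j' off_less_iff[of t n j t' j'] by simp
  then show "\<Lambda> c < \<Lambda> d"
    using j j' by (auto simp: \<Lambda>)
qed

lemma \<psi>_image: "\<psi> ` {..<off l r} \<subseteq> {..<off n r}"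
proof
  fix p assume "p \<in> \<psi> ` {..<off l r}"
  then obtain j t where "j < r" "t < l j" "p = \<psi> (off l j + t)" by (auto elim: off_decompose)
  then show "p \<in> {..<off n r}"
    using off_add_less[of j r "n j - l j + t" n] \<psi>_index_less[of j t] by (simp add: \<psi>)
qed

lemma shape_\<psi>:
  assumes "c < off l r"
  shows "shape ls ! c = \<gamma> ! \<psi> c"
proof -
  obtain j t where j: "j < r" "t < l j" "c = off l j + t" using assms by (rule off_decompose)
  have "\<gamma> ! \<psi> c = padded_rev (n j) (ls ! j) ! (n j - l j + t)"
    unfolding j(3) \<psi>[OF j(1,2)] using j(1) \<psi>_index_less[OF j(1,2)] by (rule nths)
  then show ?thesis using j by (simp only: nths) (simp add: padded_rev_def nth_append)
qed

lemma basement_\<psi>: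
  assumes "c < off l r"
  shows "basement ls ! c = \<Lambda> (\<psi> c)"
proof -
  obtain j t where j: "j < r" "t < l j" "c = off l j + t" using assms by (rule off_decompose)
  have "\<Lambda> (\<psi> c) = Omega j t"
    unfolding j(3) \<psi>[OF j(1,2)] using \<Lambda>[OF j(1) \<psi>_index_less[OF j(1,2)]] by simp
  then show ?thesis using j by (simp add: nths)
qed

lemma \<gamma>_empty:
  assumes "p < off n r" "p \<notin> \<psi> ` {..<off l r}"
  shows "\<gamma> ! p = 0"
proof -
  obtain j k where j: "j < r" "k < n j" "p = off n j + k" using assms(1) by (rule off_decompose)
  have "k < n j - l j"
  proof (rule ccontr)
    assume "\<not> ?thesis"
    then have "k - (n j - l j) < l j" and k: "n j - l j + (k - (n j - l j)) = k"
      using j len_le[of j] by auto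
    moreover have "p = \<psi> (off l j + (k - (n j - l j)))"
      unfolding \<psi>[OF j(1) calculation(1)] k j(3) ..
    moreover have "off l j + (k - (n j - l j)) < off l r"
      using off_add_less[of j r "k - (n j - l j)" l] calculation(1) j(1) by simp
    ultimately show False using assms(2) by (metis imageI lessThan_iff)
  qed
  then show ?thesis using j by (simp add: nths padded_rev_def nth_append)
qed

lemma inj_basement: "inj_on (\<lambda>c. basement ls ! c) {..<off l r}"
proof -
  have "inj_on (\<Lambda> \<circ> \<psi>) {..<off l r}"
    using strict_mono_\<psi> strict_mono_\<Lambda> \<psi>_image
    by (meson comp_inj_on inj_on_subset strict_mono_on_imp_inj_on)
  then show ?thesis by (simp add: inj_on_def basement_\<psi>)
qed

abbreviation "B \<equiv> boxes (off l r) (nth (shape ls)) 0"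
abbreviation "B' \<equiv> boxes (off n r) (nth \<gamma>) 0"

text \<open>The row conditions alone would allow basement symbols as entries, so the restriction to
  letters is kept as a separate condition.\<close>

lemma fillings_eq:
  "fillings ls = {\<sigma> \<in> fillset (off l r) (nth (shape ls)) 0 (nth (basement ls)).
     \<forall>b\<in>B. \<exists>j k. \<sigma> b = Letter j k \<and> j < r}" (is "?L = ?R")
proof -
  have row: "(\<lambda>c. extend ls \<sigma> (c, k)) = row_of 0 (nth (basement ls)) \<sigma> k" for \<sigma> k
    by (auto simp: extend_def row_of_def)
  have base: "inj_on (\<lambda>c. extend ls \<sigma> (c, 0)) {..<length (shape ls)}" for \<sigma>
    using inj_basement by (simp add: extend_def lengths)
  have range: "\<sigma> \<in> B \<rightarrow>\<^sub>E {Letter j k |j k. j < length ls} \<longleftrightarrow>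
      \<sigma> \<in> B \<rightarrow>\<^sub>E UNIV \<and> (\<forall>b\<in>B. \<exists>j k. \<sigma> b = Letter j k \<and> j < r)" for \<sigma>
    by (auto simp: PiE_iff)
  show ?thesis
    unfolding fillings_def fillset_def tableau_conditions_iff[OF base] row dg'_eq_boxes lengths range
    by auto
qed

lemma B'_eq: "B' = map_prod \<psi> id ` B"
  by (rule boxes_transport) (simp_all add: \<psi>_image shape_\<psi> \<gamma>_empty)

lemma inj_\<psi>: "inj_on (map_prod \<psi> id) B"
  using strict_mono_on_imp_inj_on[OF strict_mono_\<psi>]
  by (auto simp: inj_on_def boxes_def)

text \<open>The exponent \<open>e\<close> involves only variables at padding positions, so every
  entry of a numeric filling with this content translates into a letter. Fillings with an entry
  numbered like a column of the diagram have another content.\<close>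

lemma card_fillings_eq:
  assumes e: "\<And>j k. (j, k) \<in> Poly_Mapping.keys e \<Longrightarrow> k < n j - l j"
  shows "card {\<sigma> \<in> fillset (off n r) (nth \<gamma>) 0 (\<lambda>c. c). content B' (h \<circ> \<sigma>) = e} =
    card {\<tau> \<in> fillings ls. content B (unletter \<circ> \<tau>) = e}"
proof -
  let ?S = "{\<sigma> \<in> fillset (off n r) (nth \<gamma>) 0 (\<lambda>c. c). content B' (h \<circ> \<sigma>) = e}"
  let ?T = "{\<tau> \<in> fillings ls. content B (unletter \<circ> \<tau>) = e}"
  define f where "f \<sigma> = restrict (\<lambda>(c, k). \<Lambda> (\<sigma> (\<psi> c, k))) B" for \<sigma> :: "box \<Rightarrow> nat"
  \<comment> \<open>Inverse to \<open>h\<close> on the positions that matter; after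
    \<open>unletter\<close> it also undoes \<open>\<Lambda>\<close> on letters.\<close>
  define pos where "pos x = off n (fst x) + snd x" for x :: "nat \<times> nat"
  define \<psi>' where "\<psi>' = inv_into {..<off l r} \<psi>"
  define g where "g \<tau> = restrict (\<lambda>(p, k). pos (unletter (\<tau> (\<psi>' p, k)))) B'" for \<tau> :: "box \<Rightarrow> label"
  have \<psi>': "\<psi>' (\<psi> c) = c" if "c < off l r" for c
    using that strict_mono_on_imp_inj_on[OF strict_mono_\<psi>] by (simp add: \<psi>'_def)
  have B': "(\<psi> c, k) \<in> B'" if "(c, k) \<in> B" for c k
    using that by (force simp: B'_eq)
  have B'E: "\<exists>c. (c, k) \<in> B \<and> p = \<psi> c" if "(p, k) \<in> B'" for p k
    using that by (auto simp: B'_eq)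
  have content: "content B' \<sigma> = content B (\<lambda>(c, k). \<sigma> (\<psi> c, k))" for \<sigma> :: "box \<Rightarrow> nat \<times> nat"
    unfolding content_def B'_eq by (subst sum.reindex[OF inj_\<psi>]) (auto intro!: sum.cong)
  have transport: "\<sigma> \<in> fillset (off n r) (nth \<gamma>) 0 (\<lambda>c. c) \<longleftrightarrow>
      \<tau> \<in> fillset (off l r) (nth (shape ls)) 0 (nth (basement ls))"
    if "\<sigma> \<in> B' \<rightarrow>\<^sub>E UNIV" "\<tau> \<in> B \<rightarrow>\<^sub>E UNIV"
      "\<And>c k. (c, k) \<in> B \<Longrightarrow> \<sigma> (\<psi> c, k) < off n r \<and> \<tau> (c, k) = \<Lambda> (\<sigma> (\<psi> c, k))" for \<sigma> \<tau>
    by (rule fillset_transport[OF strict_mono_\<psi> \<psi>_image shape_\<psi> \<gamma>_empty strict_mono_\<Lambda> basement_\<psi> that])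
  \<comment> \<open>An entry is at most its column number, hence it numbers a variable of some
    block; this variable occurs in \<open>e\<close>, which places it among the padding
    positions.\<close>
  have letter: "\<exists>j k. j < r \<and> k < n j - l j \<and> \<sigma> b = off n j + k \<and> h (\<sigma> b) = (j, k) \<and> \<Lambda> (\<sigma> b) = Letter j k"
    if s: "\<sigma> \<in> ?S" and b: "b \<in> B'" for \<sigma> b
  proof -
    obtain c k where ck: "b = (c, k)" by (cases b)
    have "\<sigma> b \<le> c" "c < off n r"
      using fillset_le[of \<sigma> "off n r" "nth \<gamma>" 0 "\<lambda>c. c" k c] s b ck
      by (auto simp: boxes_def row_of_def)
    then obtain j m where j: "j < r" "m < n j" "\<sigma> b = off n j + m"
      by (meson le_less_trans off_decompose)
    then have h: "h (\<sigma> b) = (j, m)" by (simp add: nths)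
    have "h (\<sigma> b) \<in> Poly_Mapping.keys e"
      using s b keys_content[of B' "h \<circ> \<sigma>"] by auto
    then show ?thesis using j h e by (force simp: \<Lambda>)
  qed
  have letter': "\<exists>j k. j < r \<and> k < n j - l j \<and> \<tau> b = Letter j k" if t: "\<tau> \<in> ?T" and b: "b \<in> B" for \<tau> b
  proof -
    obtain j k where jk: "\<tau> b = Letter j k" "j < r" using t b unfolding fillings_eq by blast
    then have "(j, k) \<in> Poly_Mapping.keys e"
      using t b keys_content[of B "unletter \<circ> \<tau>"] by force
    then show ?thesis using jk e by blast
  qed
  have pos_less: "pos (j, k) < off n r" "\<Lambda> (pos (j, k)) = Letter j k" "h (pos (j, k)) = (j, k)"
    if "j < r" "k < n j - l j" for j k
    using that off_add_less[of j r k n] by (simp_all add: pos_def \<Lambda> nths)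
  have fS: "f \<sigma> \<in> ?T" if s: "\<sigma> \<in> ?S" for \<sigma>
  proof -
    have "f \<sigma> \<in> fillset (off l r) (nth (shape ls)) 0 (nth (basement ls))"
    proof (subst transport[symmetric, of \<sigma>])
      show "\<sigma> \<in> B' \<rightarrow>\<^sub>E UNIV" "\<sigma> \<in> fillset (off n r) (nth \<gamma>) 0 (\<lambda>c. c)" using s by (auto simp: fillset_def)
      show "\<sigma> (\<psi> c, k) < off n r \<and> f \<sigma> (c, k) = \<Lambda> (\<sigma> (\<psi> c, k))" if "(c, k) \<in> B" for c k
        using letter[OF s B'[OF that]] that off_add_less[of _ r _ n] by (force simp: f_def)
    qed (simp add: f_def)
    moreover have "\<forall>b\<in>B. \<exists>j k. f \<sigma> b = Letter j k \<and> j < r"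
      using letter[OF s B'] by (force simp: f_def)
    moreover have "content B (unletter \<circ> f \<sigma>) = content B' (h \<circ> \<sigma>)"
      unfolding content by (rule content_cong) (use letter[OF s B'] in \<open>force simp: f_def\<close>)
    ultimately show ?thesis using s by (simp add: fillings_eq)
  qed
  have gT: "g \<tau> \<in> ?S" if t: "\<tau> \<in> ?T" for \<tau>
  proof -
    have g: "g \<tau> (\<psi> c, k) = pos (unletter (\<tau> (c, k)))" if "(c, k) \<in> B" for c k
      using that B'[OF that] \<psi>'[of c] by (simp add: g_def boxes_def)
    have "g \<tau> \<in> fillset (off n r) (nth \<gamma>) 0 (\<lambda>c. c)"
    proof (subst transport[of _ \<tau>])
      show "\<tau> \<in> B \<rightarrow>\<^sub>E UNIV" "\<tau> \<in> fillset (off l r) (nth (shape ls)) 0 (nth (basement ls))"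
        using t by (auto simp: fillings_eq fillset_def)
      show "g \<tau> (\<psi> c, k) < off n r \<and> \<tau> (c, k) = \<Lambda> (g \<tau> (\<psi> c, k))" if "(c, k) \<in> B" for c k
        using letter'[OF t that] g[OF that] pos_less by force
    qed (simp add: g_def)
    moreover have "content B' (h \<circ> g \<tau>) = content B (unletter \<circ> \<tau>)"
      unfolding content by (rule content_cong) (use letter'[OF t] g pos_less in \<open>force\<close>)
    ultimately show ?thesis using t by simp
  qed
  have "bij_betw f ?S ?T"
  proof (rule bij_betw_byWitness[of _ g])
    show "\<forall>\<sigma>\<in>?S. g (f \<sigma>) = \<sigma>"
    proof (intro ballI ext)
      fix \<sigma> and b :: box assume s: "\<sigma> \<in> ?S"
      obtain p k where b: "b = (p, k)" by (cases b)
      show "g (f \<sigma>) b = \<sigma> b"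
      proof (cases "b \<in> B'")
        case True
        then obtain c where c: "(c, k) \<in> B" "p = \<psi> c" using B'E b by blast
        then have "\<psi>' p = c" using \<psi>' by (simp add: boxes_def)
        then have "g (f \<sigma>) b = pos (unletter (\<Lambda> (\<sigma> b)))" using True b c by (simp add: g_def f_def)
        then show ?thesis using letter[OF s True] by (auto simp: pos_def)
      next
        case False
        moreover have "\<sigma> \<in> B' \<rightarrow>\<^sub>E UNIV" using s by (simp add: fillset_def)
        ultimately show ?thesis using PiE_arb[of \<sigma> B' _ b] by (simp add: g_def)
      qed
    qed
    show "\<forall>\<tau>\<in>?T. f (g \<tau>) = \<tau>"
    proof (intro ballI ext)
      fix \<tau> and b :: box assume t: "\<tau> \<in> ?T"
      obtain c k where b: "b = (c, k)" by (cases b)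
      show "f (g \<tau>) b = \<tau> b"
      proof (cases "b \<in> B")
        case True
        then have "f (g \<tau>) b = \<Lambda> (pos (unletter (\<tau> b)))"
          using b B'[of c k] \<psi>'[of c] by (simp add: g_def f_def boxes_def)
        then show ?thesis using letter'[OF t True] pos_less by auto
      next
        case False
        moreover have "\<tau> \<in> B \<rightarrow>\<^sub>E UNIV" using t by (simp add: fillings_eq fillset_def)
        ultimately show ?thesis using PiE_arb[of \<tau> B _ b] by (simp add: f_def)
      qed
    qed
  qed (use fS gT in blast)+
  then show ?thesis by (rule bij_betw_same_card)
qed

end

section \<open>Multi-symmetric Schur functions count fillings\<close>

lemma rename_monom_content: "rename_monom h (content B \<sigma>) = content B (h \<circ> \<sigma>)"
  by (simp add: content_def rename_monom_sum)

lemma substitute_key_poly: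
  "substitute h (key_poly \<gamma>) = (\<Sum>\<sigma>\<in>fillset (length \<gamma>) (nth \<gamma>) 0 (\<lambda>c. c).
     Poly_Mapping.single (content (boxes (length \<gamma>) (nth \<gamma>) 0) (h \<circ> \<sigma>)) 1)"
proof -
  have "key_gf \<gamma> = (\<Sum>\<sigma>\<in>fillset (length \<gamma>) (nth \<gamma>) 0 (\<lambda>c. c).
     Poly_Mapping.single (content (boxes (length \<gamma>) (nth \<gamma>) 0) \<sigma>) 1)"
    unfolding key_gf_def using nth_le_sum_list by (intro gf_eq_sum_fillset) simp
  then show ?thesis
    by (simp add: key_poly_eq substitute_sum rename_monom_content)
qed

text \<open>Entries do not exceed the basement label of their column, so only variables numbered
  below \<open>length \<gamma>\<close> occur.\<close>

lemma substitute_key_poly_cong: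
  assumes "\<And>p. p < length \<gamma> \<Longrightarrow> h p = h' p"
  shows "substitute h (key_poly \<gamma>) = substitute h' (key_poly \<gamma>)"
  unfolding substitute_key_poly
proof (intro sum.cong refl arg_cong2[of _ _ _ _ Poly_Mapping.single] content_cong)
  fix \<sigma> and b :: box
  assume s: "\<sigma> \<in> fillset (length \<gamma>) (nth \<gamma>) 0 (\<lambda>c. c)" and b: "b \<in> boxes (length \<gamma>) (nth \<gamma>) 0"
  obtain c k where ck: "b = (c, k)" by (cases b)
  have "\<sigma> b \<le> c" "c < length \<gamma>"
    using fillset_le[OF s, of k c] b ck by (auto simp: boxes_def row_of_def)
  then show "(h \<circ> \<sigma>) b = (h' \<circ> \<sigma>) b" using assms by simp
qed

lemma lookup_substitute_key_poly:
  "Poly_Mapping.lookup (substitute h (key_poly \<gamma>)) e =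
     int (card {\<sigma> \<in> fillset (length \<gamma>) (nth \<gamma>) 0 (\<lambda>c. c). content (boxes (length \<gamma>) (nth \<gamma>) 0) (h \<circ> \<sigma>) = e})"
  by (simp add: substitute_key_poly lookup_sum lookup_single when_def sum.If_cases finite_fillset Int_def)
     (auto intro!: arg_cong[where f = card])

definition filling_count :: "nat list list \<Rightarrow> (nat \<times> nat) monomial \<Rightarrow> nat" where
  "filling_count ls e = card {\<tau> \<in> fillings ls. content (dg' (shape ls)) (unletter \<circ> \<tau>) = e}"

text \<open>Coefficients stabilise: with at least \<open>N\<close> padding zeros in each block, the
  count of fillings with content \<open>e\<close> no longer refers to \<open>n\<close>.\<close>

lemma lookup_schur_approx:
  assumes n: "\<And>j. j < length ls \<Longrightarrow> length (ls ! j) + N \<le> n j"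
    and e: "\<And>j k. (j, k) \<in> Poly_Mapping.keys e \<Longrightarrow> k < N"
  shows "Poly_Mapping.lookup (schur_approx ls n) e = int (filling_count ls e)"
proof -
  interpret padding ls n using n by unfold_locales (auto intro: add_leD1)
  have small: "card {\<sigma> \<in> fillset (off n r) (nth \<gamma>) 0 (\<lambda>c. c). content B' (h \<circ> \<sigma>) = e} = filling_count ls e"
  proof (cases "fst ` Poly_Mapping.keys e \<subseteq> {..<r}")
    case True
    have "k < n j - l j" if "(j, k) \<in> Poly_Mapping.keys e" for j k
    proof -
      have "j < r" using True that by force
      then show ?thesis using e[OF that] n[of j] by linarith
    qed
    then show ?thesis
      unfolding filling_count_def dg'_eq_boxes lengths by (rule card_fillings_eq)
  next
    case False
    \<comment> \<open>A variable outside all blocks occurs in no filling of either kind, so both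
      counts are zero.\<close>
    then obtain x where "x \<in> Poly_Mapping.keys e" "\<not> fst x < r" by blast
    then obtain j k where jk: "(j, k) \<in> Poly_Mapping.keys e" "\<not> j < r" by (cases x) simp
    have "content B' (h \<circ> \<sigma>) \<noteq> e" if s: "\<sigma> \<in> fillset (off n r) (nth \<gamma>) 0 (\<lambda>c. c)" for \<sigma>
    proof
      assume "content B' (h \<circ> \<sigma>) = e"
      then have "(j, k) \<in> (h \<circ> \<sigma>) ` B'" using jk keys_content[of B' "h \<circ> \<sigma>"] by simp
      then obtain c m where b: "(c, m) \<in> B'" "h (\<sigma> (c, m)) = (j, k)" by auto
      have "\<sigma> (c, m) \<le> c" "c < off n r"
        using fillset_le[OF s, of m c] b by (auto simp: boxes_def row_of_def)
      then have "\<sigma> (c, m) < off n r" by simp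
      then obtain j' k' where "j' < r" "k' < n j'" "\<sigma> (c, m) = off n j' + k'" by (rule off_decompose)
      then show False using b jk by (simp add: nths)
    qed
    then have 1: "{\<sigma> \<in> fillset (off n r) (nth \<gamma>) 0 (\<lambda>c. c). content B' (h \<circ> \<sigma>) = e} = {}" by blast
    have "content B (unletter \<circ> \<tau>) \<noteq> e" if t: "\<tau> \<in> fillings ls" for \<tau>
    proof
      assume "content B (unletter \<circ> \<tau>) = e"
      then have "(j, k) \<in> (unletter \<circ> \<tau>) ` B" using jk keys_content[of B "unletter \<circ> \<tau>"] by simp
      then obtain b where b: "b \<in> B" "unletter (\<tau> b) = (j, k)" by auto
      then obtain j' k' where "\<tau> b = Letter j' k'" "j' < r" using t unfolding fillings_eq by blast
      then show False using b jk by simp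
    qed
    then have 2: "{\<tau> \<in> fillings ls. content B (unletter \<circ> \<tau>) = e} = {}" by blast
    show ?thesis unfolding filling_count_def dg'_eq_boxes lengths 1 2 by simp
  qed
  show ?thesis
    unfolding schur_approx_def lookup_substitute_key_poly lengths small ..
qed

section \<open>The joint limit over the block sizes\<close>

lemma eventually_all_at_top: "\<forall>\<^sub>F n in all_at_top r. \<forall>j<r. N \<le> n j"
proof -
  have "all_at_top r \<le> principal {n. \<forall>j<r. N \<le> n j}"
    unfolding all_at_top_def by (rule INF_lower) simp
  then show ?thesis by (simp add: le_principal)
qed

text \<open>Properness of the filter makes limits unique, so \<open>Lim\<close> returns the eventual
  value. Each basic set contains a constant function.\<close>

lemma all_at_top_neq_bot: "all_at_top r \<noteq> bot"
proof
  assume "all_at_top r = bot"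
  then have "eventually (\<lambda>_. False) (all_at_top r)" by simp
  then have "\<exists>N\<in>UNIV. eventually (\<lambda>_. False) (principal {n :: nat \<Rightarrow> nat. \<forall>j<r. N \<le> n j})"
    unfolding all_at_top_def
  proof (subst (asm) eventually_INF_base)
    fix a b :: nat
    show "\<exists>x\<in>UNIV. principal {n :: nat \<Rightarrow> nat. \<forall>j<r. x \<le> n j} \<le>
        inf (principal {n. \<forall>j<r. a \<le> n j}) (principal {n. \<forall>j<r. b \<le> n j})"
      by (intro bexI[of _ "max a b"]) auto
  qed blast+
  then obtain N where N: "{n :: nat \<Rightarrow> nat. \<forall>j<r. N \<le> n j} = {}" by (auto simp: eventually_principal)
  have "(\<lambda>_. N) \<in> {n :: nat \<Rightarrow> nat. \<forall>j<r. N \<le> n j}" by simp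
  then show False unfolding N by simp
qed

lemma bounded_index: "\<exists>N. \<forall>j k. (j, k) \<in> Poly_Mapping.keys e \<longrightarrow> k < (N :: nat)"
proof (intro exI allI impI)
  fix j k assume "(j, k) \<in> Poly_Mapping.keys e"
  then have "k \<le> Max (snd ` Poly_Mapping.keys e)" by (intro Max_ge) force+
  then show "k < Suc (Max (snd ` Poly_Mapping.keys e))" by simp
qed

lemma bounded_length: "\<exists>M. \<forall>j<length ls. length (ls ! j) \<le> (M :: nat)"
proof (intro exI allI impI)
  fix j assume "j < length ls"
  then show "length (ls ! j) \<le> sum_list (map length ls)"
    using elem_le_sum_list[of j "map length ls"] by simp
qed

theorem multi_schur_eq_filling_count: "multi_schur ls e = int (filling_count ls e)"
proof -
  obtain N where N: "\<And>j k. (j, k) \<in> Poly_Mapping.keys e \<Longrightarrow> k < N" using bounded_index by blast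
  obtain M where M: "\<And>j. j < length ls \<Longrightarrow> length (ls ! j) \<le> M" using bounded_length by blast
  have "\<forall>\<^sub>F n in all_at_top (length ls). Poly_Mapping.lookup (schur_approx ls n) e = int (filling_count ls e)"
    using eventually_all_at_top[of "length ls" "M + N"]
  proof (rule eventually_mono)
    fix n assume n: "\<forall>j<length ls. M + N \<le> n j"
    have "length (ls ! j) + N \<le> n j" if "j < length ls" for j
      using M[OF that] n that by force
    from lookup_schur_approx[OF this N]
    show "Poly_Mapping.lookup (schur_approx ls n) e = int (filling_count ls e)" .
  qed
  then show ?thesis
    unfolding multi_schur_def by (intro tendsto_Lim all_at_top_neq_bot tendsto_eventually)
qed

section \<open>Symmetry within each block\<close>

lemma lookup_rename_monom:
  assumes "bij h"
  shows "Poly_Mapping.lookup (rename_monom h e) x = Poly_Mapping.lookup e (inv h x)"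
proof -
  have "h u = x \<longleftrightarrow> u = inv h x" for u using assms by (metis bij_inv_eq_iff)
  then show ?thesis
    by (simp add: rename_monom_def lookup_sum lookup_single when_def in_keys_iff)
qed

lemma lookup_rename_transpose:
  "Poly_Mapping.lookup (rename_monom (transpose a b) e) x = Poly_Mapping.lookup e (transpose a b x)"
  by (simp add: lookup_rename_monom inv_unique_comp[OF transpose_comp_involutory transpose_comp_involutory])

lemma keys_rename_transpose:
  "Poly_Mapping.keys (rename_monom (transpose a b) e) = transpose a b ` Poly_Mapping.keys e"
  by (force simp: in_keys_iff lookup_rename_transpose image_iff)

lemma lookup_substitute_rename:
  assumes "inj (rename_monom h)"
  shows "Poly_Mapping.lookup (substitute h f) (rename_monom h e) = Poly_Mapping.lookup f e"
proof -
  have "rename_monom h m = rename_monom h e \<longleftrightarrow> m = e" for m using assms by (auto dest: injD)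
  then show ?thesis
    by (simp add: substitute_eq lookup_sum lookup_single when_def in_keys_iff)
qed

lemma inj_rename_transpose: "inj (rename_monom (transpose a b))"
  by (rule inj_on_inverseI[of _ "rename_monom (transpose a b)"])
     (simp add: rename_monom_compose id_def rename_monom_id)

text \<open>Far to the left within its block, the padded index is zero at two adjacent positions, and the
  key polynomial is then symmetric in the corresponding variables.\<close>

lemma filling_count_transpose:
  assumes j: "j < length ls"
  shows "filling_count ls (rename_monom (transpose (j, k) (j, Suc k)) e) = filling_count ls e"
proof -
  let ?t = "transpose (j, k) (j, Suc k)"
  obtain N where N: "\<And>j k. (j, k) \<in> Poly_Mapping.keys e \<Longrightarrow> k < N" using bounded_index by blast
  obtain M where M: "\<And>j. j < length ls \<Longrightarrow> length (ls ! j) \<le> M" using bounded_length by blast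
  \<comment> \<open>Leaves room for the positions \<open>k\<close> and \<open>k + 1\<close> among
    the padding zeros and also bounds the transposed exponent, so a single \<open>n\<close> computes
    both coefficients.\<close>
  define N' where "N' = N + Suc (Suc k)"
  define n where "n = (\<lambda>_ :: nat. M + N')"
  have n: "length (ls ! j) + N' \<le> n j" if "j < length ls" for j
    using M[OF that] by (simp add: n_def)
  have e: "k < N'" if "(j, k) \<in> Poly_Mapping.keys e" for j k
    using N[OF that] by (simp add: N'_def)
  have e': "k' < N'" if x: "(j', k') \<in> Poly_Mapping.keys (rename_monom ?t e)" for j' k'
  proof -
    obtain y where y: "y \<in> Poly_Mapping.keys e" "(j', k') = ?t y"
      using x unfolding keys_rename_transpose by blast
    then show ?thesis using e[of "fst y" "snd y"] by (auto simp: transpose_def N'_def split: if_splits)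
  qed
  interpret padding ls n using n by unfold_locales (auto intro: add_leD1)
  let ?i = "off n j + k"
  have kn: "Suc k < n j - l j" "Suc k < n j" using n[OF j] by (simp_all add: N'_def)
  have "\<gamma> ! ?i = 0" "\<gamma> ! Suc ?i = 0"
    using nths(2)[OF j, of k] nths(2)[OF j, of "Suc k"] kn by (simp_all add: padded_rev_def nth_append)
  moreover have "Suc ?i < length \<gamma>" using off_add_less[of j r "Suc k" n] kn j by (simp add: lengths)
  ultimately have sym: "exchange ?i (key_poly \<gamma>) = key_poly \<gamma>"
    by (simp add: key_poly_eq key_gf_symmetric)
  have "?t (h p) = h (transpose ?i (Suc ?i) p)" if "p < length \<gamma>" for p
  proof -
    have "p < off n r" using that by (simp add: lengths)
    then obtain j' k' where p: "j' < r" "k' < n j'" "p = off n j' + k'"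
      by (rule off_decompose)
    have hi: "h ?i = (j, k)" "h (Suc ?i) = (j, Suc k)"
      using nths(1)[OF j, of k] nths(1)[OF j, of "Suc k"] kn by simp_all
    have hp: "h p = (j', k')" using p by (simp add: nths)
    consider "p = ?i" | "p = Suc ?i" | "p \<noteq> ?i" "p \<noteq> Suc ?i" by blast
    then show ?thesis
    proof cases
      case 3
      then have "(j', k') \<noteq> (j, k)" "(j', k') \<noteq> (j, Suc k)" using p by auto
      then show ?thesis using 3 hp by (simp add: transpose_apply_other)
    qed (simp_all add: hi)
  qed
  then have "substitute (?t \<circ> h) (key_poly \<gamma>) = substitute (h \<circ> transpose ?i (Suc ?i)) (key_poly \<gamma>)"
    by (intro substitute_key_poly_cong) simp
  then have "substitute ?t (schur_approx ls n) = schur_approx ls n"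
    unfolding schur_approx_def substitute_compose
    by (simp only: substitute_compose[symmetric] sym)
  then have "Poly_Mapping.lookup (schur_approx ls n) (rename_monom ?t e) = Poly_Mapping.lookup (schur_approx ls n) e"
    using lookup_substitute_rename[OF inj_rename_transpose] by metis
  then show ?thesis
    using lookup_schur_approx[OF n e] lookup_schur_approx[OF n e'] by simp
qed

section \<open>Expansion in monomial symmetric functions\<close>

definition restrict_monom :: "('v \<Rightarrow> bool) \<Rightarrow> 'v monomial \<Rightarrow> 'v monomial" where
  "restrict_monom P e = (\<Sum>x\<in>{x \<in> Poly_Mapping.keys e. P x}. Poly_Mapping.single x (Poly_Mapping.lookup e x))"

lemma lookup_restrict_monom:
  "Poly_Mapping.lookup (restrict_monom P e) x = (if P x then Poly_Mapping.lookup e x else 0)"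
  by (auto simp: restrict_monom_def lookup_sum lookup_single when_def in_keys_iff)

lemma keys_restrict_monom: "Poly_Mapping.keys (restrict_monom P e) = {x \<in> Poly_Mapping.keys e. P x}"
  by (auto simp: in_keys_iff lookup_restrict_monom split: if_splits)

text \<open>The product of series sums over these splittings, and a sum over an infinite set would
  be 0 by default. The exponents of \<open>a\<close> are bounded by those of \<open>e\<close>, and
  \<open>a\<close> determines \<open>b\<close> by cancellation.\<close>

lemma finite_monomial_splits: "finite {(a, b). a + b = (e :: 'v monomial)}"
proof -
  let ?F = "{f. \<forall>x. (x \<in> Poly_Mapping.keys e \<longrightarrow> f x \<in> {..\<Sum>x\<in>Poly_Mapping.keys e. Poly_Mapping.lookup e x}) \<and>
      (x \<notin> Poly_Mapping.keys e \<longrightarrow> f x = (0 :: nat))}"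
  have fin: "finite ?F" by (rule finite_set_of_finite_funs) simp_all
  have bound: "Poly_Mapping.lookup a \<in> ?F" if "a + b = e" for a b
  proof -
    have le: "Poly_Mapping.lookup a x \<le> Poly_Mapping.lookup e x" for x
      using that by (auto simp: lookup_add)
    then have "Poly_Mapping.lookup a x \<le> (\<Sum>x\<in>Poly_Mapping.keys e. Poly_Mapping.lookup e x)"
      if "x \<in> Poly_Mapping.keys e" for x
      using that by (meson finite_keys le_trans member_le_sum zero_le)
    moreover have "Poly_Mapping.lookup a x = 0" if "x \<notin> Poly_Mapping.keys e" for x
      using le[of x] that by (simp add: in_keys_iff)
    ultimately show ?thesis by simp
  qed
  have "inj_on (\<lambda>(a, b). Poly_Mapping.lookup a) {(a, b). a + b = e}"
    by (rule inj_onI) (auto simp: Poly_Mapping.lookup_inject)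
  moreover have "(\<lambda>(a, b). Poly_Mapping.lookup a) ` {(a, b). a + b = e} \<subseteq> ?F"
    using bound by auto
  ultimately show ?thesis using fin by (meson finite_imageD finite_subset)
qed

definition block_exponents :: "(nat \<times> nat) monomial \<Rightarrow> nat \<Rightarrow> nat multiset" where
  "block_exponents e j = image_mset (Poly_Mapping.lookup e) (mset_set {x \<in> Poly_Mapping.keys e. fst x = j})"

lemma monomial_sym_restrict:
  "monomial_sym j \<mu> (restrict_monom (\<lambda>x. fst x = j) e) = (if block_exponents e j = mset \<mu> then 1 else 0)"
proof -
  have "image_mset (Poly_Mapping.lookup (restrict_monom (\<lambda>x. fst x = j) e))
      (mset_set {x \<in> Poly_Mapping.keys e. fst x = j}) = block_exponents e j"
    unfolding block_exponents_def by (rule image_mset_cong) (simp add: lookup_restrict_monom)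
  then show ?thesis
    unfolding monomial_sym_def keys_restrict_monom by auto
qed

lemma block_exponents_restrict:
  assumes "P = (\<lambda>x. fst x \<noteq> j)" "j' \<noteq> j"
  shows "block_exponents (restrict_monom P e) j' = block_exponents e j'"
proof -
  have "{x \<in> Poly_Mapping.keys (restrict_monom P e). fst x = j'} = {x \<in> Poly_Mapping.keys e. fst x = j'}"
    using assms by (auto simp: keys_restrict_monom)
  then show ?thesis
    unfolding block_exponents_def using assms by (auto simp: lookup_restrict_monom intro!: image_mset_cong)
qed

text \<open>The factor for block \<open>j\<close> involves only variables of that block and the
  remaining factors none of them. Hence the one splitting that can contribute restricts
  \<open>e\<close> to the block and to its complement.\<close>

lemma foldr_monomial_sym:
  assumes "distinct js"
  shows "foldr series_mult (map (\<lambda>j. monomial_sym j (ms ! j)) js) series_one e =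
    (if fst ` Poly_Mapping.keys e \<subseteq> set js \<and> (\<forall>j\<in>set js. block_exponents e j = mset (ms ! j)) then 1 else 0)"
  using assms
proof (induction js arbitrary: e)
  case Nil
  then show ?case by (auto simp: series_one_def)
next
  case (Cons j js)
  let ?G = "foldr series_mult (map (\<lambda>j. monomial_sym j (ms ! j)) js) series_one"
  let ?P = "\<lambda>x :: nat \<times> nat. fst x = j" and ?Q = "\<lambda>x :: nat \<times> nat. fst x \<noteq> j"
  let ?a = "restrict_monom ?P e" and ?b = "restrict_monom ?Q e"
  have IH: "?G b = (if fst ` Poly_Mapping.keys b \<subseteq> set js \<and> (\<forall>j\<in>set js. block_exponents b j = mset (ms ! j)) then 1 else 0)" for b
    using Cons by simp
  have split: "?a + ?b = e"
    by (rule poly_mapping_eqI) (simp add: lookup_add lookup_restrict_monom)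
  have other: "monomial_sym j (ms ! j) a * ?G b = 0" if ab: "a + b = e" "(a, b) \<noteq> (?a, ?b)" for a b
  proof (rule ccontr)
    assume nz: "monomial_sym j (ms ! j) a * ?G b \<noteq> 0"
    then have a: "fst ` Poly_Mapping.keys a \<subseteq> {j}" by (auto simp: monomial_sym_def split: if_splits)
    have b: "fst ` Poly_Mapping.keys b \<subseteq> set js" using nz IH[of b] by (auto split: if_splits)
    have a0: "Poly_Mapping.lookup a x = 0" if "fst x \<noteq> j" for x
      using a that by (meson imageI in_keys_iff singletonD subsetD)
    have b0: "Poly_Mapping.lookup b x = 0" if "fst x = j" for x
      using b that Cons.prems by (metis distinct.simps(2) imageI in_keys_iff subsetD)
    have "a = ?a" "b = ?b"
      using a0 b0 unfolding ab(1)[symmetric]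
      by (auto intro!: poly_mapping_eqI simp: lookup_restrict_monom lookup_add)
    then show False using ab by simp
  qed
  have "foldr series_mult (map (\<lambda>j. monomial_sym j (ms ! j)) (j # js)) series_one e =
      (\<Sum>(a, b) | a + b = e. monomial_sym j (ms ! j) a * ?G b)"
    by (simp add: series_mult_def)
  also have "\<dots> = (\<Sum>(a, b)\<in>{(?a, ?b)}. monomial_sym j (ms ! j) a * ?G b)"
  proof (rule sum.mono_neutral_right)
    show "finite {(a, b). a + b = e}" by (rule finite_monomial_splits)
    show "{(?a, ?b)} \<subseteq> {(a, b). a + b = e}" using split by simp
    show "\<forall>x\<in>{(a, b). a + b = e} - {(?a, ?b)}. (case x of (a, b) \<Rightarrow> monomial_sym j (ms ! j) a * ?G b) = 0"
    proof
      fix x assume x: "x \<in> {(a, b). a + b = e} - {(?a, ?b)}"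
      then show "(case x of (a, b) \<Rightarrow> monomial_sym j (ms ! j) a * ?G b) = 0"
        using other[of "fst x" "snd x"] by (simp only: case_prod_unfold) simp
    qed
  qed
  also have "\<dots> = monomial_sym j (ms ! j) ?a * ?G ?b" by simp
  also have "?G ?b = (if fst ` Poly_Mapping.keys e \<subseteq> set (j # js) \<and> (\<forall>j\<in>set js. block_exponents e j = mset (ms ! j)) then 1 else 0)"
  proof -
    have "fst ` Poly_Mapping.keys ?b \<subseteq> set js \<longleftrightarrow> fst ` Poly_Mapping.keys e \<subseteq> set (j # js)"
      using Cons.prems by (auto simp: keys_restrict_monom)
    moreover have "block_exponents ?b j' = block_exponents e j'" if "j' \<in> set js" for j'
      using that Cons.prems by (intro block_exponents_restrict) auto
    ultimately show ?thesis unfolding IH by simp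
  qed
  finally show ?case unfolding monomial_sym_restrict by simp
qed

lemma monomial_multisym_eq:
  "monomial_multisym ms e =
    (if fst ` Poly_Mapping.keys e \<subseteq> {..<length ms} \<and> (\<forall>j<length ms. block_exponents e j = mset (ms ! j)) then 1 else 0)"
  unfolding monomial_multisym_def foldr_monomial_sym[OF distinct_upt] by (simp add: atLeast0LessThan)

section \<open>Dominant exponents, one for each tuple of partitions\<close>

definition leading_monom :: "nat list list \<Rightarrow> (nat \<times> nat) monomial" where
  "leading_monom ms = (\<Sum>j<length ms. \<Sum>k<length (ms ! j). Poly_Mapping.single (j, k) (ms ! j ! k))"

lemma lookup_leading_monom:
  "Poly_Mapping.lookup (leading_monom ms) (j, k) = (if j < length ms then part (ms ! j) k else 0)"
proof -
  have "(\<Sum>k'<length (ms ! j'). if j' = j \<and> k' = k then ms ! j' ! k' else 0) =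
      (if j' = j then part (ms ! j) k else 0)" for j'
    by (auto simp: part_def)
  then show ?thesis
    by (simp add: leading_monom_def lookup_sum lookup_single when_def)
qed

lemma is_partition_pos: "is_partition p \<Longrightarrow> k < length p \<Longrightarrow> 0 < p ! k"
  by (metis is_partition_def gr0I nth_mem)

lemma is_partition_mset_unique:
  assumes "is_partition p" "is_partition q" "mset p = mset q"
  shows "p = q"
proof -
  have "sorted (rev p)" "sorted (rev q)"
    using assms by (simp_all add: is_partition_def sorted_wrt_rev)
  then have "rev p = rev q" using assms(3) by (metis mset_rev properties_for_sort)
  then show ?thesis by simp
qed

lemma partition_tuplesD:
  assumes "ms \<in> partition_tuples r"
  shows "length ms = r" "j < r \<Longrightarrow> is_partition (ms ! j)"
  using assms by (auto simp: partition_tuples_def)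

lemma block_exponents_leading:
  assumes ms: "ms \<in> partition_tuples r" and j: "j < r"
  shows "block_exponents (leading_monom ms) j = mset (ms ! j)"
proof -
  let ?p = "ms ! j"
  have "{x \<in> Poly_Mapping.keys (leading_monom ms). fst x = j} = Pair j ` {..<length ?p}"
    using is_partition_pos[of ?p] partition_tuplesD[OF ms] j
    by (force simp: in_keys_iff lookup_leading_monom part_def split: if_splits)
  then have "block_exponents (leading_monom ms) j =
      image_mset (Poly_Mapping.lookup (leading_monom ms) \<circ> Pair j) (mset_set {..<length ?p})"
    unfolding block_exponents_def by (simp add: image_mset_mset_set[symmetric] inj_on_def multiset.map_comp)
  also have "\<dots> = image_mset (nth ?p) (mset_set {..<length ?p})"
    using partition_tuplesD[OF ms] j by (intro image_mset_cong) (simp add: lookup_leading_monom part_def)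
  also have "mset_set {..<length ?p} = mset [0..<length ?p]"
    by (simp flip: atLeast0LessThan)
  also have "image_mset (nth ?p) (mset [0..<length ?p]) = mset ?p"
    by (metis map_nth mset_map)
  finally show ?thesis .
qed

lemma keys_leading_monom: "fst ` Poly_Mapping.keys (leading_monom ms) \<subseteq> {..<length ms}"
  by (auto simp: in_keys_iff lookup_leading_monom split: if_splits)

text \<open>At the leading monomials the coefficient matrix is the identity, so each coefficient of
  an expansion is read off at a single exponent.\<close>

lemma monomial_multisym_leading:
  assumes "ms \<in> partition_tuples r" "ms' \<in> partition_tuples r"
  shows "monomial_multisym ms' (leading_monom ms) = (if ms' = ms then 1 else 0)"
proof -
  have "(\<forall>j<r. mset (ms ! j) = mset (ms' ! j)) \<longleftrightarrow> ms' = ms"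
  proof
    assume "\<forall>j<r. mset (ms ! j) = mset (ms' ! j)"
    then have "ms' ! j = ms ! j" if "j < r" for j
      using that partition_tuplesD(2)[OF assms(1)] partition_tuplesD(2)[OF assms(2)]
      by (intro is_partition_mset_unique) simp_all
    then show "ms' = ms"
      using partition_tuplesD(1)[OF assms(1)] partition_tuplesD(1)[OF assms(2)]
      by (intro nth_equalityI) simp_all
  qed simp
  then show ?thesis
    using keys_leading_monom[of ms] partition_tuplesD[OF assms(1)] partition_tuplesD[OF assms(2)]
      block_exponents_leading[OF assms(1)]
    by (simp add: monomial_multisym_eq)
qed

lemma fst_transpose_block [simp]: "fst (transpose (j, k) (j, k') x) = fst x"
  by (auto simp: transpose_def)

lemma monomial_multisym_transpose:
  "monomial_multisym ms (rename_monom (transpose (j, k) (j, k')) e) = monomial_multisym ms e"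
proof -
  let ?t = "transpose (j, k) (j, k')"
  let ?e = "rename_monom ?t e"
  have "block_exponents ?e i = block_exponents e i" for i
  proof -
    let ?S = "{x \<in> Poly_Mapping.keys e. fst x = i}"
    have "{x \<in> Poly_Mapping.keys ?e. fst x = i} = ?t ` ?S"
      unfolding keys_rename_transpose by auto
    then have "block_exponents ?e i = image_mset (Poly_Mapping.lookup ?e \<circ> ?t) (mset_set ?S)"
      unfolding block_exponents_def
      by (simp add: image_mset_mset_set[symmetric] inj_on_subset[OF inj_transpose] multiset.map_comp)
    also have "\<dots> = block_exponents e i"
      unfolding block_exponents_def by (rule image_mset_cong) (simp add: lookup_rename_transpose)
    finally show ?thesis .
  qed
  moreover have "fst ` Poly_Mapping.keys ?e = fst ` Poly_Mapping.keys e"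
    unfolding keys_rename_transpose image_image by simp
  ultimately show ?thesis by (simp add: monomial_multisym_eq)
qed

lemma dominant_eq_leading_monom:
  assumes e: "fst ` Poly_Mapping.keys e \<subseteq> {..<r}"
    and dec: "\<And>j k. Poly_Mapping.lookup e (j, Suc k) \<le> Poly_Mapping.lookup e (j, k)"
  shows "\<exists>ms\<in>partition_tuples r. e = leading_monom ms"
proof -
  \<comment> \<open>The first vanishing exponent of block \<open>j\<close>: finite support provides
    one, and monotonicity makes all later exponents vanish.\<close>
  define L where "L j = (LEAST k. Poly_Mapping.lookup e (j, k) = 0)" for j
  define p where "p j = map (\<lambda>k. Poly_Mapping.lookup e (j, k)) [0..<L j]" for j
  define ms where "ms = map p [0..<r]"
  obtain N where N: "\<And>j k. (j, k) \<in> Poly_Mapping.keys e \<Longrightarrow> k < N" using bounded_index by blast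
  then have "Poly_Mapping.lookup e (j, N) = 0" for j by (force simp: in_keys_iff)
  then have L0: "Poly_Mapping.lookup e (j, L j) = 0" for j unfolding L_def by (rule LeastI)
  have anti: "Poly_Mapping.lookup e (j, k') \<le> Poly_Mapping.lookup e (j, k)" if "k \<le> k'" for j k k'
    using lift_Suc_antimono_le[of "\<lambda>k. Poly_Mapping.lookup e (j, k)"] dec that by blast
  have part_p: "part (p j) k = Poly_Mapping.lookup e (j, k)" for j k
    using anti[of "L j" k j] L0[of j] by (auto simp: part_def p_def)
  have "is_partition (p j)" for j
  proof -
    have pos: "Poly_Mapping.lookup e (j, k) \<noteq> 0" if "k < L j" for k
      using not_less_Least[of k "\<lambda>k. Poly_Mapping.lookup e (j, k) = 0"] that by (simp add: L_def)
    show ?thesis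
      unfolding is_partition_def p_def
      by (auto simp: sorted_wrt_map sorted_wrt_iff_nth_less anti simp del: neq0_conv dest!: pos)
  qed
  then have "ms \<in> partition_tuples r" by (auto simp: partition_tuples_def ms_def)
  moreover have "e = leading_monom ms"
  proof (rule poly_mapping_eqI)
    fix x :: "nat \<times> nat"
    obtain j k where x: "x = (j, k)" by (cases x)
    have "Poly_Mapping.lookup e (j, k) = 0" if "\<not> j < r"
      using e that by (force simp: in_keys_iff)
    then show "Poly_Mapping.lookup e x = Poly_Mapping.lookup (leading_monom ms) x"
      by (simp add: x lookup_leading_monom ms_def part_p)
  qed
  ultimately show ?thesis by blast
qed

text \<open>Sorting the exponents within each block by adjacent transpositions.\<close>

lemma invariant_eq_leading_monom:
  assumes "fst ` Poly_Mapping.keys e \<subseteq> {..<r}"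
  shows "\<exists>ms\<in>partition_tuples r. \<forall>f :: _ \<Rightarrow> int.
    (\<forall>j<r. \<forall>k e. f (rename_monom (transpose (j, k) (j, Suc k)) e) = f e) \<longrightarrow> f e = f (leading_monom ms)"
  using assms
proof (induction "\<Sum>x\<in>Poly_Mapping.keys e. snd x * Poly_Mapping.lookup e x" arbitrary: e rule: less_induct)
  case less
  show ?case
  proof (cases "\<forall>j k. Poly_Mapping.lookup e (j, Suc k) \<le> Poly_Mapping.lookup e (j, k)")
    case True
    then show ?thesis using dominant_eq_leading_monom[OF less.prems] by blast
  next
    case False
    \<comment> \<open>Moving the larger exponent to the smaller index decreases the index-weighted
      degree. The exponent at \<open>(j, Suc k)\<close> is nonzero, so \<open>j\<close> is one of
      the blocks where invariance is available.\<close>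
    then obtain j k where jk: "Poly_Mapping.lookup e (j, k) < Poly_Mapping.lookup e (j, Suc k)"
      by (auto simp: not_le)
    let ?t = "transpose (j, k) (j, Suc k)"
    let ?e = "rename_monom ?t e" and ?l = "Poly_Mapping.lookup e"
    have "(j, Suc k) \<in> Poly_Mapping.keys e" using jk by (simp add: in_keys_iff)
    then have j: "j < r" using less.prems by force
    let ?A = "Poly_Mapping.keys e \<union> {(j, k), (j, Suc k)}"
    have keys_sum: "(\<Sum>x\<in>Poly_Mapping.keys e. snd x * ?l x) = (\<Sum>x\<in>?A. snd x * ?l x)"
      by (rule sum.mono_neutral_left) (auto simp: in_keys_iff)
    have "(\<Sum>x\<in>Poly_Mapping.keys ?e. snd x * Poly_Mapping.lookup ?e x) = (\<Sum>x\<in>Poly_Mapping.keys e. snd (?t x) * ?l x)"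
      unfolding keys_rename_transpose
      by (subst sum.reindex) (simp_all add: inj_on_subset[OF inj_transpose] lookup_rename_transpose)
    also have "\<dots> = (\<Sum>x\<in>?A. snd (?t x) * ?l x)"
      by (rule sum.mono_neutral_left) (auto simp: in_keys_iff)
    finally have e'_sum: "(\<Sum>x\<in>Poly_Mapping.keys ?e. snd x * Poly_Mapping.lookup ?e x) = (\<Sum>x\<in>?A. snd (?t x) * ?l x)" .
    have "snd (?t x) * ?l x + (if x = (j, Suc k) then ?l (j, Suc k) else 0)
        = snd x * ?l x + (if x = (j, k) then ?l (j, k) else 0)" for x
      by (auto simp: transpose_def)
    then have "(\<Sum>x\<in>?A. snd (?t x) * ?l x + (if x = (j, Suc k) then ?l (j, Suc k) else 0))
        = (\<Sum>x\<in>?A. snd x * ?l x + (if x = (j, k) then ?l (j, k) else 0))"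
      by simp
    moreover have "(\<Sum>x\<in>?A. if x = (j, Suc k) then ?l (j, Suc k) else 0) = ?l (j, Suc k)"
      "(\<Sum>x\<in>?A. if x = (j, k) then ?l (j, k) else 0) = ?l (j, k)"
      by (subst sum.delta; simp)+
    ultimately have "(\<Sum>x\<in>?A. snd (?t x) * ?l x) + ?l (j, Suc k) = (\<Sum>x\<in>?A. snd x * ?l x) + ?l (j, k)"
      by (simp only: sum.distrib)
    then have "(\<Sum>x\<in>Poly_Mapping.keys ?e. snd x * Poly_Mapping.lookup ?e x) < (\<Sum>x\<in>Poly_Mapping.keys e. snd x * ?l x)"
      unfolding keys_sum e'_sum using jk by linarith
    moreover have "fst ` Poly_Mapping.keys ?e \<subseteq> {..<r}"
      using less.prems unfolding keys_rename_transpose image_image by simp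
    ultimately obtain ms where "ms \<in> partition_tuples r" "\<forall>f :: _ \<Rightarrow> int.
        (\<forall>j<r. \<forall>k e. f (rename_monom (transpose (j, k) (j, Suc k)) e) = f e) \<longrightarrow> f ?e = f (leading_monom ms)"
      using less.hyps[of ?e] by blast
    then show ?thesis using j by (intro bexI[of _ ms]) auto
  qed
qed

section \<open>Content of fillings and Kostka coefficients\<close>

lemma filling_values:
  assumes "\<tau> \<in> fillings ls" "b \<in> dg' (shape ls)"
  shows "\<exists>j k. \<tau> b = Letter j k \<and> j < length ls"
  using assms unfolding fillings_def by (force simp: PiE_iff)

lemma finite_dg' [simp]: "finite (dg' \<mu>)"
  by (simp add: dg'_eq_boxes)

text \<open>Since all entries are letters, \<open>unletter\<close> loses no information; variables
  outside the blocks have exponent 0 on both sides.\<close>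

lemma fillings_of_content_eq:
  assumes ms: "ms \<in> partition_tuples (length ls)"
  shows "fillings_of_content ms ls = {\<tau> \<in> fillings ls. content (dg' (shape ls)) (unletter \<circ> \<tau>) = leading_monom ms}"
proof -
  have "(\<forall>j<length ls. \<forall>k. card {u \<in> dg' (shape ls). \<tau> u = Letter j k} = part (ms ! j) k) \<longleftrightarrow>
      content (dg' (shape ls)) (unletter \<circ> \<tau>) = leading_monom ms" if \<tau>: "\<tau> \<in> fillings ls" for \<tau>
  proof -
    let ?c = "content (dg' (shape ls)) (unletter \<circ> \<tau>)"
    have letters: "\<exists>j k. \<tau> u = Letter j k \<and> j < length ls" if "u \<in> dg' (shape ls)" for u
      using filling_values[OF \<tau> that] .
    have "{u \<in> dg' (shape ls). (unletter \<circ> \<tau>) u = (j, k)} = {u \<in> dg' (shape ls). \<tau> u = Letter j k}" for j k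
      using letters by force
    then have c: "Poly_Mapping.lookup ?c (j, k) = card {u \<in> dg' (shape ls). \<tau> u = Letter j k}" for j k
      by (simp add: lookup_content)
    have c0: "Poly_Mapping.lookup ?c (j, k) = 0" if "\<not> j < length ls" for j k
      unfolding c using letters that by force
    show ?thesis
    proof
      assume a: "\<forall>j<length ls. \<forall>k. card {u \<in> dg' (shape ls). \<tau> u = Letter j k} = part (ms ! j) k"
      show "?c = leading_monom ms"
      proof (rule poly_mapping_eqI)
        fix x :: "nat \<times> nat"
        obtain j k where x: "x = (j, k)" by (cases x)
        show "Poly_Mapping.lookup ?c x = Poly_Mapping.lookup (leading_monom ms) x"
          using a c c0 partition_tuplesD[OF ms] by (simp add: x lookup_leading_monom)
      qed
    next
      assume "?c = leading_monom ms"
      then show "\<forall>j<length ls. \<forall>k. card {u \<in> dg' (shape ls). \<tau> u = Letter j k} = part (ms ! j) k"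
        using c partition_tuplesD[OF ms] by (metis lookup_leading_monom)
    qed
  qed
  then show ?thesis unfolding fillings_of_content_def by blast
qed

text \<open>Parts and lengths are bounded by the number of boxes. The counts thus form a finitely
  supported family, as the definition of the Kostka coefficients demands.\<close>

lemma finite_filling_contents:
  "finite {ms \<in> partition_tuples (length ls). filling_count ls (leading_monom ms) \<noteq> 0}"
proof (rule finite_subset)
  let ?d = "card (dg' (shape ls))"
  let ?P = "{p. set p \<subseteq> {..?d} \<and> length p \<le> ?d}"
  show "{ms \<in> partition_tuples (length ls). filling_count ls (leading_monom ms) \<noteq> 0}
      \<subseteq> {ms. set ms \<subseteq> ?P \<and> length ms = length ls}"
  proof
    fix ms assume "ms \<in> {ms \<in> partition_tuples (length ls). filling_count ls (leading_monom ms) \<noteq> 0}"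
    then have ms: "ms \<in> partition_tuples (length ls)" and "filling_count ls (leading_monom ms) \<noteq> 0" by auto
    then have "{\<tau> \<in> fillings ls. content (dg' (shape ls)) (unletter \<circ> \<tau>) = leading_monom ms} \<noteq> {}"
      unfolding filling_count_def by (metis card.empty)
    then obtain \<tau> where \<tau>: "content (dg' (shape ls)) (unletter \<circ> \<tau>) = leading_monom ms" by blast
    have bound: "Poly_Mapping.lookup (leading_monom ms) x \<le> ?d" for x
      unfolding \<tau>[symmetric] lookup_content[OF finite_dg'] by (intro card_mono) auto
    have keys: "card (Poly_Mapping.keys (leading_monom ms)) \<le> ?d"
      unfolding \<tau>[symmetric] keys_content[OF finite_dg'] by (intro card_image_le finite_dg')
    have "p \<in> ?P" if p: "p \<in> set ms" for p
    proof -
      obtain j where j: "j < length ms" "p = ms ! j" using p by (metis in_set_conv_nth)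
      then have p: "is_partition p" using partition_tuplesD[OF ms] by simp
      have "Pair j ` {..<length p} \<subseteq> Poly_Mapping.keys (leading_monom ms)"
        using j is_partition_pos[OF p] by (auto simp: in_keys_iff lookup_leading_monom part_def)
      then have "card (Pair j ` {..<length p}) \<le> ?d"
        using keys card_mono[OF finite_keys] by (meson le_trans)
      then have "length p \<le> ?d" by (simp add: card_image inj_on_def)
      moreover have "x \<le> ?d" if "x \<in> set p" for x
      proof -
        obtain k where "k < length p" "x = p ! k" using \<open>x \<in> set p\<close> by (metis in_set_conv_nth)
        then show ?thesis using bound[of "(j, k)"] j by (simp add: lookup_leading_monom part_def)
      qed
      ultimately show ?thesis by auto
    qed
    then show "ms \<in> {ms. set ms \<subseteq> ?P \<and> length ms = length ls}"
      using partition_tuplesD[OF ms] by blast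
  qed
  show "finite {ms. set ms \<subseteq> ?P \<and> length ms = length ls}"
    by (intro finite_lists_length_eq finite_lists_length_le) simp
qed

text \<open>Evaluation at leading monomials forces each coefficient of an expansion, hence
  uniqueness. For existence, both sides are invariant under adjacent transpositions within the
  blocks and therefore determined by their values there.\<close>

lemma multi_kostka_eq_filling_count:
  assumes ls: "ls \<in> partition_tuples r" and mus: "mus \<in> partition_tuples r"
  shows "multi_kostka ls mus = int (filling_count ls (leading_monom mus))"
proof -
  have r: "length ls = r" using ls by (simp add: partition_tuples_def)
  let ?c = "\<lambda>e. int (filling_count ls e)"
  let ?E = "\<lambda>K :: nat list list \<Rightarrow>\<^sub>0 int. \<lambda>e.
      \<Sum>ms\<in>Poly_Mapping.keys K. Poly_Mapping.lookup K ms * monomial_multisym ms e"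
  let ?Q = "\<lambda>K. Poly_Mapping.keys K \<subseteq> partition_tuples r \<and> (\<forall>e. ?c e = ?E K e)"
  define f where "f ms = (if ms \<in> partition_tuples r then ?c (leading_monom ms) else 0)" for ms
  define K where "K = Abs_poly_mapping f"
  have "{ms. f ms \<noteq> 0} = {ms \<in> partition_tuples (length ls). filling_count ls (leading_monom ms) \<noteq> 0}"
    by (auto simp: f_def r)
  then have lookup_K: "Poly_Mapping.lookup K = f"
    using finite_filling_contents unfolding K_def by (intro lookup_Abs_poly_mapping) simp
  have eval: "?E K' (leading_monom ms) = Poly_Mapping.lookup K' ms"
    if K': "Poly_Mapping.keys K' \<subseteq> partition_tuples r" and ms: "ms \<in> partition_tuples r" for K' ms
  proof -
    have "?E K' (leading_monom ms) = (\<Sum>ms'\<in>Poly_Mapping.keys K'. if ms' = ms then Poly_Mapping.lookup K' ms else 0)"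
      using monomial_multisym_leading[OF ms] K' by (intro sum.cong) auto
    then show ?thesis by (simp add: in_keys_iff)
  qed
  have keys_K: "Poly_Mapping.keys K \<subseteq> partition_tuples r"
    by (auto simp: in_keys_iff lookup_K f_def split: if_splits)
  have "?c e = ?E K e" for e
  proof (cases "fst ` Poly_Mapping.keys e \<subseteq> {..<r}")
    case True
    \<comment> \<open>The same \<open>ms\<close> serves every invariant function, here both the
      filling count and the expansion.\<close>
    obtain ms where ms: "ms \<in> partition_tuples r" and inv: "\<And>g :: _ \<Rightarrow> int.
      (\<forall>j<r. \<forall>k e. g (rename_monom (transpose (j, k) (j, Suc k)) e) = g e) \<Longrightarrow> g e = g (leading_monom ms)"
      using invariant_eq_leading_monom[OF True] by blast
    have "?c e = ?c (leading_monom ms)"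
      using filling_count_transpose[of _ ls] r by (intro inv) simp
    also have "\<dots> = ?E K (leading_monom ms)"
      using eval[OF keys_K ms] ms by (simp add: lookup_K f_def)
    also have "\<dots> = ?E K e"
      by (rule inv[symmetric]) (simp add: monomial_multisym_transpose)
    finally show ?thesis .
  next
    case False
    then obtain x where x: "x \<in> Poly_Mapping.keys e" "\<not> fst x < r" by blast
    have "{\<tau> \<in> fillings ls. content (dg' (shape ls)) (unletter \<circ> \<tau>) = e} = {}"
    proof (intro equals0I, clarify)
      fix \<tau> assume \<tau>: "\<tau> \<in> fillings ls" and e: "e = content (dg' (shape ls)) (unletter \<circ> \<tau>)"
      obtain b where b: "b \<in> dg' (shape ls)" "x = unletter (\<tau> b)"
        using x(1) unfolding e keys_content[OF finite_dg'] by auto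
      then obtain j k where "\<tau> b = Letter j k" "j < length ls" using filling_values[OF \<tau>] by blast
      then show False using x(2) b r by simp
    qed
    then have "?c e = 0" unfolding filling_count_def by (simp only: card.empty of_nat_0)
    moreover have "monomial_multisym ms e = 0" if "ms \<in> Poly_Mapping.keys K" for ms
    proof -
      have "length ms = r" using keys_K that partition_tuplesD(1) by blast
      then show ?thesis using False by (simp only: monomial_multisym_eq simp_thms if_False)
    qed
    ultimately show ?thesis by simp
  qed
  then have Q: "?Q K" using keys_K by blast
  have "K' = K" if "?Q K'" for K'
  proof (rule poly_mapping_eqI)
    fix ms
    show "Poly_Mapping.lookup K' ms = Poly_Mapping.lookup K ms"
    proof (cases "ms \<in> partition_tuples r")
      case True
      then show ?thesis using eval[OF _ True, of K'] eval[OF _ True, of K] that Q by metis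
    next
      case False
      then show ?thesis using that keys_K by (metis in_keys_iff subsetD)
    qed
  qed
  then have "(THE K. ?Q K) = K" using Q by (intro the_equality) blast+
  moreover have "multi_schur ls = ?c"
    using multi_schur_eq_filling_count by blast
  ultimately have "multi_kostka ls = f"
    unfolding multi_kostka_def r by (simp only: lookup_K)
  then show ?thesis using mus by (simp add: f_def)
qed

theorem mainTheorem2:
  fixes r :: nat and mus lams :: "nat list list"
  assumes "mus \<in> partition_tuples r" and "lams \<in> partition_tuples r"
  shows "multi_kostka lams mus = int (card (fillings_of_content mus lams))"
proof -
  have "length lams = r" using assms(2) by (simp add: partition_tuples_def)
  then have "fillings_of_content mus lams =
      {\<tau> \<in> fillings lams. content (dg' (shape lams)) (unletter \<circ> \<tau>) = leading_monom mus}"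
    using assms(1) by (intro fillings_of_content_eq) simp
  then show ?thesis
    unfolding multi_kostka_eq_filling_count[OF assms(2,1)] filling_count_def by simp
qed

end
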